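(* Let $\mathcal{S}$ be a proper partial geometry $pg(s,t,\alpha)$ with $2\le\alpha\leq 1000$ that admits an abelian Singer group $G$ such that the pair $(\mathcal{S},G)$ is of rigid type. Then either $\mathcal{S}$ is (isomorphic to) the Van Lint–Schrijver partial geometry, or the parameters $(s,t,\alpha)$ of $\mathcal{S}$ are one of $(11,23,3)$, $(39,39,15)$, $(272,272,104)$, $(2295,4591,615)$.
   Context: A proper partial geometry $pg(s,t,\alpha)$ is a finite point-line geometry such that each line contains $s+1$ points, each point is on $t+1$ lines, each pair of distinct lines intersects in at most one point, and, for every point $x$ and every line $L$ not containing $x$, there are exactly $\alpha$ lines through $x$ that intersect $L$, where $0<\alpha<\min(s,t)$. An abelian Singer group of $\mathcal{S}$ is an abelian group $G$ of automorphisms of $\mathcal{S}$ acting sharply transitively (regularly) on the points of $\mathcal{S}$. The pair $(\mathcal{S},G)$ is of rigid type if every line of $\mathcal{S}$ has trivial (setwise) stabilizer in $G$. The Van Lint–Schrijver partial geometry is the following $pg(5,5,2)$: let $\gamma$ be a primitive fifth root of unity in the finite field $\mathbb{F}_{81}$; the points are the elements of $\mathbb{F}_{81}$ and the lines are the $81$ sets $\{b,\,b+1,\,b+\gamma,\,b+\gamma^2,\,b+\gamma^3,\,b+\gamma^4\}$ with $b\in\mathbb{F}_{81}$. *)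

theory Defs
  imports "HOL-Algebra.Bij" "HOL-Algebra.Multiplicative_Group"
begin

text \<open>A line is identified with the set of points on it. In a proper partial geometry this loses
  nothing: a line carries at least three points and two distinct lines share at most one.\<close>

record 'a geometry =
  points :: "'a set"
  lines :: "'a set set"

locale partial_geometry =
  fixes S :: "'a geometry" and s t \<alpha> :: nat
  assumes finite_points: "finite (points S)"
    and points_nonempty: "points S \<noteq> {}"
    and line_subset: "\<And>l. l \<in> lines S \<Longrightarrow> l \<subseteq> points S"
    and card_line: "\<And>l. l \<in> lines S \<Longrightarrow> card l = s + 1"
    and card_lines_through: "\<And>x. x \<in> points S \<Longrightarrow> card {l \<in> lines S. x \<in> l} = t + 1"
    and card_inter: "\<And>l m. l \<in> lines S \<Longrightarrow> m \<in> lines S \<Longrightarrow> l \<noteq> m \<Longrightarrow> card (l \<inter> m) \<le> 1"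
    and card_meeting: "\<And>x l. x \<in> points S \<Longrightarrow> l \<in> lines S \<Longrightarrow> x \<notin> l \<Longrightarrow>
          card {m \<in> lines S. x \<in> m \<and> m \<inter> l \<noteq> {}} = \<alpha>"

locale proper_partial_geometry = partial_geometry +
  assumes alpha_pos: "0 < \<alpha>"
    and alpha_less: "\<alpha> < min s t"

definition geometry_iso :: "('a \<Rightarrow> 'b) \<Rightarrow> 'a geometry \<Rightarrow> 'b geometry \<Rightarrow> bool" where
  "geometry_iso f S T \<longleftrightarrow>
     bij_betw f (points S) (points T) \<and> (\<lambda>l. f ` l) ` lines S = lines T"

definition isomorphic :: "'a geometry \<Rightarrow> 'b geometry \<Rightarrow> bool" where
  "isomorphic S T \<longleftrightarrow> (\<exists>f. geometry_iso f S T)"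

definition aut_group :: "'a geometry \<Rightarrow> ('a \<Rightarrow> 'a) monoid" where
  "aut_group S = (BijGroup (points S))
     \<lparr>carrier := {f \<in> Bij (points S). geometry_iso f S S}\<rparr>"

definition abelian_singer_group :: "'a geometry \<Rightarrow> ('a \<Rightarrow> 'a) set \<Rightarrow> bool" where
  "abelian_singer_group S G \<longleftrightarrow>
     subgroup G (aut_group S) \<and>
     comm_group ((aut_group S)\<lparr>carrier := G\<rparr>) \<and>
     (\<forall>x \<in> points S. \<forall>y \<in> points S. \<exists>!g. g \<in> G \<and> g x = y)"

definition rigid_type :: "'a geometry \<Rightarrow> ('a \<Rightarrow> 'a) set \<Rightarrow> bool" where
  "rigid_type S G \<longleftrightarrow> (\<forall>l \<in> lines S. {g \<in> G. g ` l = l} = {\<one>\<^bsub>aut_group S\<^esub>})"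

definition primitive_root_of_unity :: "('k, 'm) ring_scheme \<Rightarrow> nat \<Rightarrow> 'k \<Rightarrow> bool" where
  "primitive_root_of_unity K n \<gamma> \<longleftrightarrow>
     \<gamma> \<in> carrier (mult_of K) \<and> group.ord (mult_of K) \<gamma> = n"

definition van_lint_schrijver :: "('k, 'm) ring_scheme \<Rightarrow> 'k \<Rightarrow> 'k geometry" where
  "van_lint_schrijver K \<gamma> =
     \<lparr>points = carrier K,
      lines = {{b, b \<oplus>\<^bsub>K\<^esub> \<one>\<^bsub>K\<^esub>, b \<oplus>\<^bsub>K\<^esub> \<gamma>, b \<oplus>\<^bsub>K\<^esub> \<gamma> [^]\<^bsub>K\<^esub> (2::nat),
                b \<oplus>\<^bsub>K\<^esub> \<gamma> [^]\<^bsub>K\<^esub> (3::nat), b \<oplus>\<^bsub>K\<^esub> \<gamma> [^]\<^bsub>K\<^esub> (4::nat)} | b. b \<in> carrier K}\<rparr>"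

text \<open>The field of order 81 is unique up to isomorphism, and every primitive fifth root of unity has
  the same set of powers, so the choice of K and \<open>\<gamma>\<close> is immaterial. Since K is finite it can be
  taken with carrier in the natural numbers, which avoids quantifying over types.\<close>

definition is_van_lint_schrijver :: "'a geometry \<Rightarrow> bool" where
  "is_van_lint_schrijver S \<longleftrightarrow>
     (\<exists>(K :: nat ring) \<gamma>. field K \<and> order K = 81 \<and> primitive_root_of_unity K 5 \<gamma> \<and>
        isomorphic S (van_lint_schrijver K \<gamma>))"

end

theory Submission
  imports Defs "HOL-Algebra.Sylow" "HOL-Algebra.Weak_Morphisms" "HOL-Number_Theory.Residues"
    "Jordan_Normal_Form.Char_Poly" "HOL-Library.Countable"
begin

text \<open>Fix a point $p$. Since $G$ acts regularly on the points, a point is the same thing as an element of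
$G$, and the geometry is recorded by the function $E$ on $G$ for which $E(g)$ is the number of lines
through $p$ and $g p$: it is $t+1$ at the identity, and $1$ or $0$ elsewhere according to whether
the two points are collinear. Counting chains of two lines shows that $E * E = q E + \mu$ in the
group algebra, where $q = s+t+1-\alpha$ and $\mu = \alpha(t+1)$ (\<open>E_conv\<close>). Rigidity says
that all orbits of $G$ on the lines are regular; if there are $n$ of them then $t+1 = n(s+1)$.

Three properties of such a function $E$ on an abelian group restrict the parameters.
\<^item> Integrality. Up to a constant, the convolution of $E$ with the indicator of a subgroup $H$ is a
  multiple of an idempotent of the group algebra. The rational coefficients of an idempotent become
  integers after multiplication by $|G|$, because they are combinations of roots of unity whose
  multiplicities are ranks. Hence the sum of $E$ over each coset of $H$ satisfies a congruence
  modulo $q$ (Benson's theorem, \<open>coset_sum_cong\<close>). The trivial subgroup gives that $q$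
  divides both $|G|$ and the sum $K = (s+1)(t+1)$ of all values of $E$.
\<^item> Frobenius. Modulo a prime $p$, the $p^k$-th convolution power of $E$ lives on the $p^k$-th powers
  of $G$. This gives that every prime divisor of $|G|$ divides $q$ (\<open>prime_dvd_q\<close>), and that
  $E(g^j) = E(g)$ whenever $j$ is prime to $|G|$ (\<open>E_power_map\<close>).
\<^item> Variance. For a Hall subgroup the congruence makes the coset sums divisible by a large factor of
  $q$. The quotients $y$ are integers whose first two moments are known, and the inequality
  $(y-k)(y-k-1) \ge 0$, summed over the group, is a strong condition (\<open>hall_inequality\<close>).

The divisibility conditions parametrise $(s,t,\alpha)$ by five integers
(\<open>benson_parametrisation\<close>). For $\alpha \le 1000$ a finite search over these integers leaves
the infinite family $s + 1 = \alpha(\alpha+1)$, $n = \alpha-1$ and eighteen further triples. The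
variance condition excludes all $\alpha > 3$ in the family (\<open>family_alpha_le_3\<close>) and all but
four of the other triples. One of these four, $(1869,1869,714)$, falls to a parity argument which uses
the invariance of $E$ under a power map that inverts the elements of $5$-power order and fixes those
of $11$-power order (\<open>not_1_1870_714\<close>). What remains are the four triples of the theorem
and $(5,5,2)$.

In the case $(5,5,2)$ one has $|G| = 81$, and the elements of $G$ that move $p$ along one line
through $p$ form a set $B$ of six elements with $1 \in B$. The condition $\alpha = 2$ says that a point
off this line is collinear with exactly two of its points. Since $G$ is abelian, the point $x y / k$
with $x, y, k$ distinct in $B$ is collinear with $x$ and $y$, hence with no other point of $B$; following this observation
shows that all elements of $B$ have cube $1$ and that the product of the six is $1$
(\<open>cube_B\<close>, \<open>zero_sum\<close>). As $B$ generates $G$, these relations identify $G$ with the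
additive group of the field of order $81$ in such a way that $B$ becomes zero together with the five
powers of a fifth root of unity $\gamma$, written in the basis $1, \gamma, \gamma^2, \gamma^3$.\<close>

section \<open>Sums invariant under a map of prime power order\<close>

lemma fixpoint_funpow: "f y = y \<Longrightarrow> (f ^^ k) y = y"
  by (induction k) auto

lemma funpow_mult_fixed:
  assumes "(f ^^ n) x = x"
  shows "(f ^^ (k * n)) x = x"
  using assms by (induction k) (auto simp: funpow_add)

lemma prime_period_trivial:
  assumes p: "prime (p::nat)" and per: "(f ^^ p) x = x" and j: "(f ^^ j) x = x" and "0 < j" "j < p"
  shows "f x = x"
proof -
  have "coprime j p"
    using assms by (metis coprime_commute dvd_imp_le not_le prime_imp_coprime)
  then obtain a where a: "[j * a = 1] (mod p)"
    using cong_solve_coprime_nat[of j p] by auto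
  moreover have "p > 1" using p prime_gt_1_nat by blast
  ultimately have "(j * a) mod p = 1" by (simp add: cong_def)
  then have eq: "a * j = (j * a div p) * p + 1"
    by (metis div_mult_mod_eq mult.commute)
  have "x = (f ^^ (a * j)) x" using funpow_mult_fixed[OF j] by simp
  also have "\<dots> = (f ^^ (1 + (j * a div p) * p)) x" using eq by (simp add: add.commute)
  also have "\<dots> = f x" using funpow_mult_fixed[OF per] by (simp only: funpow_add) simp
  finally show ?thesis by simp
qed

text \<open>The orbits have length 1 or p, and the weight is constant on each of them; so those of length p contribute
  multiples of p.\<close>
lemma sum_prime_action_cong:
  fixes w :: "'a \<Rightarrow> int"
  assumes "prime p" "finite S" "\<And>x. x \<in> S \<Longrightarrow> f x \<in> S"
    and "\<And>x. x \<in> S \<Longrightarrow> (f ^^ p) x = x" and "\<And>x. x \<in> S \<Longrightarrow> w (f x) = w x"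
  shows "[sum w S = sum w {x \<in> S. f x = x}] (mod int p)"
  using assms(2-5)
proof (induction "card S" arbitrary: S rule: less_induct)
  case less
  show ?case
  proof (cases "\<exists>x\<in>S. f x \<noteq> x")
    case False
    then have "{x \<in> S. f x = x} = S" by auto
    then show ?thesis by simp
  next
    case True
    then obtain x where x: "x \<in> S" "f x \<noteq> x" by blast
    define Orb where "Orb = (\<lambda>i. (f ^^ i) x) ` {..<p}"
    have p0: "p > 0" using assms(1) prime_gt_0_nat by blast
    have iter: "(f ^^ i) x \<in> S" for i using x(1) less.prems(2) by (induction i) auto
    have witer: "w ((f ^^ i) x) = w x" for i
      using iter less.prems(4) by (induction i) auto
    have inj: "inj_on (\<lambda>i. (f ^^ i) x) {..<p}"
    proof (rule linorder_inj_onI)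
      fix i j assume ij: "i < j" "i \<in> {..<p}" "j \<in> {..<p}"
      show "(f ^^ i) x \<noteq> (f ^^ j) x"
      proof
        assume "(f ^^ i) x = (f ^^ j) x"
        then have "(f ^^ (p - i)) ((f ^^ i) x) = (f ^^ (p - i)) ((f ^^ j) x)" by simp
        then have "(f ^^ p) x = (f ^^ (p - i + j)) x"
          using ij by (simp flip: funpow_add add: funpow_add[symmetric, THEN fun_cong, unfolded o_def])
        moreover have "p - i + j = (j - i) + p" using ij by auto
        ultimately have "(f ^^ (j - i)) x = x"
          using less.prems(3)[OF x(1)] by (simp add: funpow_add)
        moreover have "0 < j - i" "j - i < p" using ij by auto
        ultimately show False
          using prime_period_trivial[OF assms(1) less.prems(3)[OF x(1)]] x(2) by blast
      qed
    qed auto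
    have sub: "Orb \<subseteq> S" unfolding Orb_def using iter by auto
    have fOrb: "f y \<in> Orb" if "y \<in> Orb" for y
    proof -
      obtain i where i: "i < p" "y = (f ^^ i) x" using \<open>y \<in> Orb\<close> unfolding Orb_def by auto
      show ?thesis
      proof (cases "Suc i = p")
        case True
        then have "f y = x" using i less.prems(3)[OF x(1)] by auto
        then show ?thesis unfolding Orb_def using p0 by (intro image_eqI[of _ _ 0]) auto
      next
        case False
        then show ?thesis unfolding Orb_def using i by (intro image_eqI[of _ _ "Suc i"]) auto
      qed
    qed
    have perY: "(f ^^ p) y = y" if "y \<in> S" for y using less.prems(3) that by blast
    have backwards: "y \<in> Orb" if "y \<in> S" "f y \<in> Orb" for y
    proof -
      have "(f ^^ k) z \<in> Orb" if "z \<in> Orb" for k z using that fOrb by (induction k) auto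
      then have "(f ^^ (p - 1)) (f y) \<in> Orb" using that by blast
      moreover have "(f ^^ (p - 1)) (f y) = (f ^^ p) y"
        using p0 by (metis Suc_diff_1 comp_apply funpow_Suc_right)
      ultimately show ?thesis using perY[OF that(1)] by simp
    qed
    have nofix: "f y \<noteq> y" if "y \<in> Orb" for y
    proof
      assume fy: "f y = y"
      obtain i where i: "i < p" "y = (f ^^ i) x" using \<open>y \<in> Orb\<close> unfolding Orb_def by auto
      have "(f ^^ (p - i)) y = y" using fy by (rule fixpoint_funpow)
      moreover have "(f ^^ (p - i)) y = x"
      proof -
        have "(f ^^ (p - i)) ((f ^^ i) x) = (f ^^ (p - i + i)) x" by (simp only: funpow_add o_apply)
        then show ?thesis using i perY[OF x(1)] by simp
      qed
      ultimately show False using fy x by simp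
    qed
    have fin: "finite Orb" unfolding Orb_def by simp
    have "card (S - Orb) < card S"
      using less.prems(1) sub fin p0 inj by (intro psubset_card_mono) (auto simp: Orb_def)
    then have IH: "[sum w (S - Orb) = sum w {x \<in> S - Orb. f x = x}] (mod int p)"
      using less.prems backwards by (intro less.hyps) auto
    have "sum w S = sum w (S - Orb) + sum w Orb"
      using sum.subset_diff[OF sub less.prems(1)] .
    also have "sum w Orb = int p * w x"
      unfolding Orb_def by (subst sum.reindex[OF inj]) (simp add: witer)
    finally have "sum w S = sum w (S - Orb) + int p * w x" .
    moreover have "{x \<in> S - Orb. f x = x} = {x \<in> S. f x = x}" using nofix by auto
    ultimately show ?thesis using IH by (simp add: cong_def)
  qed
qed

text \<open>The points fixed by \<open>f ^^ (p ^ k)\<close> reduce to those fixed by \<open>f ^^ (p ^ (k - 1))\<close>, a map of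
  order dividing p, by the prime case; the claim follows by induction.\<close>
lemma sum_prime_power_action_cong:
  fixes w :: "'a \<Rightarrow> int"
  assumes "prime p" "finite S" "\<And>x. x \<in> S \<Longrightarrow> f x \<in> S"
    and "\<And>x. x \<in> S \<Longrightarrow> (f ^^ (p ^ k)) x = x" and "\<And>x. x \<in> S \<Longrightarrow> w (f x) = w x"
  shows "[sum w S = sum w {x \<in> S. f x = x}] (mod int p)"
  using assms(2-5)
proof (induction k arbitrary: S)
  case 0
  then have "{x \<in> S. f x = x} = S" by auto
  then show ?case by simp
next
  case (Suc k)
  define S' where "S' = {x \<in> S. (f ^^ (p ^ k)) x = x}"
  have iter: "(f ^^ i) x \<in> S" if "x \<in> S" for i x using that Suc.prems(2) by (induction i) auto
  have "w ((f ^^ i) x) = w x" if "x \<in> S" for i x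
    using that iter Suc.prems(4) by (induction i) auto
  then have "[sum w S = sum w S'] (mod int p)"
    unfolding S'_def using Suc.prems iter
    by (intro sum_prime_action_cong[OF assms(1)]) (auto simp: funpow_mult mult.commute)
  also have "[sum w S' = sum w {x \<in> S'. f x = x}] (mod int p)"
  proof (intro Suc.IH)
    show "f x \<in> S'" if "x \<in> S'" for x
      using that Suc.prems(2) unfolding S'_def by (auto simp flip: funpow_swap1)
  qed (use Suc.prems in \<open>auto simp: S'_def\<close>)
  also have "{x \<in> S'. f x = x} = {x \<in> S. f x = x}"
    by (auto simp: S'_def fixpoint_funpow)
  finally show ?case .
qed

section \<open>Convolution powers on an abelian group\<close>

lemma rotate1_fixed_imp_constant:
  "rotate1 xs = xs \<Longrightarrow> xs = replicate (length xs) (hd xs)"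
proof -
  have *: "ys @ [x] = x # ys \<Longrightarrow> ys = replicate (length ys) x" for ys :: "'a list" and x
    by (induction ys arbitrary: x) auto
  show "rotate1 xs = xs \<Longrightarrow> xs = replicate (length xs) (hd xs)"
    using * by (cases xs) auto
qed

context comm_group
begin

definition list_product :: "'a list \<Rightarrow> 'a" where
  "list_product xs = foldr (\<otimes>) xs \<one>"

lemma list_product_simps [simp]:
  "list_product [] = \<one>" "list_product (x # xs) = x \<otimes> list_product xs"
  by (simp_all add: list_product_def)

lemma list_product_closed [simp]:
  "set xs \<subseteq> carrier G \<Longrightarrow> list_product xs \<in> carrier G"
  by (induction xs) auto

lemma list_product_append:
  "set xs \<subseteq> carrier G \<Longrightarrow> set ys \<subseteq> carrier G \<Longrightarrow>
    list_product (xs @ ys) = list_product xs \<otimes> list_product ys"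
  by (induction xs) (auto simp: m_assoc)

lemma list_product_rotate1:
  "set xs \<subseteq> carrier G \<Longrightarrow> list_product (rotate1 xs) = list_product xs"
  by (cases xs) (auto simp: list_product_append m_comm)

lemma list_product_replicate:
  "x \<in> carrier G \<Longrightarrow> list_product (replicate n x) = x [^] n"
  by (induction n) (auto simp: m_comm)

definition factorisations :: "nat \<Rightarrow> 'a \<Rightarrow> 'a list set" where
  "factorisations N g = {xs. set xs \<subseteq> carrier G \<and> length xs = N \<and> list_product xs = g}"

text \<open>The N-fold convolution power of E, expanded into a sum over all factorisations. This form makes the action
  of the cyclic group by rotation of the factors available.\<close>
definition conv_power :: "('a \<Rightarrow> int) \<Rightarrow> nat \<Rightarrow> 'a \<Rightarrow> int" where
  "conv_power E N g = (\<Sum>xs\<in>factorisations N g. prod_list (map E xs))"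

lemma finite_factorisations:
  "finite (carrier G) \<Longrightarrow> finite (factorisations N g)"
  unfolding factorisations_def
  by (rule finite_subset[OF _ finite_lists_length_eq[of "carrier G" N]]) auto

lemma conv_power_one:
  assumes "g \<in> carrier G"
  shows "conv_power E 1 g = E g"
proof -
  have "factorisations 1 g = {[g]}"
    using assms by (auto simp: factorisations_def length_Suc_conv)
  then show ?thesis by (simp add: conv_power_def)
qed

lemma conv_power_Suc:
  assumes fin: "finite (carrier G)" and g: "g \<in> carrier G"
  shows "conv_power E (Suc N) g = (\<Sum>x\<in>carrier G. E x * conv_power E N (inv x \<otimes> g))"
proof -
  have *: "x \<otimes> y = g \<longleftrightarrow> y = inv x \<otimes> g" if "x \<in> carrier G" "y \<in> carrier G" for x y
    using that g by (metis inv_solve_left)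
  have "bij_betw (\<lambda>(x, xs). x # xs) (SIGMA x:carrier G. factorisations N (inv x \<otimes> g)) (factorisations (Suc N) g)"
    by (rule bij_betw_byWitness[where f' = "\<lambda>xs. (hd xs, tl xs)"])
       (auto simp: factorisations_def length_Suc_conv g simp flip: m_assoc)
  then have "conv_power E (Suc N) g =
      (\<Sum>(x, xs)\<in>(SIGMA x:carrier G. factorisations N (inv x \<otimes> g)). prod_list (map E (x # xs)))"
    unfolding conv_power_def by (subst sum.reindex_bij_betw[symmetric]) (auto simp: case_prod_unfold)
  also have "\<dots> = (\<Sum>x\<in>carrier G. \<Sum>xs\<in>factorisations N (inv x \<otimes> g). prod_list (map E (x # xs)))"
    by (subst sum.Sigma) (auto simp: fin finite_factorisations)
  finally show ?thesis by (simp add: conv_power_def sum_distrib_left)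
qed

text \<open>Rotation of the factors preserves the product because the group is abelian, and only constant lists are
  fixed. So modulo p the convolution power keeps nothing but the terms $E(y)^{p^k}$ with $y^{p^k} = g$.\<close>
lemma conv_power_Frobenius:
  assumes fin: "finite (carrier G)" and p: "prime p" and g: "g \<in> carrier G"
  shows "[conv_power E (p ^ k) g = (\<Sum>y\<in>{y \<in> carrier G. y [^] (p ^ k) = g}. E y ^ (p ^ k))] (mod int p)"
proof -
  let ?S = "factorisations (p ^ k) g"
  let ?R = "{y \<in> carrier G. y [^] (p ^ k) = g}"
  have N: "p ^ k > 0" using p prime_gt_0_nat by simp
  have "[conv_power E (p ^ k) g = (\<Sum>xs\<in>{xs \<in> ?S. rotate1 xs = xs}. prod_list (map E xs))] (mod int p)"
    unfolding conv_power_def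
  proof (rule sum_prime_power_action_cong[OF p finite_factorisations[OF fin], where k = k])
    show "(rotate1 ^^ p ^ k) xs = xs" if "xs \<in> ?S" for xs
      using that by (simp add: factorisations_def flip: rotate_def)
    show "prod_list (map E (rotate1 xs)) = prod_list (map E xs)" for xs
      by (cases xs) auto
  qed (auto simp: factorisations_def list_product_rotate1)
  also have "bij_betw (replicate (p ^ k)) ?R {xs \<in> ?S. rotate1 xs = xs}"
  proof (rule bij_betw_byWitness[where f' = hd])
    show "hd ` {xs \<in> ?S. rotate1 xs = xs} \<subseteq> ?R"
    proof
      fix y assume "y \<in> hd ` {xs \<in> ?S. rotate1 xs = xs}"
      then obtain xs where xs: "xs \<in> ?S" "rotate1 xs = xs" "y = hd xs" by auto
      then have "xs = replicate (p ^ k) y" using rotate1_fixed_imp_constant[of xs] by (simp add: factorisations_def)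
      moreover from this xs(1) N have "y \<in> carrier G" by (auto simp: factorisations_def)
      ultimately show "y \<in> ?R" using xs(1) list_product_replicate[of y "p ^ k"] by (auto simp: factorisations_def)
    qed
    show "\<forall>xs\<in>{xs \<in> ?S. rotate1 xs = xs}. replicate (p ^ k) (hd xs) = xs"
      using rotate1_fixed_imp_constant by (force simp: factorisations_def)
    show "replicate (p ^ k) ` ?R \<subseteq> {xs \<in> ?S. rotate1 xs = xs}"
      using N by (auto simp: factorisations_def list_product_replicate rotate1_replicate)
  qed (use N in auto)
  then have "(\<Sum>xs\<in>{xs \<in> ?S. rotate1 xs = xs}. prod_list (map E xs)) = (\<Sum>y\<in>?R. prod_list (map E (replicate (p ^ k) y)))"
    by (rule sum.reindex_bij_betw[symmetric])
  also have "\<dots> = (\<Sum>y\<in>?R. E y ^ (p ^ k))" by (simp add: prod_list_replicate)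
  finally show ?thesis .
qed

end

section \<open>Integrality of rational idempotents\<close>

text \<open>The trace of an idempotent matrix is its rank. A nonzero entry gives a column $u$ and a row $w$ with
  $w u = 1$, normalised so that $A u = u$ and $w A = w$; subtracting the rank one idempotent $u w$ leaves an
  idempotent with fewer nonzero columns and a trace that is smaller by one.\<close>
lemma idempotent_trace_nat:
  fixes A :: "'a \<Rightarrow> 'a \<Rightarrow> complex"
  assumes fin: "finite X"
    and idem: "\<And>x z. x \<in> X \<Longrightarrow> z \<in> X \<Longrightarrow> (\<Sum>y\<in>X. A x y * A y z) = A x z"
  shows "\<exists>k::nat. (\<Sum>x\<in>X. A x x) = of_nat k"
  using idem
proof (induction "card {y \<in> X. \<exists>x\<in>X. A x y \<noteq> 0}" arbitrary: A rule: less_induct)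
  case less
  show ?case
  proof (cases "\<exists>y\<in>X. \<exists>x\<in>X. A x y \<noteq> 0")
    case False
    then have "(\<Sum>x\<in>X. A x x) = of_nat 0" by (simp add: sum.neutral)
    then show ?thesis by blast
  next
    case True
    then obtain x0 y0 where xy: "x0 \<in> X" "y0 \<in> X" "A x0 y0 \<noteq> 0" by blast
    define u where "u x = A x y0 / A x0 y0" for x
    define w where "w y = A x0 y" for y
    define B where "B x y = A x y - u x * w y" for x y
    have Au: "(\<Sum>y\<in>X. A x y * u y) = u x" if "x \<in> X" for x
      using less.prems[OF that xy(2)] by (simp add: u_def flip: sum_divide_distrib)
    have wA: "(\<Sum>y\<in>X. w y * A y z) = w z" if "z \<in> X" for z
      using less.prems[OF xy(1) that] by (simp add: w_def)
    have wu: "(\<Sum>y\<in>X. w y * u y) = 1"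
      using Au[OF xy(1)] xy(3) by (simp add: w_def u_def)
    have idemB: "(\<Sum>y\<in>X. B x y * B y z) = B x z" if "x \<in> X" "z \<in> X" for x z
    proof -
      have "(\<Sum>y\<in>X. B x y * B y z) = (\<Sum>y\<in>X. A x y * A y z) - (\<Sum>y\<in>X. A x y * u y) * w z
          - u x * (\<Sum>y\<in>X. w y * A y z) + u x * (\<Sum>y\<in>X. w y * u y) * w z"
        by (simp add: B_def algebra_simps sum.distrib sum_subtractf sum_distrib_left sum_distrib_right)
      also have "\<dots> = B x z"
        using less.prems[OF that] Au[OF that(1)] wA[OF that(2)] wu by (simp add: B_def)
      finally show ?thesis .
    qed
    have "{y \<in> X. \<exists>x\<in>X. B x y \<noteq> 0} \<subset> {y \<in> X. \<exists>x\<in>X. A x y \<noteq> 0}"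
    proof (intro psubsetI)
      show "{y \<in> X. \<exists>x\<in>X. B x y \<noteq> 0} \<subseteq> {y \<in> X. \<exists>x\<in>X. A x y \<noteq> 0}"
        using xy(1) by (auto simp: B_def w_def) (metis mult_zero_right)
      have "y0 \<notin> {y \<in> X. \<exists>x\<in>X. B x y \<noteq> 0}"
        using xy(3) by (simp add: B_def u_def w_def)
      moreover have "y0 \<in> {y \<in> X. \<exists>x\<in>X. A x y \<noteq> 0}" using xy by auto
      ultimately show "{y \<in> X. \<exists>x\<in>X. B x y \<noteq> 0} \<noteq> {y \<in> X. \<exists>x\<in>X. A x y \<noteq> 0}" by blast
    qed
    then have "card {y \<in> X. \<exists>x\<in>X. B x y \<noteq> 0} < card {y \<in> X. \<exists>x\<in>X. A x y \<noteq> 0}"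
      using fin by (intro psubset_card_mono) auto
    from less.hyps[OF this idemB] obtain k :: nat where k: "(\<Sum>x\<in>X. B x x) = of_nat k" by blast
    have "(\<Sum>x\<in>X. A x x) = (\<Sum>x\<in>X. B x x) + (\<Sum>y\<in>X. w y * u y)"
      by (simp add: B_def sum_subtractf mult.commute)
    then have "(\<Sum>x\<in>X. A x x) = of_nat (Suc k)" using k wu by simp
    then show ?thesis by blast
  qed
qed

text \<open>The number x is an eigenvalue of the integral circulant matrix with first row b, the powers of $\omega$ being
  an eigenvector. So it is an algebraic integer.\<close>
lemma rational_root_of_unity_sum_integer:
  fixes \<omega> x :: complex and b :: "nat \<Rightarrow> int"
  assumes v: "v > 0" and root: "\<omega> ^ v = 1" and x: "x = (\<Sum>j<v. of_int (b j) * \<omega> ^ j)" and rat: "x \<in> \<rat>"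
  shows "x \<in> \<int>"
proof -
  define C :: "int mat" where "C = mat v v (\<lambda>(i, k). b ((k + (v - i)) mod v))"
  define A :: "complex mat" where "A = map_mat of_int C"
  define w :: "complex vec" where "w = vec v (\<lambda>i. \<omega> ^ i)"
  have C: "C \<in> carrier_mat v v" by (simp add: C_def)
  then have A: "A \<in> carrier_mat v v" by (simp add: A_def)
  have pm: "\<omega> ^ (k mod v) = \<omega> ^ k" for k
    by (metis div_mult_mod_eq mult.commute mult_1 power_add power_mult power_one root)
  have "A *\<^sub>v w = x \<cdot>\<^sub>v w"
  proof (rule eq_vecI)
    show "dim_vec (A *\<^sub>v w) = dim_vec (x \<cdot>\<^sub>v w)" using A by (simp add: w_def)
    fix i assume "i < dim_vec (x \<cdot>\<^sub>v w)"
    then have i: "i < v" by (simp add: w_def)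
    have inj: "inj_on (\<lambda>j. (i + j) mod v) {..<v}"
    proof (rule inj_onI)
      fix j k assume jk: "j \<in> {..<v}" "k \<in> {..<v}" "(i + j) mod v = (i + k) mod v"
      then have "[i + j = i + k] (mod v)" by (simp add: cong_def)
      then have "[j = k] (mod v)" by (simp add: cong_add_lcancel_nat)
      then show "j = k" using jk by (simp add: cong_def)
    qed
    have "(\<lambda>j. (i + j) mod v) ` {..<v} \<subseteq> {..<v}" using v by auto
    then have bij: "bij_betw (\<lambda>j. (i + j) mod v) {..<v} {..<v}"
      using inj by (simp add: bij_betw_def endo_inj_surj)
    have idx: "((i + j) mod v + (v - i)) mod v = j" if "j < v" for j
    proof -
      have "((i + j) mod v + (v - i)) mod v = (i + j + (v - i)) mod v" by (simp add: mod_add_left_eq)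
      also have "i + j + (v - i) = j + v" using i by simp
      finally show ?thesis using that by simp
    qed
    have "(A *\<^sub>v w) $ i = (\<Sum>k<v. of_int (b ((k + (v - i)) mod v)) * \<omega> ^ k)"
      using i A C by (simp add: A_def C_def w_def scalar_prod_def row_def atLeast0LessThan)
    also have "\<dots> = (\<Sum>j<v. of_int (b (((i + j) mod v + (v - i)) mod v)) * \<omega> ^ ((i + j) mod v))"
      by (rule sum.reindex_bij_betw[OF bij, symmetric])
    also have "\<dots> = (\<Sum>j<v. of_int (b j) * \<omega> ^ (i + j))"
      by (intro sum.cong refl) (simp add: idx pm)
    also have "\<dots> = x * \<omega> ^ i"
      unfolding x by (simp add: power_add sum_distrib_left sum_distrib_right mult_ac)
    finally show "(A *\<^sub>v w) $ i = (x \<cdot>\<^sub>v w) $ i" using i by (simp add: w_def)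
  qed
  moreover have "w \<noteq> 0\<^sub>v v"
  proof
    assume "w = 0\<^sub>v v"
    then have "w $ 0 = 0" using v by simp
    then show False using v by (simp add: w_def)
  qed
  ultimately have "eigenvalue A x"
    unfolding eigenvalue_def eigenvector_def using A by (intro exI[of _ w]) (auto simp: w_def)
  then have "poly (char_poly A) x = 0" using eigenvalue_root_char_poly[OF A] by simp
  moreover have "char_poly A = map_poly of_int (char_poly C)"
    unfolding A_def by (rule of_int_hom.char_poly_hom[OF C])
  moreover have "monic (char_poly C)" using degree_monic_char_poly[OF C] by simp
  ultimately have "algebraic_int x" unfolding algebraic_int_altdef_ipoly by metis
  then show ?thesis using rat by (rule rational_algebraic_int_is_int)
qed

lemma sum_periodic_shift:
  fixes f :: "nat \<Rightarrow> complex"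
  assumes "\<And>i. f (i + v) = f i"
  shows "(\<Sum>i=1..v. f (k + i)) = (\<Sum>i=1..v. f i)"
proof (induction k)
  case (Suc k)
  have "(\<Sum>i=1..v. f (Suc k + i)) = (\<Sum>i=1..v. f (k + Suc i))" by simp
  also have "\<dots> = (\<Sum>i=Suc 1..Suc v. f (k + i))" by (subst sum.shift_bounds_cl_Suc_ivl) simp
  also have "\<dots> = (\<Sum>i=1..Suc v. f (k + i)) - f (k + 1)" by (simp add: sum.atLeast_Suc_atMost)
  also have "\<dots> = (\<Sum>i=1..v. f (k + i))" using assms[of "k + 1"] by (simp add: add_ac)
  finally show ?case using Suc by simp
qed simp

text \<open>Averaging the translates of $\varphi$ by the powers of $g$ against the character $i \mapsto \zeta^{ji}$ of the integers
  modulo $v = |G|$ gives an idempotent matrix \<open>A j\<close> for each j, and its trace, the natural number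
  $m_j = \sum_i \zeta^{ji} \varphi(g^i)$, is a Fourier coefficient of $i \mapsto \varphi(g^i)$. Fourier inversion writes
  $v \varphi(g)$ as a combination of powers of $\zeta$ with the integer coefficients $m_j$.\<close>
lemma (in comm_group) idempotent_coefficient_integer:
  fixes \<phi> :: "'a \<Rightarrow> complex"
  assumes fin: "finite (carrier G)"
    and idem: "\<And>z. z \<in> carrier G \<Longrightarrow> (\<Sum>y\<in>carrier G. \<phi> y * \<phi> (inv y \<otimes> z)) = \<phi> z"
    and g: "g \<in> carrier G" and rat: "of_nat (card (carrier G)) * \<phi> g \<in> \<rat>"
  shows "of_nat (card (carrier G)) * \<phi> g \<in> \<int>"
proof -
  define v where "v = card (carrier G)"
  have v: "v > 0" unfolding v_def using fin g by (auto simp: card_gt_0_iff)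
  define \<zeta> where "\<zeta> = cis (2 * pi / of_nat v)"
  have zv: "\<zeta> ^ v = 1" using v by (simp add: \<zeta>_def DeMoivre)
  have z1: "\<zeta> ^ i \<noteq> 1" if "0 < i" "i < v" for i
  proof
    assume "\<zeta> ^ i = 1"
    then have "cis (of_nat i * (2 * pi / of_nat v)) = 1" by (simp add: \<zeta>_def DeMoivre)
    then have "cos (of_nat i * (2 * pi / of_nat v)) = 1"
      by (metis cis.sel(1) one_complex.sel(1))
    then obtain n :: int where "of_nat i * (2 * pi / of_nat v) = of_int n * 2 * pi"
      by (auto simp: cos_one_2pi_int)
    then have "real i = of_int n * real v" using v by (simp add: field_simps)
    then have "int i = n * int v" by (metis of_int_eq_iff of_int_mult of_int_of_nat_eq)
    then have "v dvd i" by (metis dvd_triv_right int_dvd_int_iff)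
    then show False using that by (simp add: nat_dvd_not_less)
  qed
  have gv: "g [^] v = \<one>" using pow_order_eq_1[OF g] by (simp add: v_def Coset.order_def)
  have "\<zeta> \<noteq> 0" by (simp add: \<zeta>_def)
  define A where "A j x y = (\<Sum>i=1..v. \<zeta> ^ (j * i) * \<phi> (inv x \<otimes> y \<otimes> g [^] i)) / of_nat v" for j :: nat and x y
  have conv: "(\<Sum>y\<in>carrier G. \<phi> (inv x \<otimes> y \<otimes> a) * \<phi> (inv y \<otimes> z \<otimes> b)) = \<phi> (inv x \<otimes> z \<otimes> (a \<otimes> b))"
    if "x \<in> carrier G" "z \<in> carrier G" "a \<in> carrier G" "b \<in> carrier G" for x z a b
  proof -
    let ?c = "inv x \<otimes> a"
    have c: "?c \<in> carrier G" using that by simp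
    have "(\<Sum>y\<in>carrier G. \<phi> (inv x \<otimes> y \<otimes> a) * \<phi> (inv y \<otimes> z \<otimes> b))
        = (\<Sum>y\<in>carrier G. \<phi> (?c \<otimes> y) * \<phi> (inv (?c \<otimes> y) \<otimes> (inv x \<otimes> z \<otimes> (a \<otimes> b))))"
    proof (intro sum.cong refl)
      fix y assume y: "y \<in> carrier G"
      define c where "c = ?c"
      define w where "w = z \<otimes> b"
      have cw: "c \<in> carrier G" "w \<in> carrier G" using that by (simp_all add: c_def w_def)
      have "inv x \<otimes> y \<otimes> a = ?c \<otimes> y" using that y by (simp add: m_ac)
      moreover have "inv x \<otimes> z \<otimes> (a \<otimes> b) = c \<otimes> w" using that by (simp add: c_def w_def m_ac)
      moreover have "inv c \<otimes> (c \<otimes> w) = w" using cw by (simp flip: m_assoc)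
      then have "inv (c \<otimes> y) \<otimes> (c \<otimes> w) = inv y \<otimes> w"
        using cw y by (simp add: inv_mult_group m_assoc)
      then have "inv (c \<otimes> y) \<otimes> (c \<otimes> w) = inv y \<otimes> z \<otimes> b"
        using y that by (simp add: w_def m_assoc)
      ultimately show "\<phi> (inv x \<otimes> y \<otimes> a) * \<phi> (inv y \<otimes> z \<otimes> b)
        = \<phi> (?c \<otimes> y) * \<phi> (inv (?c \<otimes> y) \<otimes> (inv x \<otimes> z \<otimes> (a \<otimes> b)))" by (simp add: c_def)
    qed
    also have "\<dots> = (\<Sum>y\<in>carrier G. \<phi> y * \<phi> (inv y \<otimes> (inv x \<otimes> z \<otimes> (a \<otimes> b))))"
    proof (rule sum.reindex_bij_betw)
      show "bij_betw ((\<otimes>) ?c) (carrier G) (carrier G)"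
        using c by (intro bij_betw_byWitness[where f' = "(\<otimes>) (inv ?c)"])
          (auto simp flip: m_assoc simp del: inv_mult_group)
    qed
    also have "\<dots> = \<phi> (inv x \<otimes> z \<otimes> (a \<otimes> b))" using that by (intro idem) simp
    finally show ?thesis .
  qed
  have "\<exists>k::nat. (\<Sum>i=1..v. \<zeta> ^ (j * i) * \<phi> (g [^] i)) = of_nat k" for j
  proof -
    have "(\<Sum>y\<in>carrier G. A j x y * A j y z) = A j x z" if xz: "x \<in> carrier G" "z \<in> carrier G" for x z
    proof -
      define f where "f i = \<zeta> ^ (j * i) * \<phi> (inv x \<otimes> z \<otimes> g [^] i)" for i :: nat
      have per: "f (i + v) = f i" for i
      proof -
        have "\<zeta> ^ (j * (i + v)) = \<zeta> ^ (j * i) * (\<zeta> ^ v) ^ j"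
          by (simp add: power_add power_mult algebra_simps flip: power_mult)
        moreover have "g [^] (i + v) = g [^] i" using g gv by (simp flip: nat_pow_mult)
        ultimately show ?thesis by (simp add: f_def zv)
      qed
      have "(\<Sum>y\<in>carrier G. A j x y * A j y z) * (of_nat v * of_nat v)
        = (\<Sum>y\<in>carrier G. (\<Sum>i=1..v. \<zeta> ^ (j * i) * \<phi> (inv x \<otimes> y \<otimes> g [^] i))
             * (\<Sum>k=1..v. \<zeta> ^ (j * k) * \<phi> (inv y \<otimes> z \<otimes> g [^] k)))"
        using v by (simp add: A_def times_divide_times_eq flip: sum_divide_distrib)
      also have "\<dots> = (\<Sum>y\<in>carrier G. \<Sum>i=1..v. \<Sum>k=1..v. \<zeta> ^ (j * (i + k)) *
            (\<phi> (inv x \<otimes> y \<otimes> g [^] i) * \<phi> (inv y \<otimes> z \<otimes> g [^] k)))"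
        by (intro sum.cong refl, subst sum_product, intro sum.cong refl) (simp add: power_add distrib_left mult_ac)
      also have "\<dots> = (\<Sum>i=1..v. \<Sum>k=1..v. \<zeta> ^ (j * (i + k)) * (\<Sum>y\<in>carrier G.
            \<phi> (inv x \<otimes> y \<otimes> g [^] i) * \<phi> (inv y \<otimes> z \<otimes> g [^] k)))"
        by (simp add: sum_distrib_left sum.swap[where A = "carrier G"])
      also have "\<dots> = (\<Sum>i=1..v. \<Sum>k=1..v. f (i + k))"
        using xz g by (simp add: conv f_def nat_pow_mult)
      also have "\<dots> = (\<Sum>i=1..v. \<Sum>k=1..v. f k)" by (simp only: sum_periodic_shift[of f v, OF per])
      also have "\<dots> = of_nat v * (of_nat v * A j x z)" using v by (simp add: A_def f_def)
      finally show ?thesis using v by simp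
    qed
    from idempotent_trace_nat[OF fin this]
    obtain k :: nat where "(\<Sum>x\<in>carrier G. A j x x) = of_nat k" by blast
    moreover have "A j x x = (\<Sum>i=1..v. \<zeta> ^ (j * i) * \<phi> (g [^] i)) / of_nat v" if "x \<in> carrier G" for x
      using that g by (simp add: A_def)
    ultimately have "of_nat v * ((\<Sum>i=1..v. \<zeta> ^ (j * i) * \<phi> (g [^] i)) / of_nat v) = of_nat k"
      by (simp add: v_def)
    then show ?thesis using v by auto
  qed
  then obtain m :: "nat \<Rightarrow> nat" where m: "(\<Sum>i=1..v. \<zeta> ^ (j * i) * \<phi> (g [^] i)) = of_nat (m j)" for j
    by metis
  \<comment> \<open>Fourier inversion at the exponent 1; the sums run over i from 1 to v, so that exponent is a term of them.\<close>
  have geo: "(\<Sum>j<v. (inverse \<zeta>) ^ j * \<zeta> ^ (j * i)) = (if i = 1 then of_nat v else 0)" if i: "i \<in> {1..v}" for i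
  proof -
    have "(inverse \<zeta>) ^ j * \<zeta> ^ (j * i) = (\<zeta> ^ (i - 1)) ^ j" for j
    proof -
      have "\<zeta> ^ (j * i) = \<zeta> ^ (j * (i - 1)) * \<zeta> ^ j"
        using i by (metis atLeastAtMost_iff le_add_diff_inverse2 mult.right_neutral distrib_left power_add)
      then show ?thesis using \<open>\<zeta> \<noteq> 0\<close>
        by (simp add: power_mult[symmetric] mult.commute power_inverse)
    qed
    then have eq: "(\<Sum>j<v. (inverse \<zeta>) ^ j * \<zeta> ^ (j * i)) = (\<Sum>j<v. (\<zeta> ^ (i - 1)) ^ j)" by simp
    show ?thesis
    proof (cases "i = 1")
      case True then show ?thesis using eq by simp
    next
      case False
      then have ne: "\<zeta> ^ (i - 1) \<noteq> 1" using i v by (intro z1) auto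
      have "(\<zeta> ^ (i - 1)) ^ v = 1" by (metis mult.commute power_mult power_one zv)
      then show ?thesis using eq ne False by (simp add: geometric_sum)
    qed
  qed
  have "of_nat v * \<phi> g = (\<Sum>i=1..v. (if i = 1 then of_nat v else 0) * \<phi> (g [^] i))"
    using v g by (simp add: if_distrib[of "\<lambda>x. x * _"] sum.delta' cong: if_cong)
  also have "\<dots> = (\<Sum>i=1..v. (\<Sum>j<v. (inverse \<zeta>) ^ j * \<zeta> ^ (j * i)) * \<phi> (g [^] i))"
    by (intro sum.cong refl) (simp add: geo)
  also have "\<dots> = (\<Sum>j<v. (inverse \<zeta>) ^ j * (\<Sum>i=1..v. \<zeta> ^ (j * i) * \<phi> (g [^] i)))"
    by (simp add: sum_distrib_left sum_distrib_right mult_ac sum.swap[where A = "{..<v}"])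
  also have "\<dots> = (\<Sum>j<v. of_int (int (m j)) * (inverse \<zeta>) ^ j)" by (simp only: m) (simp add: mult.commute)
  finally have eq: "of_nat v * \<phi> g = (\<Sum>j<v. of_int (int (m j)) * (inverse \<zeta>) ^ j)" .
  show ?thesis
    using rational_root_of_unity_sum_integer[OF v _ eq] rat zv by (simp add: v_def power_inverse)
qed

section \<open>Torsion subgroups of an abelian group\<close>

lemma fermat_int:
  assumes p: "prime p"
  shows "[a ^ p = (a::int)] (mod int p)"
proof -
  define b where "b = nat (a mod int p)"
  have p0: "p > 0" using p prime_gt_0_nat by blast
  have ab: "[a = int b] (mod int p)" using p0 by (simp add: b_def cong_def)
  have "[b ^ p = b] (mod p)"
  proof (cases "p dvd b")
    case True
    then have "[b = 0] (mod p)" by (simp add: cong_0_iff)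
    moreover from this have "[b ^ p = 0 ^ p] (mod p)" by (rule cong_pow)
    ultimately show ?thesis using p0 by (metis cong_sym cong_trans power_0_left not_gr0)
  next
    case False
    from fermat_theorem[OF p this] have "[b ^ (p - 1) * b = 1 * b] (mod p)" by (rule cong_scalar_right)
    moreover have "b ^ (p - 1) * b = b ^ p" using p0 by (metis Suc_diff_1 power_Suc2)
    ultimately show ?thesis by simp
  qed
  then have "[int b ^ p = int b] (mod int p)" by (metis cong_int_iff of_nat_power)
  then show ?thesis using ab by (meson cong_pow cong_sym cong_trans)
qed

context comm_group
begin

lemma sum_translate:
  fixes f :: "'a \<Rightarrow> 'c::comm_monoid_add"
  assumes H: "subgroup H G" and c: "c \<in> H"
  shows "(\<Sum>y\<in>H. f (c \<otimes> y)) = sum f H"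
proof (rule sum.reindex_bij_betw)
  have HG: "\<And>h. h \<in> H \<Longrightarrow> h \<in> carrier G" using subgroup.mem_carrier[OF H] by blast
  then have cG: "c \<in> carrier G" using c by blast
  show "bij_betw ((\<otimes>) c) H H"
    using assms cG HG
    by (intro bij_betw_byWitness[where f' = "(\<otimes>) (inv c)"])
       (auto simp: subgroup.m_closed subgroup.m_inv_closed simp flip: m_assoc)
qed

lemma sum_inverse:
  fixes f :: "'a \<Rightarrow> 'c::comm_monoid_add"
  assumes H: "subgroup H G"
  shows "(\<Sum>y\<in>H. f (inv y)) = sum f H"
proof (rule sum.reindex_bij_betw)
  have HG: "\<And>h. h \<in> H \<Longrightarrow> h \<in> carrier G" using subgroup.mem_carrier[OF H] by blast
  show "bij_betw (\<lambda>y. inv y) H H"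
    using H HG by (intro bij_betw_byWitness[where f' = "\<lambda>y. inv y"]) (auto simp: subgroup.m_inv_closed)
qed

lemma nat_pow_cong:
  assumes x: "x \<in> carrier G" and cong: "[a = b] (mod card (carrier G))"
  shows "x [^] (a::nat) = x [^] (b::nat)"
proof -
  have *: "x [^] a = x [^] b" if ab: "a \<le> b" "[b = a] (mod card (carrier G))" for a b :: nat
  proof -
    obtain i where "b = i * card (carrier G) + a" using ab cong_le_nat by blast
    then have "x [^] b = (x [^] card (carrier G)) [^] i \<otimes> x [^] a"
      using x by (simp add: nat_pow_mult nat_pow_pow mult.commute)
    then show ?thesis using pow_order_eq_1[OF x] x by (simp add: Coset.order_def)
  qed
  show ?thesis using *[of a b] *[of b a] cong by (metis cong_sym nat_le_linear)
qed

lemma pow_coprime_eq_one: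
  assumes "x \<in> carrier G" "x [^] (a::nat) = \<one>" "x [^] (b::nat) = \<one>" "coprime a b"
  shows "x = \<one>"
proof -
  have "ord x dvd a" "ord x dvd b" using assms pow_eq_id by auto
  then have "ord x = 1" using assms(4) coprime_common_divisor_nat by blast
  then show ?thesis using assms(1) ord_eq_1 by blast
qed

lemma subgroup_pow_card:
  assumes H: "subgroup H G" and x: "x \<in> H"
  shows "x [^] card H = \<one>"
proof -
  interpret HH: group "G\<lparr>carrier := H\<rparr>" using H is_group by (rule subgroup.subgroup_is_group)
  have "x [^]\<^bsub>G\<lparr>carrier := H\<rparr>\<^esub> card H = \<one>"
    using HH.pow_order_eq_1[of x] x by (simp add: Coset.order_def)
  then show ?thesis using nat_pow_consistent by metis
qed

lemma exists_pow_prime_eq_one: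
  assumes fin: "finite (carrier G)" and p: "prime p" and dvd: "p dvd card (carrier G)"
  shows "\<exists>h\<in>carrier G. h \<noteq> \<one> \<and> h [^] p = \<one>"
proof -
  obtain m where "card (carrier G) = p * m" using dvd by blast
  then obtain H where H: "subgroup H G" "card H = p"
    using sylow_thm[of p G 1 m] p fin is_group by (auto simp: Coset.order_def)
  have "p > 1" using p prime_gt_1_nat by blast
  then have "\<not> H \<subseteq> {\<one>}" using H(2) card_mono[of "{\<one>}" H] by auto
  then obtain h where h: "h \<in> H" "h \<noteq> \<one>" by blast
  have "h [^] p = \<one>" using subgroup_pow_card[OF H(1) h(1)] H(2) by simp
  then show ?thesis using h subgroup.mem_carrier[OF H(1)] by blast
qed

lemma subgroup_torsion: "subgroup {g \<in> carrier G. g [^] (n::nat) = \<one>} G"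
  by (rule subgroupI) (auto simp: nat_pow_inv nat_pow_distrib intro: exI[of _ "\<one>"])

text \<open>The group is the product of its x-torsion and its y-torsion, by the Chinese remainder theorem for exponents.
  By Cauchy, the order of the x-torsion has no prime factor in common with y, so it divides x; likewise for y.
  As the product of the two orders is at least $x y$, both are attained.\<close>
lemma exists_hall_subgroup:
  assumes fin: "finite (carrier G)" and card: "card (carrier G) = x * y" and cop: "coprime x y"
  shows "\<exists>H. subgroup H G \<and> card H = x"
proof -
  define T where "T n = {g \<in> carrier G. g [^] (n::nat) = \<one>}" for n
  have sub: "subgroup (T n) G" for n unfolding T_def by (rule subgroup_torsion)
  have v0: "card (carrier G) > 0" using fin by (auto simp: card_gt_0_iff)
  have dvd: "card (T a) dvd a" if ab: "card (carrier G) = a * b" "coprime a b" for a b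
  proof -
    have "coprime (card (T a)) b"
    proof (rule ccontr)
      assume "\<not> coprime (card (T a)) b"
      then obtain p where p: "prime p" "p dvd card (T a)" "p dvd b"
        using prime_factor_nat[of "gcd (card (T a)) b"] by (auto simp: coprime_iff_gcd_eq_1)
      interpret HH: comm_group "G\<lparr>carrier := T a\<rparr>"
        by (rule group.group_comm_groupI[OF subgroup.subgroup_is_group[OF sub is_group]])
          (auto simp: T_def intro: m_comm)
      have "finite (T a)" using fin by (simp add: T_def)
      then obtain h where h: "h \<in> T a" "h \<noteq> \<one>" "h [^]\<^bsub>G\<lparr>carrier := T a\<rparr>\<^esub> p = \<one>"
        using HH.exists_pow_prime_eq_one[of p] p by auto
      then have "h [^] p = \<one>" using nat_pow_consistent by metis
      moreover have "coprime a p" using ab(2) p(3) by (meson coprime_divisors dvd_refl)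
      ultimately show False using h pow_coprime_eq_one[of h a p] by (auto simp: T_def)
    qed
    moreover have "card (T a) dvd a * b"
      using lagrange[OF sub[of a]] ab by (metis Coset.order_def dvd_triv_right)
    ultimately show ?thesis by (simp add: coprime_dvd_mult_left_iff)
  qed
  have "carrier G \<subseteq> (\<lambda>(h, k). h \<otimes> k) ` (T x \<times> T y)"
  proof
    fix g assume g: "g \<in> carrier G"
    obtain n where n: "[n = 1] (mod x)" "[n = 0] (mod y)"
      using binary_chinese_remainder_nat[OF cop] by blast
    have xy: "x > 0" "y > 0" using card v0 by (auto intro: gr0I)
    define k where "k = g \<otimes> inv (g [^] n)"
    have gv: "g [^] (x * y * i) = \<one>" for i
      using pow_order_eq_1[OF g] g card by (simp add: Coset.order_def flip: nat_pow_pow)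
    obtain i where i: "n = y * i" using n(2) by (auto simp: cong_0_iff)
    have "g [^] n \<in> T x" using gv[of i] g i by (simp add: T_def nat_pow_pow mult_ac)
    moreover have "k \<in> T y"
    proof -
      have "[n * y = y] (mod x * y)" using cong_cmult_leftI[OF n(1), of y] by (simp add: mult.commute)
      then have "g [^] (n * y) = g [^] y" using nat_pow_cong[OF g] card by simp
      then show ?thesis using g by (simp add: T_def k_def nat_pow_distrib nat_pow_inv nat_pow_pow)
    qed
    moreover have "g = g [^] n \<otimes> k" using g by (simp add: k_def m_lcomm)
    ultimately show "g \<in> (\<lambda>(h, k). h \<otimes> k) ` (T x \<times> T y)" by force
  qed
  moreover have finT: "finite (T x \<times> T y)" using fin by (simp add: T_def)
  ultimately have "card (carrier G) \<le> card ((\<lambda>(h, k). h \<otimes> k) ` (T x \<times> T y))"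
    by (intro card_mono) auto
  also have "\<dots> \<le> card (T x \<times> T y)" using finT by (rule card_image_le)
  finally have le: "x * y \<le> card (T x) * card (T y)" using card by (simp add: card_cartesian_product)
  have xy: "x > 0" "y > 0" using card v0 by (auto intro: gr0I)
  have Tx: "card (T x) \<le> x" using dvd[OF card cop] xy by (simp add: dvd_imp_le)
  have "card (carrier G) = y * x" "coprime y x" using card cop by (simp_all add: mult.commute coprime_commute)
  then have "card (T y) \<le> y" using dvd[of y x] xy by (simp add: dvd_imp_le)
  then have "x * y \<le> card (T x) * y" using le by (meson le_trans mult_le_mono2)
  then have "card (T x) = x" using Tx xy by simp
  then show ?thesis using sub by blast
qed

end

section \<open>Functions on a group that satisfy a quadratic equation\<close>

text \<open>Outside the identity, E is the indicator function of a set, a partial difference set; the value at the identity is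
  chosen so that the convolution square is a combination of E and a constant.\<close>
locale pds_group = comm_group G for G (structure) +
  fixes E :: "'a \<Rightarrow> int" and q \<mu> K \<tau> :: int
  assumes fin: "finite (carrier G)"
    and conv: "\<And>g. g \<in> carrier G \<Longrightarrow> (\<Sum>x\<in>carrier G. E x * E (inv x \<otimes> g)) = q * E g + \<mu>"
    and total: "(\<Sum>x\<in>carrier G. E x) = K"
    and E_one: "E \<one> = \<tau>"
    and E_01: "\<And>g. g \<in> carrier G \<Longrightarrow> g \<noteq> \<one> \<Longrightarrow> E g \<in> {0, 1}"
    and E_inv: "\<And>g. g \<in> carrier G \<Longrightarrow> E (inv g) = E g"
    and q_pos: "q > 0" and mu_pos: "\<mu> > 0" and tau_pos: "\<tau> > 0"
    and E_zero: "\<exists>g\<in>carrier G. E g = 0"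
begin

abbreviation v :: int where "v \<equiv> int (card (carrier G))"

definition coset_sum :: "'a set \<Rightarrow> 'a \<Rightarrow> int" where
  "coset_sum H g = (\<Sum>h\<in>H. E (g \<otimes> h))"

lemma E_nonneg: "g \<in> carrier G \<Longrightarrow> E g \<ge> 0"
  using E_01 E_one tau_pos by (cases "g = \<one>") force+

lemma v_pos: "v > 0"
  using fin by (auto simp: card_gt_0_iff)

lemma sum_shift:
  fixes f :: "'a \<Rightarrow> 'c::comm_monoid_add"
  assumes "c \<in> carrier G"
  shows "(\<Sum>y\<in>carrier G. f (c \<otimes> y)) = sum f (carrier G)"
  using sum_translate[OF subgroup_self assms] .

text \<open>Sum the convolution square over the group.\<close>
lemma total_square: "K * K = q * K + \<mu> * v"
proof -
  have "(\<Sum>g\<in>carrier G. \<Sum>x\<in>carrier G. E x * E (inv x \<otimes> g)) = (\<Sum>x\<in>carrier G. E x * (\<Sum>g\<in>carrier G. E (inv x \<otimes> g)))"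
    by (subst sum.swap) (simp add: sum_distrib_left)
  also have "\<dots> = K * K" by (simp add: sum_shift total flip: sum_distrib_right)
  finally show ?thesis
    by (simp add: conv sum.distrib total mult.commute flip: sum_distrib_left)
qed

context
  fixes H assumes H: "subgroup H G"
begin

lemma sub_carrier: "h \<in> H \<Longrightarrow> h \<in> carrier G"
  using subgroup.mem_carrier[OF H] .

lemma finite_sub: "finite H"
  using finite_subset[OF subgroup.subset[OF H] fin] .

lemma coset_sum_total: "(\<Sum>g\<in>carrier G. coset_sum H g) = int (card H) * K"
proof -
  have "(\<Sum>g\<in>carrier G. coset_sum H g) = (\<Sum>h\<in>H. \<Sum>g\<in>carrier G. E (h \<otimes> g))"
    unfolding coset_sum_def by (subst sum.swap) (auto intro!: sum.cong simp: m_comm sub_carrier)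
  then show ?thesis by (simp add: sum_shift sub_carrier total)
qed

lemma coset_sum_inv:
  assumes "g \<in> carrier G"
  shows "coset_sum H (inv g) = coset_sum H g"
proof -
  have "coset_sum H (inv g) = (\<Sum>h\<in>H. E (inv g \<otimes> inv h))"
    unfolding coset_sum_def by (rule sum_inverse[OF H, symmetric])
  also have "\<dots> = coset_sum H g"
    unfolding coset_sum_def using assms sub_carrier by (intro sum.cong) (auto simp: E_inv simp flip: inv_mult)
  finally show ?thesis .
qed

lemma coset_sum_shift:
  assumes "g \<in> carrier G" "h \<in> H"
  shows "coset_sum H (g \<otimes> h) = coset_sum H g"
proof -
  have "coset_sum H (g \<otimes> h) = (\<Sum>k\<in>H. E (g \<otimes> (h \<otimes> k)))"
    unfolding coset_sum_def using assms sub_carrier by (intro sum.cong) (auto simp: m_assoc)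
  also have "\<dots> = coset_sum H g" unfolding coset_sum_def by (rule sum_translate[OF H assms(2)])
  finally show ?thesis .
qed

lemma coset_sum_conv:
  assumes z: "z \<in> carrier G"
  shows "(\<Sum>y\<in>carrier G. coset_sum H y * coset_sum H (inv y \<otimes> z))
    = int (card H) * (q * coset_sum H z + int (card H) * \<mu>)"
proof -
  have one: "(\<Sum>y\<in>carrier G. E (y \<otimes> h) * E (inv y \<otimes> z \<otimes> k)) = q * E (z \<otimes> (h \<otimes> k)) + \<mu>"
    if hk: "h \<in> H" "k \<in> H" for h k
  proof -
    have hkG: "h \<in> carrier G" "k \<in> carrier G" using hk sub_carrier by auto
    have "(\<Sum>y\<in>carrier G. E (y \<otimes> h) * E (inv y \<otimes> z \<otimes> k))
      = (\<Sum>y\<in>carrier G. E (h \<otimes> y) * E (inv (h \<otimes> y) \<otimes> (z \<otimes> (h \<otimes> k))))"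
    proof (intro sum.cong refl)
      fix y assume y: "y \<in> carrier G"
      have "inv h \<otimes> (h \<otimes> (z \<otimes> k)) = z \<otimes> k" using hkG z by (simp flip: m_assoc)
      moreover have "z \<otimes> (h \<otimes> k) = h \<otimes> (z \<otimes> k)" using hkG z by (simp add: m_ac)
      ultimately have "inv (h \<otimes> y) \<otimes> (z \<otimes> (h \<otimes> k)) = inv y \<otimes> z \<otimes> k"
        using hkG z y by (simp add: inv_mult_group m_assoc)
      then show "E (y \<otimes> h) * E (inv y \<otimes> z \<otimes> k) = E (h \<otimes> y) * E (inv (h \<otimes> y) \<otimes> (z \<otimes> (h \<otimes> k)))"
        using hkG y by (simp add: m_comm)
    qed
    also have "\<dots> = (\<Sum>y\<in>carrier G. E y * E (inv y \<otimes> (z \<otimes> (h \<otimes> k))))"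
      using hkG by (intro sum_shift) auto
    also have "\<dots> = q * E (z \<otimes> (h \<otimes> k)) + \<mu>" using hkG z by (intro conv) auto
    finally show ?thesis .
  qed
  have "(\<Sum>y\<in>carrier G. coset_sum H y * coset_sum H (inv y \<otimes> z))
    = (\<Sum>y\<in>carrier G. \<Sum>h\<in>H. \<Sum>k\<in>H. E (y \<otimes> h) * E (inv y \<otimes> z \<otimes> k))"
    by (simp add: coset_sum_def sum_product)
  also have "\<dots> = (\<Sum>h\<in>H. \<Sum>k\<in>H. \<Sum>y\<in>carrier G. E (y \<otimes> h) * E (inv y \<otimes> z \<otimes> k))"
    by (rule trans[OF sum.swap], rule sum.cong[OF refl], rule sum.swap)
  also have "\<dots> = (\<Sum>h\<in>H. \<Sum>k\<in>H. q * E (z \<otimes> (h \<otimes> k)) + \<mu>)"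
    by (intro sum.cong refl one)
  also have "\<dots> = (\<Sum>h\<in>H. \<Sum>k\<in>H. q * E (z \<otimes> k) + \<mu>)"
    by (intro sum.cong refl sum_translate[OF H, of _ "\<lambda>k. q * E (z \<otimes> k) + \<mu>"])
  also have "\<dots> = int (card H) * (q * coset_sum H z + int (card H) * \<mu>)"
    by (simp add: coset_sum_def sum.distrib sum_distrib_left)
  finally show ?thesis .
qed

lemma card_sub_pos: "card H > 0"
  using finite_sub subgroup.one_closed[OF H] by (auto simp: card_gt_0_iff)

text \<open>A form of Benson's theorem. Let F be the coset sum function and $U$ the index of H. Subtracting from F its mean
  and dividing by $q |H|$ gives an idempotent $\varphi$ of the group algebra, and
  $|G| \varphi(g) = (U F(g) - K)/q$ is rational, hence an integer.\<close>
lemma coset_sum_cong: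
  assumes U: "card (carrier G) = card H * U" and g: "g \<in> carrier G"
  shows "q dvd int U * coset_sum H g - K"
proof -
  define \<phi> :: "'a \<Rightarrow> complex" where
    "\<phi> z = (of_int (coset_sum H z) - of_int (int (card H) * K) / of_int v) / of_int (q * int (card H))" for z
  have nz: "of_int v \<noteq> (0::complex)" "of_int q \<noteq> (0::complex)" "of_int (int (card H)) \<noteq> (0::complex)"
    using v_pos q_pos card_sub_pos by auto
  have idem: "(\<Sum>y\<in>carrier G. \<phi> y * \<phi> (inv y \<otimes> z)) = \<phi> z" if z: "z \<in> carrier G" for z
  proof -
    define d where "d = (of_int (int (card H) * K) / of_int v :: complex)"
    define F where "F y = (of_int (coset_sum H y) :: complex)" for y
    have S1: "(\<Sum>y\<in>carrier G. F y) = of_int (int (card H) * K)"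
      unfolding F_def by (simp only: coset_sum_total flip: of_int_sum)
    have S2: "(\<Sum>y\<in>carrier G. F (inv y \<otimes> z)) = of_int (int (card H) * K)"
    proof -
      have "(\<Sum>y\<in>carrier G. F (inv y \<otimes> z)) = (\<Sum>y\<in>carrier G. F (y \<otimes> z))"
        using sum_inverse[OF subgroup_self, of "\<lambda>y. F (y \<otimes> z)"] .
      also have "\<dots> = (\<Sum>y\<in>carrier G. F (z \<otimes> y))" using z by (intro sum.cong) (auto simp: m_comm)
      finally show ?thesis using sum_shift[OF z] S1 by metis
    qed
    have S3: "(\<Sum>y\<in>carrier G. F y * F (inv y \<otimes> z)) = of_int (int (card H) * (q * coset_sum H z + int (card H) * \<mu>))"
      unfolding F_def using coset_sum_conv[OF z] by (simp flip: of_int_mult of_int_sum)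
    have "(\<Sum>y\<in>carrier G. (F y - d) * (F (inv y \<otimes> z) - d))
      = (\<Sum>y\<in>carrier G. F y * F (inv y \<otimes> z)) - d * (\<Sum>y\<in>carrier G. F y)
          - d * (\<Sum>y\<in>carrier G. F (inv y \<otimes> z)) + of_int v * d * d"
      by (simp add: algebra_simps sum.distrib sum_subtractf sum_distrib_left)
    also have "\<dots> = of_int (int (card H) * (q * coset_sum H z + int (card H) * \<mu>)) - d * of_int (int (card H) * K)"
      unfolding S1 S2 S3 using nz by (simp add: d_def field_simps)
    also have "\<dots> = of_int (q * int (card H)) * (F z - d)"
    proof -
      define k n c m V :: complex where "k = of_int K" and "n = of_int (int (card H))"
        and "c = of_int q" and "m = of_int \<mu>" and "V = of_int v"
      \<comment> \<open>The constant terms cancel by the quadratic equation for the total K.\<close>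
      have kk: "k * k = c * k + m * V"
        unfolding k_def c_def m_def V_def using total_square by (metis of_int_add of_int_mult)
      have dV: "d * V = n * k" using nz by (simp add: d_def n_def k_def V_def)
      have "(n * n * m - d * (n * k) + c * n * d) * V = n * n * (m * V) - (n * k) * (d * V) + c * n * (d * V)"
        by (simp add: algebra_simps)
      also have "\<dots> = n * n * (c * k + m * V - k * k)" unfolding dV by (simp add: algebra_simps)
      also have "\<dots> = 0" using kk by simp
      finally have "n * n * m - d * (n * k) + c * n * d = 0" using nz by (simp add: V_def)
      then have "n * (c * F z + n * m) - d * (n * k) = c * n * (F z - d)" by (simp add: algebra_simps)
      then show ?thesis by (simp add: F_def k_def n_def c_def m_def)
    qed
    finally have *: "(\<Sum>y\<in>carrier G. (F y - d) * (F (inv y \<otimes> z) - d)) = of_int (q * int (card H)) * (F z - d)" .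
    have "(\<Sum>y\<in>carrier G. \<phi> y * \<phi> (inv y \<otimes> z))
        = (\<Sum>y\<in>carrier G. (F y - d) * (F (inv y \<otimes> z) - d)) / (of_int (q * int (card H)) * of_int (q * int (card H)))"
      by (simp add: \<phi>_def F_def d_def sum_divide_distrib)
    also have "\<dots> = \<phi> z" unfolding * using nz by (simp add: \<phi>_def F_def d_def)
    finally show ?thesis .
  qed
  have cv: "(of_nat (card (carrier G)) :: complex) = of_nat (card H) * of_nat U" using U by simp
  have "card (carrier G) \<noteq> 0" using v_pos by simp
  then have "U \<noteq> 0" using U by (metis mult_0_right)
  then have "(of_nat U :: complex) \<noteq> 0" by simp
  then have "of_nat (card (carrier G)) * \<phi> g = (of_int (int U * coset_sum H g - K) / of_int q :: complex)"
    using nz unfolding \<phi>_def by (simp add: cv field_simps)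
  moreover have "(of_int (int U * coset_sum H g - K) / of_int q :: complex) \<in> \<rat>" by simp
  ultimately have "(of_int (int U * coset_sum H g - K) / of_int q :: complex) \<in> \<int>"
    using idempotent_coefficient_integer[OF fin idem g] by simp
  then obtain n :: int where "(of_int (int U * coset_sum H g - K) / of_int q :: complex) = of_int n"
    by (auto elim: Ints_cases)
  then have "(of_int (int U * coset_sum H g - K) :: complex) = of_int (q * n)"
    using nz by (simp add: field_simps)
  then have "int U * coset_sum H g - K = q * n" by (simp only: of_int_eq_iff)
  then show ?thesis by simp
qed

end

lemma q_dvd: "g \<in> carrier G \<Longrightarrow> q dvd v * E g - K"
  using coset_sum_cong[OF triv_subgroup, of "card (carrier G)" g] by (simp add: coset_sum_def)

lemma q_dvd_total: "q dvd K"
proof -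
  obtain g where "g \<in> carrier G" "E g = 0" using E_zero by blast
  then show ?thesis using q_dvd[of g] by simp
qed

text \<open>By Benson's congruence each coset sum is divisible by the part q' of q that is coprime to the index; y is the
  quotient. Its sum and its sum of squares come from the total of E and from the convolution square.\<close>
lemma hall_profile:
  assumes H: "subgroup H G" and U: "card (carrier G) = card H * U"
    and q: "q = u * q'" and cop: "coprime q' (int U)" and K: "K = q * e"
  obtains y :: "'a \<Rightarrow> int" and M :: int
  where "\<And>g. g \<in> carrier G \<Longrightarrow> coset_sum H g = q' * y g"
    and "\<And>h. h \<in> H \<Longrightarrow> y h = y \<one>"
    and "(\<Sum>g\<in>carrier G. y g) = int (card H) * (u * e)"
    and "(\<Sum>g\<in>carrier G. y g * y g) = int (card H) * (u * y \<one> + M)"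
    and "int U * M = u * u * (e * (e - 1))"
    and "\<tau> \<le> q' * y \<one>"
proof -
  have q'0: "q' \<noteq> 0" using q q_pos by auto
  have H0: "int (card H) > 0" using card_sub_pos[OF H] by simp
  have "q' dvd coset_sum H g" if "g \<in> carrier G" for g
  proof -
    have "q dvd int U * coset_sum H g - K" using coset_sum_cong[OF H U that] .
    then have "q dvd (int U * coset_sum H g - K) + K" using q_dvd_total by (rule dvd_add)
    then have "q' dvd int U * coset_sum H g" using q by (metis diff_add_cancel dvd_mult_right)
    then show ?thesis using cop by (simp add: coprime_dvd_mult_right_iff)
  qed
  then have y: "coset_sum H g = q' * (coset_sum H g div q')" if "g \<in> carrier G" for g
    using that by simp
  define y where "y g = coset_sum H g div q'" for g
  have y: "coset_sum H g = q' * y g" if "g \<in> carrier G" for g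
    using y[OF that] by (simp add: y_def)
  have yH: "y h = y \<one>" if "h \<in> H" for h
  proof -
    have "q' * y h = q' * y \<one>"
      using coset_sum_shift[OF H one_closed that] sub_carrier[OF H that] y by (metis l_one one_closed)
    then show ?thesis using q'0 by simp
  qed
  have "q' * (\<Sum>g\<in>carrier G. y g) = q' * (int (card H) * (u * e))"
    using coset_sum_total[OF H] by (simp add: y sum_distrib_left K q mult_ac)
  then have S1: "(\<Sum>g\<in>carrier G. y g) = int (card H) * (u * e)" using q'0 by simp
  have "(\<Sum>g\<in>carrier G. coset_sum H g * coset_sum H (inv g)) = int (card H) * (q * coset_sum H \<one> + int (card H) * \<mu>)"
    using coset_sum_conv[OF H one_closed] by simp
  then have S2: "q' * q' * (\<Sum>g\<in>carrier G. y g * y g) = int (card H) * (q * (q' * y \<one>) + int (card H) * \<mu>)"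
  proof -
    assume *: "(\<Sum>g\<in>carrier G. coset_sum H g * coset_sum H (inv g)) = int (card H) * (q * coset_sum H \<one> + int (card H) * \<mu>)"
    have "(\<Sum>g\<in>carrier G. coset_sum H g * coset_sum H (inv g)) = (\<Sum>g\<in>carrier G. q' * q' * (y g * y g))"
      by (intro sum.cong refl, subst coset_sum_inv[OF H]) (simp_all add: y)
    then show ?thesis using * y[OF one_closed] by (simp add: sum_distrib_left)
  qed
  have "\<mu> * v = K * (K - q)" using total_square by (simp add: algebra_simps)
  then have muU: "int U * (int (card H) * \<mu>) = q' * q' * (u * u * (e * (e - 1)))"
    using U by (simp add: K q algebra_simps)
  then have "q' * q' dvd int U * (int (card H) * \<mu>)" by simp
  then have "q' * q' dvd int (card H) * \<mu>"
    using cop by (simp add: coprime_dvd_mult_right_iff)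
  then obtain M where M: "int (card H) * \<mu> = q' * q' * M" by (auto simp: dvd_def)
  have "q' * q' * (int U * M) = q' * q' * (u * u * (e * (e - 1)))" 
    using muU unfolding M by (simp only: mult_ac)
  then have UM: "int U * M = u * u * (e * (e - 1))" using q'0 by simp
  have "q' * q' * (\<Sum>g\<in>carrier G. y g * y g) = q' * q' * (int (card H) * (u * y \<one> + M))"
    using S2 M q by (simp add: algebra_simps)
  then have S2': "(\<Sum>g\<in>carrier G. y g * y g) = int (card H) * (u * y \<one> + M)" using q'0 by simp
  have "coset_sum H \<one> = (\<Sum>h\<in>H. E h)"
    unfolding coset_sum_def using sub_carrier[OF H] by (intro sum.cong) auto
  also have "\<dots> = \<tau> + (\<Sum>h\<in>H - {\<one>}. E h)"
    using finite_sub[OF H] subgroup.one_closed[OF H] by (simp add: sum.remove E_one)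
  finally have one: "q' * y \<one> = \<tau> + (\<Sum>h\<in>H - {\<one>}. E h)" using y by simp
  have "(\<Sum>h\<in>H - {\<one>}. E h) \<ge> 0" using sub_carrier[OF H] by (intro sum_nonneg E_nonneg) auto
  then have lo: "\<tau> \<le> q' * y \<one>" using one by linarith
  show thesis by (rule that[OF y yH S1 S2' UM lo])
qed

text \<open>An integer z satisfies $(z-k)(z-k-1) \ge 0$. Summing this for z = y(g) over the group, and keeping only the
  contribution of H, where y is constant, turns the two moments into an inequality for that constant.\<close>
lemma hall_inequality:
  assumes H: "subgroup H G" and U: "card (carrier G) = card H * U"
    and q: "q = u * q'" and cop: "coprime q' (int U)" and K: "K = q * e"
  obtains y M :: int
  where "int U * M = u * u * (e * (e - 1))"
    and "\<tau> \<le> q' * y" and "coset_sum H \<one> = q' * y"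
    and "\<And>k. 0 \<le> u * y - y * y + M - (2 * k + 1) * (u * e - y) + k * (k + 1) * (int U - 1)"
proof -
  obtain y M where F: "\<And>g. g \<in> carrier G \<Longrightarrow> coset_sum H g = q' * y g"
    and y: "\<And>h. h \<in> H \<Longrightarrow> y h = y \<one>"
      "(\<Sum>g\<in>carrier G. y g) = int (card H) * (u * e)"
      "(\<Sum>g\<in>carrier G. y g * y g) = int (card H) * (u * y \<one> + M)"
    and res: "int U * M = u * u * (e * (e - 1))" "\<tau> \<le> q' * y \<one>"
    by (rule hall_profile[OF assms]) (rule that)
  have ineq: "0 \<le> u * y \<one> - y \<one> * y \<one> + M - (2 * k + 1) * (u * e - y \<one>) + k * (k + 1) * (int U - 1)" for k
  proof -
    have pos: "0 \<le> (z - k) * (z - k - 1)" for z :: int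
      by (cases "z \<le> k") (simp_all add: mult_nonpos_nonpos)
    have "(\<Sum>g\<in>H. (y g - k) * (y g - k - 1)) \<le> (\<Sum>g\<in>carrier G. (y g - k) * (y g - k - 1))"
      using subgroup.subset[OF H] by (intro sum_mono2 fin pos) auto
    moreover have "(\<Sum>g\<in>H. (y g - k) * (y g - k - 1)) = int (card H) * ((y \<one> - k) * (y \<one> - k - 1))"
      by (simp add: y(1))
    moreover have "(\<Sum>g\<in>carrier G. (y g - k) * (y g - k - 1))
      = (\<Sum>g\<in>carrier G. y g * y g) - (2 * k + 1) * (\<Sum>g\<in>carrier G. y g) + v * (k * (k + 1))"
      by (simp add: algebra_simps sum.distrib sum_subtractf sum_distrib_left)
    moreover have "v = int (card H) * int U" using U by simp
    ultimately have "int (card H) * ((y \<one> - k) * (y \<one> - k - 1))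
       \<le> int (card H) * (u * y \<one> + M - (2 * k + 1) * (u * e) + int U * (k * (k + 1)))"
      by (simp only: y(2,3)) (simp add: algebra_simps)
    then have "(y \<one> - k) * (y \<one> - k - 1) \<le> u * y \<one> + M - (2 * k + 1) * (u * e) + int U * (k * (k + 1))"
      using card_sub_pos[OF H] by simp
    then show ?thesis by (simp add: algebra_simps)
  qed
  show thesis by (rule that[OF res F[OF one_closed] ineq])
qed

text \<open>The span of E and the constants is closed under convolution with E.\<close>
lemma conv_power_regular:
  "\<exists>c. \<forall>g\<in>carrier G. conv_power E (Suc N) g = q ^ N * E g + c"
proof (induction N)
  case 0
  then show ?case using conv_power_one by (intro exI[of _ 0]) simp
next
  case (Suc N)
  then obtain c where c: "conv_power E (Suc N) g = q ^ N * E g + c" if "g \<in> carrier G" for g by blast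
  have "conv_power E (Suc (Suc N)) g = q ^ Suc N * E g + (q ^ N * \<mu> + c * K)" if g: "g \<in> carrier G" for g
  proof -
    have "conv_power E (Suc (Suc N)) g = (\<Sum>x\<in>carrier G. E x * (q ^ N * E (inv x \<otimes> g) + c))"
      unfolding conv_power_Suc[OF fin g, of E "Suc N"] using g by (intro sum.cong) (auto simp: c)
    also have "\<dots> = q ^ N * (\<Sum>x\<in>carrier G. E x * E (inv x \<otimes> g)) + c * (\<Sum>x\<in>carrier G. E x)"
      by (simp add: sum_distrib_left sum.distrib algebra_simps)
    finally show ?thesis using conv[OF g] total by (simp add: algebra_simps)
  qed
  then show ?case by blast
qed

lemma cong_imp_E_eq:
  assumes p: "prime p" and g: "g \<in> carrier G" "g \<noteq> \<one>" and h: "h \<in> carrier G" "h \<noteq> \<one>"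
    and "[E g = E h] (mod int p)"
  shows "E g = E h"
proof -
  have "int p > 1" using p prime_gt_1_nat by fastforce
  then show ?thesis using E_01[OF g] E_01[OF h] assms(6) by (auto simp: cong_def)
qed

text \<open>Let H consist of the elements of order prime to p. Outside H there are no $p^{a+1}$-th powers, where $p^a$ is the
  exact power of p in $|G|$, so by Frobenius a convolution power of E vanishes there modulo p. As q is invertible
  modulo p, this forces E to be constant outside H. The constant 0 would make the convolution square vanish at a
  point where it is positive; the constant 1 makes the quadratic equation, restricted to H, determine K.\<close>
lemma prime_divisor_order:
  assumes p: "prime p" and dvd: "int p dvd v" and ndvd: "\<not> int p dvd q"
  shows "K = v \<or> K = v + q"
proof -
  have "p dvd card (carrier G)" using dvd by simp
  moreover have "card (carrier G) \<noteq> 0" using v_pos by simp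
  ultimately obtain a r where ar: "card (carrier G) = p ^ a * r" "\<not> p dvd r"
    using prime_power_canonical[OF p, of "card (carrier G)"] by (auto simp: mult.commute)
  define H where "H = {g \<in> carrier G. g [^] r = \<one>}"
  have H: "subgroup H G" unfolding H_def by (rule subgroup_torsion)
  note HG = sub_carrier[OF H]
  have pcop: "coprime (int p) q" using p ndvd by (simp add: prime_imp_coprime)
  have Hpow: "y [^] (p ^ Suc a) \<in> H" if y: "y \<in> carrier G" for y
  proof -
    have "y [^] (p ^ Suc a * r) = (y [^] (card (carrier G))) [^] p"
      using y ar by (simp add: nat_pow_pow mult_ac)
    also have "y [^] (card (carrier G)) = \<one>" using pow_order_eq_1[OF y] by (simp add: Coset.order_def)
    finally show ?thesis using y by (simp add: H_def nat_pow_pow)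
  qed
  have const: "E g = E h" if gh: "g \<in> carrier G - H" "h \<in> carrier G - H" for g h
  proof -
    obtain N where N: "p ^ Suc a = Suc N" using p prime_gt_0_nat by (metis Suc_pred zero_less_power)
    obtain c where c: "conv_power E (Suc N) g = q ^ N * E g + c" if "g \<in> carrier G" for g
      using conv_power_regular by blast
    have zero: "[q ^ N * E g + c = 0] (mod int p)" if g: "g \<in> carrier G - H" for g
    proof -
      have "{y \<in> carrier G. y [^] (p ^ Suc a) = g} = {}" using Hpow g by auto
      then have "(\<Sum>y\<in>{y \<in> carrier G. y [^] (p ^ Suc a) = g}. E y ^ (p ^ Suc a)) = 0"
        by (simp only: sum.empty)
      then have "[conv_power E (p ^ Suc a) g = 0] (mod int p)"
        using conv_power_Frobenius[OF fin p, of g E "Suc a"] g by (simp only: DiffD1)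
      then show ?thesis using c[of g] g N by (simp only: DiffD1)
    qed
    have "[q ^ N * E g + c = q ^ N * E h + c] (mod int p)"
      using zero[OF gh(1)] zero[OF gh(2)] by (metis cong_sym cong_trans)
    then have "[q ^ N * E g = q ^ N * E h] (mod int p)" by (simp add: cong_add_rcancel)
    moreover have "coprime (q ^ N) (int p)" using pcop by (simp add: coprime_commute)
    ultimately have "[E g = E h] (mod int p)" by (simp add: cong_mult_lcancel)
    moreover have "\<one> \<in> H" by (rule subgroup.one_closed[OF H])
    ultimately show ?thesis using cong_imp_E_eq[OF p] gh by blast
  qed
  obtain b where b: "b \<in> carrier G" "b \<noteq> \<one>" "b [^] p = \<one>"
    using exists_pow_prime_eq_one[OF fin p] dvd by auto
  have "coprime r p" using ar(2) p by (simp add: prime_imp_coprime coprime_commute)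
  then have bH: "b \<notin> H" using pow_coprime_eq_one[of b r p] b by (auto simp: H_def)
  have off: "inv x \<otimes> b \<notin> H" if "x \<in> H" for x
  proof
    assume "inv x \<otimes> b \<in> H"
    then have "x \<otimes> (inv x \<otimes> b) \<in> H" using subgroup.m_closed[OF H \<open>x \<in> H\<close>] by blast
    then show False using bH b(1) HG[OF \<open>x \<in> H\<close>] by (simp flip: m_assoc)
  qed
  have split: "sum f (carrier G) = sum f H + sum f (carrier G - H)" for f :: "'a \<Rightarrow> int"
    using sum.subset_diff[OF subgroup.subset[OF H] fin, of f] by simp
  show ?thesis
  proof (cases "E b = 0")
    case True
    have E0: "E x = 0" if "x \<in> carrier G - H" for x using const[of x b] that b bH True by simp
    have "E x * E (inv x \<otimes> b) = 0" if "x \<in> carrier G" for x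
    proof (cases "x \<in> H")
      case True
      then show ?thesis using E0[of "inv x \<otimes> b"] off[OF True] that b(1) by simp
    qed (use E0 that in simp)
    then have "(\<Sum>x\<in>carrier G. E x * E (inv x \<otimes> b)) = 0" by (intro sum.neutral ballI)
    then have "q * E b + \<mu> = 0" using conv[OF b(1)] by simp
    then show ?thesis using True mu_pos by simp
  next
    case False
    then have "E b = 1" using E_01[OF b(1,2)] by simp
    then have E1: "E x = 1" if "x \<in> carrier G - H" for x using const[of x b] that b bH by simp
    define k where "k = (\<Sum>x\<in>H. E x)"
    define n where "n = int (card H)"
    have cardD: "int (card (carrier G - H)) = v - n"
      using card_Diff_subset[OF finite_sub[OF H] subgroup.subset[OF H]] card_mono[OF fin subgroup.subset[OF H]]
      by (simp add: n_def of_nat_diff)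
    have Kk: "K = k + (v - n)"
      using split[of E] E1 total cardD by (simp add: k_def)
    have "(\<Sum>x\<in>H. E x * E (inv x \<otimes> b)) = k"
      unfolding k_def using off b(1) HG by (intro sum.cong refl) (simp add: E1)
    moreover have "(\<Sum>x\<in>carrier G - H. E x * E (inv x \<otimes> b)) = K - n"
    proof -
      have "(\<Sum>x\<in>carrier G - H. E x * E (inv x \<otimes> b)) = (\<Sum>x\<in>carrier G - H. E (inv x \<otimes> b))"
        by (intro sum.cong refl) (simp add: E1)
      also have "\<dots> = (\<Sum>x\<in>carrier G. E (inv x \<otimes> b)) - (\<Sum>x\<in>H. E (inv x \<otimes> b))"
        using split[of "\<lambda>x. E (inv x \<otimes> b)"] by simp
      also have "(\<Sum>x\<in>H. E (inv x \<otimes> b)) = n"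
        using off b(1) HG by (simp add: E1 n_def)
      also have "(\<Sum>x\<in>carrier G. E (inv x \<otimes> b)) = (\<Sum>x\<in>carrier G. E (b \<otimes> x))"
        using sum_inverse[OF subgroup_self, of "\<lambda>x. E (x \<otimes> b)"] b(1) by (simp add: m_comm cong: sum.cong)
      also have "\<dots> = K" using sum_shift[OF b(1), of E] total by simp
      finally show ?thesis .
    qed
    ultimately have c1: "q + \<mu> = k + (K - n)"
      using conv[OF b(1)] split[of "\<lambda>x. E x * E (inv x \<otimes> b)"] \<open>E b = 1\<close> by simp
    have inner: "(\<Sum>x\<in>H. E x * E (inv x \<otimes> h)) = q * E h + \<mu> - (v - n)" if h: "h \<in> H" for h
    proof -
      have "E x * E (inv x \<otimes> h) = 1" if x: "x \<in> carrier G - H" for x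
      proof -
        have "inv x \<otimes> h \<notin> H"
        proof
          assume "inv x \<otimes> h \<in> H"
          then have "h \<otimes> inv (inv x \<otimes> h) \<in> H"
            using subgroup.m_closed[OF H h] subgroup.m_inv_closed[OF H] by blast
          moreover have "h \<otimes> inv (inv x \<otimes> h) = x"
            using x HG[OF h] by (simp add: inv_mult_group m_lcomm flip: m_assoc)
          ultimately show False using x by simp
        qed
        then show ?thesis using x HG[OF h] by (simp add: E1)
      qed
      then have "(\<Sum>x\<in>carrier G - H. E x * E (inv x \<otimes> h)) = v - n" using cardD by simp
      then show ?thesis using conv[OF HG[OF h]] split[of "\<lambda>x. E x * E (inv x \<otimes> h)"] by simp
    qed
    have "k * k = (\<Sum>h\<in>H. \<Sum>x\<in>H. E x * E (inv x \<otimes> h))"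
    proof -
      have "(\<Sum>h\<in>H. \<Sum>x\<in>H. E x * E (inv x \<otimes> h)) = (\<Sum>x\<in>H. E x * (\<Sum>h\<in>H. E (inv x \<otimes> h)))"
        by (subst sum.swap) (simp add: sum_distrib_left)
      also have "\<dots> = (\<Sum>x\<in>H. E x * k)"
        using sum_translate[OF H, of _ E] subgroup.m_inv_closed[OF H] by (intro sum.cong refl) (simp add: k_def)
      finally show ?thesis by (simp add: k_def sum_distrib_right)
    qed
    also have "\<dots> = q * k + (\<mu> - (v - n)) * n"
      by (simp add: inner k_def n_def sum.distrib sum_subtractf sum_distrib_left algebra_simps)
    finally have "k * k = q * k + (\<mu> - (v - n)) * n" .
    moreover have "\<mu> = 2 * k + v - 2 * n - q" using c1 Kk by simp
    ultimately have "(k - n) * (k - n - q) = 0" by (simp add: algebra_simps)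
    then show ?thesis using Kk by auto
  qed
qed

text \<open>Raising to the power l permutes the group, so Frobenius expresses E(g) modulo l by the value at $g^l$ of
  the l-th convolution power, which is $E(g^l)$ plus a constant c since $q^{l-1} = 1$ modulo l. At the identity this
  gives c = 0, and the values 0 and 1 are distinct modulo l.\<close>
lemma E_prime_power_map:
  assumes p: "prime l" and nv: "\<not> int l dvd v" and nq: "\<not> int l dvd q" and g: "g \<in> carrier G"
  shows "E (g [^] l) = E g"
proof (cases "g = \<one>")
  case False
  obtain N where N: "l = Suc N" using p prime_gt_0_nat by (metis Suc_pred)
  obtain c where c: "conv_power E l g = q ^ N * E g + c" if "g \<in> carrier G" for g
    using conv_power_regular[of N] N by blast
  have lcop: "coprime (card (carrier G)) l"
    using nv p by (simp add: prime_imp_coprime coprime_commute)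
  have uniq: "{y \<in> carrier G. y [^] l = x [^] l} = {x}" if x: "x \<in> carrier G" for x
  proof -
    have "y = x" if y: "y \<in> carrier G" "y [^] l = x [^] l" for y
    proof -
      have "(y \<otimes> inv x) [^] l = \<one>" using x y by (simp add: nat_pow_distrib nat_pow_inv)
      moreover have "(y \<otimes> inv x) [^] card (carrier G) = \<one>"
        using pow_order_eq_1[of "y \<otimes> inv x"] x y by (simp add: Coset.order_def)
      ultimately have "y \<otimes> inv x = \<one>" using pow_coprime_eq_one[OF _ _ _ lcop] x y by simp
      then show ?thesis using x y by (metis inv_inv inv_equality inv_closed)
    qed
    then show ?thesis using x by auto
  qed
  have fr: "[q ^ N * E (x [^] l) + c = E x] (mod int l)" if x: "x \<in> carrier G" for x
  proof -
    have "[conv_power E l (x [^] l) = E x ^ l] (mod int l)"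
      using conv_power_Frobenius[OF fin p, of "x [^] l" E 1] uniq[OF x] x by simp
    then show ?thesis using fermat_int[OF p, of "E x"] c[of "x [^] l"] x by (metis cong_trans nat_pow_closed)
  qed
  have qN: "[q ^ N = 1] (mod int l)"
  proof -
    have "[q ^ N * q = 1 * q] (mod int l)" using fermat_int[OF p, of q] N by (simp add: mult.commute)
    moreover have "coprime q (int l)" using nq p prime_imp_coprime[of "int l" q] by (simp add: coprime_commute)
    ultimately show ?thesis by (simp only: cong_mult_rcancel)
  qed
  have fr': "[E (x [^] l) + c = E x] (mod int l)" if x: "x \<in> carrier G" for x
  proof -
    have "[q ^ N * E (x [^] l) + c = 1 * E (x [^] l) + c] (mod int l)"
      using qN by (intro cong_add cong_mult) auto
    then show ?thesis using fr[OF x] by (metis cong_sym cong_trans mult_1)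
  qed
  have "[\<tau> + c = \<tau>] (mod int l)" using fr'[of \<one>] by (simp add: E_one)
  then have "[c = 0] (mod int l)" by (metis add_cancel_right_right cong_add_lcancel)
  then have "[E (g [^] l) + 0 = E g] (mod int l)"
    using fr'[OF g] by (meson cong_add_lcancel cong_sym cong_trans)
  moreover have "g [^] l \<noteq> \<one>" using uniq[of \<one>] g False by auto
  ultimately show ?thesis using cong_imp_E_eq[OF p, of "g [^] l" g] g False by simp
qed simp

lemma E_power_map:
  assumes cop: "coprime (int j) v" and pq: "\<And>p. prime p \<Longrightarrow> int p dvd q \<Longrightarrow> int p dvd v"
    and j: "j > 0" and g: "g \<in> carrier G"
  shows "E (g [^] j) = E g"
  using cop j g
proof (induction j arbitrary: g rule: less_induct)
  case (less j)
  show ?case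
  proof (cases "j = 1")
    case True then show ?thesis using less.prems by simp
  next
    case False
    then obtain p where p: "prime p" "p dvd j" using prime_factor_nat by blast
    then obtain i where i: "j = p * i" by blast
    have i0: "i > 0" "i < j" using i less.prems(2) prime_gt_1_nat[OF p(1)] by auto
    have cops: "coprime (int p) v" "coprime (int i) v" using less.prems(1) i by simp_all
    have nv: "\<not> int p dvd v"
    proof
      assume "int p dvd v"
      then have "int p dvd 1" using coprime_common_divisor[OF cops(1), of "int p"] by simp
      then show False using p(1) by simp
    qed
    have "E ((g [^] i) [^] p) = E (g [^] i)"
      using E_prime_power_map[OF p(1) nv] pq[OF p(1)] nv less.prems(3) by auto
    also have "\<dots> = E g" using less.IH[OF i0(2) cops(2) i0(1) less.prems(3)] .
    finally show ?thesis using less.prems(3) i by (simp add: nat_pow_pow mult.commute)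
  qed
qed

end

section \<open>A finite search\<close>

text \<open>Whether P divides \<open>x * \<gamma> ^ 8\<close>, with the powers formed modulo P so that the numbers stay small.\<close>
definition smooth_quotient :: "int \<Rightarrow> int \<Rightarrow> int \<Rightarrow> bool" where
  "smooth_quotient \<gamma> x P = (if \<gamma> = 1 then x mod P = 0 else
     let r = \<gamma> * \<gamma> mod P; s = r * r mod P; t = s * s mod P in x * t mod P = 0)"

text \<open>Whether w divides \<open>q ^ 64\<close>, by six squarings modulo w. For w below $2^{65}$ whose prime factors all divide q
  this is certain to hold.\<close>
definition radical_test :: "int \<Rightarrow> int \<Rightarrow> bool" where
  "radical_test q w = (let a = q mod w; b = a * a mod w; c = b * b mod w; d = c * c mod w;
     e = d * d mod w; f = e * e mod w; g = f * f mod w in g = 0)"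

text \<open>With \<open>P = \<beta> + a' * \<delta>\<close> and \<open>Q = a * P + \<delta>\<close>, the ranges contain all positive integers with
  \<open>\<beta> * \<gamma> * Q \<le> 1001\<close>. The last filter asks that all primes dividing $w = v/q$ divide q; the one on P is a
  consequence of it and is tested first because it does not involve the innermost variable.\<close>
definition candidates :: "int \<Rightarrow> (int \<times> int \<times> int \<times> int \<times> int) list" where
  "candidates \<gamma> = [(\<beta>, \<gamma>, \<delta>, a', a).
      \<beta> \<leftarrow> [1..1001 div \<gamma>],
      \<delta> \<leftarrow> [1..(1001 div (\<beta> * \<gamma>) - \<beta>) div 2],
      \<beta> * \<gamma> * \<delta> \<noteq> 1,
      a' \<leftarrow> [1..(1001 div (\<beta> * \<gamma>) - \<beta> - \<delta>) div \<delta>],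
      smooth_quotient \<gamma> (\<beta> * \<gamma> * \<delta> - 1) (\<beta> + a' * \<delta>),
      a \<leftarrow> [1..(1001 div (\<beta> * \<gamma>) - \<delta>) div (\<beta> + a' * \<delta>)],
      (\<beta> + a' * \<delta>) * (a * \<gamma> * ((\<beta> + a' * \<delta>) * (\<beta> + a' * \<delta>)) - 1) mod
        (\<beta> * \<gamma> * (a * (\<beta> + a' * \<delta>) + \<delta>) - 1) = 0,
      radical_test (a' * \<gamma> * ((a * (\<beta> + a' * \<delta>) + \<delta>) * (a * (\<beta> + a' * \<delta>) + \<delta>)))
        (\<gamma> * (\<beta> + a' * \<delta>) * (a * (\<beta> + a' * \<delta>) + \<delta>) *
          (a * \<gamma> * ((\<beta> + a' * \<delta>) * (\<beta> + a' * \<delta>)) - 1) div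
          (\<beta> * \<gamma> * (a * (\<beta> + a' * \<delta>) + \<delta>) - 1))]"

text \<open>The search is evaluated by rewriting, in pieces of comparable size.\<close>
lemma candidates_1_1: "concat (map candidates [1..1]) = [(2, 1, 3, 1, 1), (3, 1, 4, 2, 1), (4, 1, 5, 3, 1), (5, 1, 2, 2, 17), (5, 1, 6, 4, 1), (5, 1, 8, 1, 1), (6, 1, 7, 5, 1), (7, 1, 5, 2, 1), (7, 1, 8, 6, 1), (8, 1, 9, 7, 1), (9, 1, 10, 8, 1), (11, 1, 15, 2, 1), (13, 1, 21, 1, 1), (16, 1, 7, 3, 1)]"
  by code_simp

lemma candidates_2_4: "concat (map candidates [2..4]) = [(1, 2, 11, 1, 2), (2, 2, 19, 2, 2), (4, 2, 7, 1, 3), (1, 3, 8, 1, 3), (1, 4, 19, 1, 4)]"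
  by code_simp

lemma candidates_5_16: "concat (map candidates [5..16]) = []"
  by code_simp

lemma candidates_17_333: "concat (map candidates [17..333]) = []"
  by code_simp

section \<open>Parametrisation of the divisibility conditions\<close>

text \<open>Let $c = n A^2/q$ and $r = n m A/q$, which are integers, and $d = A - r$. Then $r = c + n d$, and $c$ divides
  $n d^2$. Write $c = b a$ and $n = a' a$ with $b$ prime to $a'$; then $b$ divides $d^2$, so $b = \beta^2 \gamma$ and
  $d = \beta \gamma \delta$ with $\beta$ prime to $\delta$. All quantities are polynomials in these five integers.\<close>
lemma benson_parametrisation:
  fixes n m q A :: nat
  assumes sum: "(n + 1) * m = q + A" and dvd: "q dvd n * m^2" and Am: "A < m"
    and pos: "n > 0" "q > 0" "A > 0"
  obtains \<beta> \<gamma> \<delta> a a' P Q where "\<beta> > 0" "\<gamma> > 0" "\<delta> > 0" "a > 0" "a' > 0"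
    and "P = \<beta> + a' * \<delta>" "Q = a * P + \<delta>" "n = a * a'" "A = \<beta> * \<gamma> * Q" "m = \<gamma> * P * Q"
    and "q = a' * \<gamma> * Q^2" "coprime \<beta> \<delta>" "coprime \<beta> a'"
proof -
  obtain e where e: "n * m^2 = q * e" using dvd by blast
  have "n * (q + A)^2 = q * (n * (q + 2 * A)) + n * A^2"
    by (simp add: algebra_simps power2_eq_square)
  moreover have "q dvd n * (q + A)^2"
    using dvd unfolding sum[symmetric] power_mult_distrib by (metis dvd_mult mult.left_commute)
  ultimately have "q dvd n * A^2" by (metis dvd_add_right_iff dvd_triv_left)
  then obtain c where c: "n * A^2 = q * c" by blast
  \<comment> \<open>$q^2$ divides the square of $n m A$, hence q divides $n m A$.\<close>
  have "(n * m * A)^2 = (n * m^2) * (n * A^2)" by (simp add: power2_eq_square)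
  then have sq: "(n * m * A)^2 = q^2 * (e * c)" unfolding e c by (simp add: power2_eq_square)
  then have "q^2 dvd (n * m * A)^2" by simp
  then have "q dvd n * m * A" by simp
  then obtain r where r: "n * m * A = q * r" by blast
  have "q * ((n + 1) * r) = (n + 1) * (q * r)" by (simp only: mult.left_commute)
  also have "\<dots> = n * A * ((n + 1) * m)" unfolding r[symmetric] by (simp only: mult_ac)
  also have "\<dots> = q * (n * A + c)" unfolding sum using c by (simp add: algebra_simps power2_eq_square)
  finally have r1: "(n + 1) * r = n * A + c" using pos by simp
  have "q * (c * m) = q * (r * A)" using c r by (metis mult.assoc mult.commute power2_eq_square)
  then have cm: "c * m = r * A" using pos by simp
  have c0: "c > 0" using c pos by (metis gr0I mult_eq_0_iff power_not_zero less_not_refl)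
  have "q * c < q * r" unfolding c[symmetric] r[symmetric] using Am pos by (simp add: power2_eq_square)
  then have cr: "c < r" by simp
  define d where "d = A - r"
  have "n * r + r = n * A + c" using r1 by (simp add: algebra_simps)
  then have "n * r < n * A" using cr by linarith
  then have rA: "r < A" by simp
  then have d0: "d > 0" and Ard: "A = r + d" by (simp_all add: d_def)
  have rc: "r = c + n * d" using \<open>n * r + r = n * A + c\<close> unfolding Ard by (simp add: algebra_simps)
  have "q^2 * (e * c) = q^2 * r^2" using sq r by (simp only: power_mult_distrib)
  then have ce: "c * e = r^2" using pos by (simp add: mult.commute)
  have "(c + n * d)^2 = c * (c + 2 * (n * d)) + n * (n * d^2)"
    by (simp add: algebra_simps power2_eq_square)
  moreover have "c dvd (c + n * d)^2" using ce rc by (metis dvd_triv_left)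
  ultimately have d1: "c dvd n * (n * d^2)" by (metis dvd_add_right_iff dvd_triv_left)
  have "(c + n * d) * (c + n * d + d) = c * (c + 2 * (n * d) + d) + (n * (n * d^2) + n * d^2)"
    by (simp add: algebra_simps power2_eq_square)
  moreover have "c dvd (c + n * d) * (c + n * d + d)" using cm rc Ard by (metis dvd_triv_left)
  ultimately have "c dvd n * (n * d^2) + n * d^2" by (metis dvd_add_right_iff dvd_triv_left)
  then have cnd: "c dvd n * d^2" using d1 by (metis dvd_add_right_iff)
  define a where "a = gcd c n"
  have a0: "a > 0" using pos by (simp add: a_def)
  obtain b a' where ba: "c = b * a" "n = a' * a" "coprime b a'"
    using gcd_coprime_exists[of c n] a0 unfolding a_def by blast
  have "b dvd a' * d^2" using cnd a0 unfolding ba by (simp add: mult_ac)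
  then have bd: "b dvd d^2" using ba(3) by (simp add: coprime_dvd_mult_right_iff)
  define g where "g = gcd b d"
  have g0: "g > 0" using d0 by (simp add: g_def)
  obtain \<beta> \<delta> where bdel: "b = \<beta> * g" "d = \<delta> * g" "coprime \<beta> \<delta>"
    using gcd_coprime_exists[of b d] g0 unfolding g_def by blast
  have "\<beta> * g dvd (\<delta>^2 * g) * g" using bd unfolding bdel by (simp add: power2_eq_square mult_ac)
  then obtain k where "(\<delta>^2 * g) * g = \<beta> * g * k" by blast
  then have "g * (\<delta>^2 * g) = g * (\<beta> * k)" by (simp only: mult_ac)
  then have "\<delta>^2 * g = \<beta> * k" using g0 by simp
  then have "\<beta> dvd \<delta>^2 * g" by simp
  then have "\<beta> dvd g" using bdel(3) by (simp add: coprime_dvd_mult_right_iff)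
  then obtain \<gamma> where \<gamma>: "g = \<beta> * \<gamma>" by blast
  define P where "P = \<beta> + a' * \<delta>"
  define Q where "Q = a * P + \<delta>"
  have r2: "r = a * \<beta> * \<gamma> * P"
    unfolding rc ba bdel \<gamma> P_def by (simp add: algebra_simps)
  have A2: "A = \<beta> * \<gamma> * Q"
    unfolding Ard r2 bdel \<gamma> Q_def by (simp add: algebra_simps)
  have pos2: "\<beta> > 0" "\<gamma> > 0" "\<delta> > 0" "a' > 0"
    using c0 d0 pos(1) ba bdel \<gamma> by (auto intro: gr0I)
  have c2: "c = a * \<beta> * \<beta> * \<gamma>" unfolding ba bdel \<gamma> by simp
  have z: "a * \<beta> * \<beta> * \<gamma> > 0" using a0 pos2 by simp
  have "(a * \<beta> * \<beta> * \<gamma>) * m = (a * \<beta> * \<beta> * \<gamma>) * (\<gamma> * P * Q)"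
    using cm unfolding c2 r2 A2 by (simp add: algebra_simps)
  then have m2: "m = \<gamma> * P * Q" using z by (simp only: mult_cancel1) simp
  have "(a * \<beta> * \<beta> * \<gamma>) * q = (a * \<beta> * \<beta> * \<gamma>) * (a' * \<gamma> * Q^2)"
    using c[symmetric] unfolding c2 A2 ba(2) by (simp add: algebra_simps power2_eq_square)
  then have q2: "q = a' * \<gamma> * Q^2" using z by (simp only: mult_cancel1) simp
  have "coprime \<beta> a'" using ba(3) bdel(1) by simp
  then show thesis
    using that[OF pos2(1-3) a0 pos2(4) P_def Q_def _ A2 m2 q2 bdel(3)] ba(2) by (simp add: mult.commute)
qed

lemma multiplicity_less_log:
  fixes P :: nat
  assumes "prime p" "P > 0" "P < 2 ^ Suc k"
  shows "multiplicity p P \<le> k"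
proof -
  have "p ^ multiplicity p P \<le> P" using assms(2) by (intro dvd_imp_le multiplicity_dvd)
  moreover have "2 ^ multiplicity p P \<le> p ^ multiplicity p P"
    using prime_ge_2_nat[OF assms(1)] by (intro power_mono) auto
  ultimately have "(2::nat) ^ multiplicity p P < 2 ^ Suc k" using assms(3) by linarith
  then have "multiplicity p P < Suc k" by (rule power_less_imp_less_exp[rotated]) simp
  then show ?thesis by simp
qed

text \<open>The exponent of a prime in w is at most k because w is less than $2^{k+1}$.\<close>
lemma dvd_power_of_radical:
  fixes w q :: nat
  assumes w: "w > 0" "w < 2 ^ Suc k" and q: "q > 0" and rad: "\<And>p. prime p \<Longrightarrow> p dvd w \<Longrightarrow> p dvd q"
  shows "w dvd q ^ k"
proof (rule multiplicity_le_imp_dvd)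
  show "w \<noteq> 0" using w by simp
  fix p :: nat assume p: "prime p"
  show "multiplicity p w \<le> multiplicity p (q ^ k)"
  proof (cases "p dvd w")
    case True
    then have "multiplicity p q \<ge> 1" using rad[OF p] p q
      by (metis One_nat_def Suc_leI multiplicity_gt_zero_iff not_prime_unit less_numeral_extra(3))
    then have "k \<le> k * multiplicity p q" by simp
    moreover have "multiplicity p (q ^ k) = k * multiplicity p q"
      using p q by (simp add: prime_elem_multiplicity_power_distrib)
    ultimately show ?thesis using multiplicity_less_log[OF p w] by linarith
  next
    case False
    then show ?thesis by (simp add: not_dvd_imp_multiplicity_0)
  qed
qed

text \<open>The exponent of a prime in P is at most k, so a single factor of that prime in $\gamma$ suffices in $\gamma^k$.\<close>
lemma dvd_mult_power_reduce:
  fixes P x \<gamma> :: nat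
  assumes dvd: "P dvd x * \<gamma> ^ N" and P: "P > 0" "P < 2 ^ Suc k" and pos: "x > 0" "\<gamma> > 0"
  shows "P dvd x * \<gamma> ^ k"
proof (rule multiplicity_le_imp_dvd)
  show "P \<noteq> 0" using P by simp
  fix p :: nat assume p: "prime p"
  have mult: "multiplicity p (x * \<gamma> ^ j) = multiplicity p x + j * multiplicity p \<gamma>" for j
    using p pos by (simp add: prime_elem_multiplicity_mult_distrib prime_elem_multiplicity_power_distrib)
  have "multiplicity p P \<le> multiplicity p x + N * multiplicity p \<gamma>"
    using dvd_imp_multiplicity_le[OF dvd, of p] pos by (simp add: mult)
  moreover have "multiplicity p P \<le> k" by (rule multiplicity_less_log[OF p P])
  moreover have "k \<le> k * multiplicity p \<gamma>" if "multiplicity p \<gamma> > 0" using that by simp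
  ultimately show "multiplicity p P \<le> multiplicity p (x * \<gamma> ^ k)"
    unfolding mult by (cases "multiplicity p \<gamma> = 0") (simp, linarith)
qed

lemma radical_test_int:
  assumes "w dvd q ^ 64"
  shows "radical_test q w"
proof -
  have "radical_test q w \<longleftrightarrow> q ^ 64 mod w = 0"
    by (simp add: radical_test_def Let_def power_mod mod_mult_eq mod_mult_left_eq mod_mult_right_eq flip: power_mult power2_eq_square)
  then show ?thesis using assms by simp
qed

lemma smooth_quotient_int:
  assumes "P dvd x * \<gamma> ^ 8"
  shows "smooth_quotient \<gamma> x P"
proof -
  have "x * (((\<gamma> * \<gamma> mod P) * (\<gamma> * \<gamma> mod P) mod P) * ((\<gamma> * \<gamma> mod P) * (\<gamma> * \<gamma> mod P) mod P) mod P) mod P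
    = x * \<gamma> ^ 8 mod P"
    by (simp add: power_mod mod_mult_eq mod_mult_left_eq mod_mult_right_eq flip: power_mult power2_eq_square)
  then show ?thesis using assms by (cases "\<gamma> = 1") (simp_all add: smooth_quotient_def Let_def)
qed

lemma le_div_int: "0 < c \<Longrightarrow> b * c \<le> a \<Longrightarrow> b \<le> a div (c::int)"
  by (metis nonzero_mult_div_cancel_right order_less_irrefl zdiv_mono1)

lemma set_concat_mapI: "x \<in> set xs \<Longrightarrow> y \<in> set (f x) \<Longrightarrow> y \<in> set (concat (map f xs))"
  by auto

lemma in_candidates:
  fixes \<beta> \<gamma> \<delta> a a' P Q :: int
  assumes pos: "\<beta> > 0" "\<gamma> > 0" "\<delta> > 0" "a > 0" "a' > 0"
    and PQ: "P = \<beta> + a' * \<delta>" "Q = a * P + \<delta>" and A: "\<beta> * \<gamma> * Q \<le> 1001"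
    and d: "\<beta> * \<gamma> * \<delta> \<noteq> 1"
    and dvd1: "P dvd (\<beta> * \<gamma> * \<delta> - 1) * \<gamma> ^ 8"
    and w: "(\<beta> * \<gamma> * Q - 1) * w = \<gamma> * P * Q * (a * \<gamma> * (P * P) - 1)"
    and dvd2: "\<beta> * \<gamma> * Q - 1 dvd P * (a * \<gamma> * (P * P) - 1)"
    and rad: "w dvd (a' * \<gamma> * (Q * Q)) ^ 64"
    and A1: "\<beta> * \<gamma> * Q > 1"
  shows "(\<beta>, \<gamma>, \<delta>, a', a) \<in> set (candidates \<gamma>)" "\<gamma> \<le> 333"
proof -
  have N: "\<beta> * \<gamma> > 0" using pos by simp
  have Q: "Q \<le> 1001 div (\<beta> * \<gamma>)" using A N by (intro le_div_int) (simp_all add: mult_ac)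
  have "a' * \<delta> \<ge> \<delta>" using pos by simp
  have P0: "P > 0" unfolding PQ using pos by (simp add: add_pos_pos)
  have "a * P \<ge> P" using pos P0 by simp
  then have Q1: "\<beta> + \<delta> + a' * \<delta> \<le> Q" "\<beta> + 2 * \<delta> \<le> Q"
    using \<open>a' * \<delta> \<ge> \<delta>\<close> unfolding PQ by linarith+
  have Q3: "Q \<ge> 3" using Q1 pos by linarith
  have "3 * \<gamma> \<le> Q * (\<beta> * \<gamma>)" using Q3 pos by (intro mult_mono) auto
  then show "\<gamma> \<le> 333" using A by (simp add: mult_ac)
  have "1 * (\<beta> * \<gamma>) \<le> Q * (\<beta> * \<gamma>)" using Q3 N by (intro mult_right_mono) auto
  moreover have "Q * (\<beta> * \<gamma>) \<le> 1001" using A by (simp add: mult_ac)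
  ultimately have b1: "\<beta> \<le> 1001 div \<gamma>" using pos by (intro le_div_int) linarith+
  have b2: "\<delta> \<le> (1001 div (\<beta> * \<gamma>) - \<beta>) div 2" using Q Q1 by (intro le_div_int) simp_all
  have b3: "a' \<le> (1001 div (\<beta> * \<gamma>) - \<beta> - \<delta>) div \<delta>" using Q Q1 pos by (intro le_div_int) simp_all
  have b4: "a \<le> (1001 div (\<beta> * \<gamma>) - \<delta>) div (\<beta> + a' * \<delta>)"
    using Q P0 unfolding PQ(1)[symmetric] by (intro le_div_int) (simp_all add: PQ(2))
  have t1: "smooth_quotient \<gamma> (\<beta> * \<gamma> * \<delta> - 1) P" by (rule smooth_quotient_int[OF dvd1])
  have t2: "P * (a * \<gamma> * (P * P) - 1) mod (\<beta> * \<gamma> * Q - 1) = 0" using dvd2 by simp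
  have "\<gamma> * P * Q * (a * \<gamma> * (P * P) - 1) div (\<beta> * \<gamma> * Q - 1) = w"
    using A1 unfolding w[symmetric] by simp
  then have t3: "radical_test (a' * \<gamma> * (Q * Q)) (\<gamma> * P * Q * (a * \<gamma> * (P * P) - 1) div (\<beta> * \<gamma> * Q - 1))"
    using radical_test_int[OF rad] by simp
  have m1: "\<beta> \<in> set [1..1001 div \<gamma>]" using b1 pos by (simp only: set_upto atLeastAtMost_iff int_one_le_iff_zero_less)
  have m2: "\<delta> \<in> set [1..(1001 div (\<beta> * \<gamma>) - \<beta>) div 2]"
    using b2 pos by (simp only: set_upto atLeastAtMost_iff int_one_le_iff_zero_less)
  have m3: "a' \<in> set [1..(1001 div (\<beta> * \<gamma>) - \<beta> - \<delta>) div \<delta>]"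
    using b3 pos by (simp only: set_upto atLeastAtMost_iff int_one_le_iff_zero_less)
  have m4: "a \<in> set [1..(1001 div (\<beta> * \<gamma>) - \<delta>) div (\<beta> + a' * \<delta>)]"
    using b4 pos by (simp only: set_upto atLeastAtMost_iff int_one_le_iff_zero_less)
  note t = t1[unfolded PQ(1)] t2[unfolded PQ(2), unfolded PQ(1)] t3[unfolded PQ(2), unfolded PQ(1)]
  show "(\<beta>, \<gamma>, \<delta>, a', a) \<in> set (candidates \<gamma>)"
    unfolding candidates_def
    by (rule set_concat_mapI[OF m1], rule set_concat_mapI[OF m2], subst if_P[OF d],
        rule set_concat_mapI[OF m3], subst if_P[OF t(1)], rule set_concat_mapI[OF m4],
        subst if_P[OF t(2)], subst if_P[OF t(3)], rule list.set_intros(1))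
qed

lemma le_333_cases:
  assumes "0 < (\<gamma>::int)" "\<gamma> \<le> 333" "x \<in> set (candidates \<gamma>)"
  shows "x \<in> set (concat (map candidates [1..1])) \<or> x \<in> set (concat (map candidates [2..4]))
    \<or> x \<in> set (concat (map candidates [5..16])) \<or> x \<in> set (concat (map candidates [17..333]))"
proof -
  have *: "x \<in> set (concat (map candidates [l..u]))" if "l \<le> \<gamma>" "\<gamma> \<le> u" for l u
  proof -
    have "\<gamma> \<in> set [l..u]" using that by (simp only: set_upto atLeastAtMost_iff)
    then show ?thesis using assms(3) unfolding set_concat set_map by (rule UN_I[OF imageI])
  qed
  consider "\<gamma> \<le> 1" | "2 \<le> \<gamma>" "\<gamma> \<le> 4" | "5 \<le> \<gamma>" "\<gamma> \<le> 16" | "17 \<le> \<gamma>" by linarith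
  then show ?thesis
  proof cases
    case 1 then show ?thesis using *[of 1 1] assms(1) by linarith
  next
    case 2 then show ?thesis using *[of 2 4] by blast
  next
    case 3 then show ?thesis using *[of 5 16] by blast
  next
    case 4 then show ?thesis using *[of 17 333] assms(2) by blast
  qed
qed

section \<open>Exclusion of parameters by Hall subgroups\<close>

context comm_group begin

lemma complementary_sum:
  fixes f :: "'a \<Rightarrow> 'c::comm_monoid_add"
  assumes fin: "finite (carrier G)" and A: "subgroup A G" and B: "subgroup B G"
    and card: "card (carrier G) = card A * card B" and cop: "coprime (card A) (card B)"
  shows "sum f (carrier G) = (\<Sum>a\<in>A. \<Sum>b\<in>B. f (a \<otimes> b))" and "A \<inter> B = {\<one>}"
proof -
  have AG: "a \<in> carrier G" if "a \<in> A" for a using subgroup.mem_carrier[OF A that] .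
  have BG: "b \<in> carrier G" if "b \<in> B" for b using subgroup.mem_carrier[OF B that] .
  have int: "x = \<one>" if "x \<in> A" "x \<in> B" for x
    using pow_coprime_eq_one[OF AG[OF that(1)] subgroup_pow_card[OF A that(1)] subgroup_pow_card[OF B that(2)] cop] .
  then show "A \<inter> B = {\<one>}" using subgroup.one_closed[OF A] subgroup.one_closed[OF B] by blast
  have inj: "inj_on (\<lambda>(a, b). a \<otimes> b) (A \<times> B)"
  proof (rule inj_onI, clarify)
    fix a b a' b' assume ab: "a \<in> A" "b \<in> B" "a' \<in> A" "b' \<in> B" "a \<otimes> b = a' \<otimes> b'"
    note c = AG[OF ab(1)] AG[OF ab(3)] BG[OF ab(2)] BG[OF ab(4)]
    have "inv a' \<otimes> a = b' \<otimes> inv b"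
    proof -
      have "inv a' \<otimes> a = inv a' \<otimes> (a \<otimes> b) \<otimes> inv b" using c by (simp add: m_assoc)
      also have "\<dots> = inv a' \<otimes> (a' \<otimes> b') \<otimes> inv b" using ab(5) by simp
      also have "\<dots> = b' \<otimes> inv b" using c by (simp flip: m_assoc)
      finally show ?thesis .
    qed
    moreover have "inv a' \<otimes> a \<in> A" using ab A by (simp add: subgroup.m_closed subgroup.m_inv_closed)
    moreover have "b' \<otimes> inv b \<in> B" using ab B by (simp add: subgroup.m_closed subgroup.m_inv_closed)
    ultimately have "inv a' \<otimes> a = \<one>" "b' \<otimes> inv b = \<one>" using int by metis+
    then show "a = a' \<and> b = b'" using c by (metis inv_equality inv_inv inv_closed inv_char m_comm)
  qed
  have fAB: "finite A" "finite B"
    using finite_subset[OF _ fin] subgroup.subset[OF A] subgroup.subset[OF B] by auto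
  have "card ((\<lambda>(a, b). a \<otimes> b) ` (A \<times> B)) = card (carrier G)"
    using inj card by (simp add: card_image card_cartesian_product)
  moreover have "(\<lambda>(a, b). a \<otimes> b) ` (A \<times> B) \<subseteq> carrier G" using AG BG by auto
  ultimately have img: "(\<lambda>(a, b). a \<otimes> b) ` (A \<times> B) = carrier G"
    using card_subset_eq[OF fin] by blast
  have "sum f (carrier G) = sum (f \<circ> (\<lambda>(a, b). a \<otimes> b)) (A \<times> B)"
    unfolding img[symmetric] by (rule sum.reindex[OF inj])
  also have "\<dots> = (\<Sum>a\<in>A. \<Sum>b\<in>B. f (a \<otimes> b))"
    by (simp add: sum.cartesian_product case_prod_unfold)
  finally show "sum f (carrier G) = (\<Sum>a\<in>A. \<Sum>b\<in>B. f (a \<otimes> b))" .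
qed

end

text \<open>The parameters of a rigid pair: m is the number of points on a line and n the number of orbits of lines, so that
  each point is on \<open>n * m\<close> lines.\<close>
locale rigid_pds = pds_group G E q \<mu> K \<tau> for G (structure) and E q \<mu> K \<tau> +
  fixes n m \<alpha> :: nat
  assumes q_eq: "q = (int n + 1) * int m - (int \<alpha> + 1)"
    and mu_eq: "\<mu> = int \<alpha> * (int n * int m)"
    and K_eq: "K = int n * int m * int m"
    and tau_eq: "\<tau> = int n * int m"
    and alpha_ge: "\<alpha> \<ge> 2" and m_ge: "m \<ge> \<alpha> + 2"
    and adjacent: "\<exists>g\<in>carrier G. g \<noteq> \<one> \<and> E g = 1"
begin

lemma n_pos: "n > 0"
  using tau_pos tau_eq by (cases n) auto

lemma alpha_order: "int \<alpha> * v = int m * (K - q)"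
proof -
  have "\<mu> * v = K * (K - q)" using total_square by (simp add: algebra_simps)
  then have "(int n * int m) * (int \<alpha> * v) = (int n * int m) * (int m * (K - q))"
    by (simp add: mu_eq K_eq algebra_simps)
  then show ?thesis using n_pos m_ge by simp
qed

lemma q_dvd_order: "q dvd v"
proof -
  obtain g where "g \<in> carrier G" "E g = 1" using adjacent by blast
  then have "q dvd v - K" using q_dvd[of g] by simp
  then have "q dvd (v - K) + K" using q_dvd_total by (rule dvd_add)
  then show ?thesis by simp
qed

lemma quotients:
  obtains e w :: int where "K = q * e" "v = q * w" "int \<alpha> * w = int m * (e - 1)" "e > 1" "w > 0"
proof -
  obtain e where e: "K = q * e" using q_dvd_total by blast
  obtain w where w: "v = q * w" using q_dvd_order by blast
  have "q * (int \<alpha> * w) = q * (int m * (e - 1))"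
    using alpha_order unfolding w e by (simp add: algebra_simps)
  then have aw: "int \<alpha> * w = int m * (e - 1)" using q_pos by simp
  have "0 < q * w" using v_pos w by simp
  then have w0: "w > 0" using q_pos by (simp add: zero_less_mult_iff)
  then have "0 < int m * (e - 1)" unfolding aw[symmetric] using alpha_ge by simp
  then have "e > 1" by (simp add: zero_less_mult_iff)
  then show thesis using that[OF e w aw _ w0] by simp
qed

text \<open>Otherwise K is v or v + q, and both values contradict the relation \<open>\<alpha> * v = m * (K - q)\<close> by size.\<close>
lemma prime_dvd_q:
  assumes p: "prime p" and dvd: "int p dvd v"
  shows "int p dvd q"
proof (rule ccontr)
  assume "\<not> int p dvd q"
  obtain e w :: int where K_e: "K = q * e" and v_w: "v = q * w" and alpha_w: "int \<alpha> * w = int m * (e - 1)"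
    and e_gt_1: "e > 1" and w_pos: "w > 0" by (rule quotients)
  from prime_divisor_order[OF p dvd \<open>\<not> int p dvd q\<close>] consider "q * e = q * w" | "q * e = q * (w + 1)"
    using v_w K_e by (auto simp: algebra_simps)
  then consider "e = w" | "e = w + 1" using q_pos by fastforce
  then show False
  proof cases
    case 2
    then have "int \<alpha> * w = int m * w" using alpha_w by simp
    then show False using w_pos m_ge by simp
  next
    case 1
    have "(int m - int \<alpha>) * e = int m" using alpha_w 1 by (simp add: algebra_simps)
    moreover have "2 * e \<le> (int m - int \<alpha>) * e" using m_ge e_gt_1 by (intro mult_right_mono) auto
    ultimately have 2: "2 * e \<le> int m" by simp
    have "q < (int n + 1) * int m" using q_eq alpha_ge by simp
    then have "q * e < (int n + 1) * int m * e" using e_gt_1 by simp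
    then have "int m * (int n * int m) < int m * ((int n + 1) * e)"
      using K_e K_eq by (simp add: algebra_simps)
    then have "int n * int m < (int n + 1) * e" by (simp add: mult_less_cancel_left)
    also have "\<dots> \<le> (2 * int n) * e" using n_pos e_gt_1 by (intro mult_right_mono) auto
    also have "\<dots> \<le> int n * int m" using mult_left_mono[OF 2, of "int n"] by (simp add: mult_ac)
    finally show False by simp
  qed
qed

text \<open>The value y of \<open>hall_inequality\<close> at the identity is at least \<open>lo\<close>, since the coset sum there is at
  least \<open>n * m\<close>. For a fixed k the quadratic in y decreases from there on, so it is enough that it is
  negative at \<open>lo\<close>.\<close>
lemma hall_excludes:
  fixes h U u q' \<epsilon> M lo k :: nat
  assumes card: "card (carrier G) = h * U" and cop1: "coprime h U"
    and q: "q = int u * int q'" and cop2: "coprime q' U" and K: "K = q * int \<epsilon>"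
    and M: "U * M = u * u * (\<epsilon> * (\<epsilon> - 1))" and lo: "q' * lo < n * m + q'" and k: "u + 2 * k \<le> 2 * lo"
    and neg: "int u * int lo - int lo * int lo + int M - (2 * int k + 1) * (int u * int \<epsilon> - int lo)
        + int k * (int k + 1) * (int U - 1) < 0"
  shows False
proof -
  obtain H where H: "subgroup H G" "card H = h" using exists_hall_subgroup[OF fin card cop1] by blast
  have U0: "U > 0" using card v_pos by (auto intro: gr0I)
  have q'0: "q' > 0" using q q_pos by (auto intro: gr0I)
  obtain y M' where y: "int U * M' = int u * int u * (int \<epsilon> * (int \<epsilon> - 1))" "\<tau> \<le> int q' * y"
    "coset_sum H \<one> = int q' * y" "\<And>k. 0 \<le> int u * y - y * y + M' - (2 * k + 1) * (int u * int \<epsilon> - y) + k * (k + 1) * (int U - 1)"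
    by (rule hall_inequality[OF H(1), of U "int u" "int q'" "int \<epsilon>"]) (use card H q cop2 K in \<open>auto simp: that\<close>)
  have "\<epsilon> \<ge> 1" using K K_eq n_pos m_ge by (cases \<epsilon>) auto
  then have "int U * M' = int (U * M)" using y(1) unfolding M by (simp add: of_nat_diff)
  then have M': "M' = int M" using U0 by simp
  have "int q' * int lo < int q' * (y + 1)"
    using y(2) lo unfolding tau_eq by (simp add: algebra_simps flip: of_nat_mult of_nat_add)
  then have ylo: "int lo \<le> y" using q'0 by (simp add: mult_less_cancel_left)
  have "(y - int lo) * (int u + 2 * int k + 1 - y - int lo) \<le> 0"
  proof (cases "y = int lo")
    case False
    then show ?thesis using ylo k by (intro mult_nonneg_nonpos) auto
  qed simp
  then show False using y(4)[of "int k"] neg unfolding M' by (simp add: algebra_simps)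
qed

lemma hall_excludes_square:
  fixes u q' \<epsilon> lo k :: nat
  assumes vq: "v = q * q" and q: "q = int u * int q'" and cop: "coprime q' u" and K: "K = q * int \<epsilon>"
    and lo: "q' * lo < n * m + q'" and k: "u + 2 * k \<le> 2 * lo"
    and neg: "int u * int lo - int lo * int lo + int \<epsilon> * (int \<epsilon> - 1) - (2 * int k + 1) * (int u * int \<epsilon> - int lo)
        + int k * (int k + 1) * (int u * int u - 1) < 0"
  shows False
proof (rule hall_excludes[where h = "q' * q'" and U = "u * u" and M = "\<epsilon> * (\<epsilon> - 1)", OF _ _ q _ K _ lo k])
  have "int (card (carrier G)) = int (q' * q' * (u * u))" using vq q by (simp add: mult_ac)
  then show "card (carrier G) = q' * q' * (u * u)" by (simp only: of_nat_eq_iff)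
  have "\<epsilon> \<ge> 1" using K K_eq n_pos m_ge by (cases \<epsilon>) auto
  then show "int u * int lo - int lo * int lo + int (\<epsilon> * (\<epsilon> - 1)) - (2 * int k + 1) * (int u * int \<epsilon> - int lo)
        + int k * (int k + 1) * (int (u * u) - 1) < 0"
    using neg by (simp add: of_nat_diff)
qed (use cop in auto)

text \<open>Here $q = (\alpha-1)(\alpha+1)^2$ and $v = q^2$. The coprime splitting of q that works depends on the common
  factors of $\alpha - 1$ and $\alpha + 1$: for even $\alpha$ these two are coprime; for $\alpha = 3$ modulo 4 the
  factor 2 of $\alpha-1$ is moved to the other side; for $\alpha = 4k+1$ the factor 4 of $(\alpha+1)^2$ is moved to
  $\alpha - 1$. In the last case the quadratic is negative for the parameter k itself, just barely: its value is
  $-49k(k-1) - 12$.\<close>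
lemma family_alpha_le_3:
  assumes n: "n + 1 = \<alpha>" and m: "m = \<alpha> * (\<alpha> + 1)"
  shows "\<alpha> \<le> 3"
proof (rule ccontr)
  assume "\<not> \<alpha> \<le> 3"
  then have a4: "\<alpha> \<ge> 4" by simp
  have ni: "int n = int \<alpha> - 1" using n by simp
  have qf: "q = (int \<alpha> - 1) * ((int \<alpha> + 1) * (int \<alpha> + 1))"
    using q_eq unfolding ni m by (simp add: algebra_simps)
  have Kf: "K = q * int (\<alpha> * \<alpha>)"
    unfolding K_eq ni m qf by (simp add: algebra_simps)
  obtain e w :: int where K_e: "K = q * e" and v_w: "v = q * w" and alpha_w: "int \<alpha> * w = int m * (e - 1)"
    by (rule quotients)
  have "q * e = q * int (\<alpha> * \<alpha>)" using Kf K_e by (rule trans[OF sym, rotated])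
  then have ef: "e = int (\<alpha> * \<alpha>)" using q_pos by simp
  have "int \<alpha> * w = int \<alpha> * q"
    using alpha_w unfolding ef m qf by (simp add: algebra_simps)
  then have "w = q" using a4 by simp
  then have vq: "v = q * q" using v_w by simp
  have "even \<alpha> \<or> \<alpha> mod 4 = 1 \<or> \<alpha> mod 4 = 3" by presburger
  then consider (even) "even \<alpha>" | (one) "\<alpha> mod 4 = 1" | (three) "\<alpha> mod 4 = 3" by blast
  then show False
  proof cases
    case even
    show False
    proof (rule hall_excludes_square[OF vq _ _ Kf, where u = "(\<alpha> + 1) * (\<alpha> + 1)" and q' = "\<alpha> - 1" and lo = "\<alpha> * (\<alpha> + 1)" and k = 0])
      show "q = int ((\<alpha> + 1) * (\<alpha> + 1)) * int (\<alpha> - 1)" unfolding qf using a4 by (simp add: of_nat_diff algebra_simps)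
      have "coprime (\<alpha> - 1) (\<alpha> + 1)"
      proof (rule coprimeI)
        fix c assume c: "c dvd \<alpha> - 1" "c dvd \<alpha> + 1"
        then have "c dvd (\<alpha> + 1) - (\<alpha> - 1)" by (rule dvd_diff_nat[rotated])
        then have "c dvd 2" using a4 by simp
        moreover have "c \<noteq> 2" using c(2) even by auto
        ultimately show "is_unit c" by (metis dvd_1_iff_1 prime_nat_iff two_is_prime_nat nat_dvd_1_iff_1)
      qed
      then show "coprime (\<alpha> - 1) ((\<alpha> + 1) * (\<alpha> + 1))"
        by (simp only: coprime_mult_right_iff simp_thms)
      show "(\<alpha> - 1) * (\<alpha> * (\<alpha> + 1)) < n * m + (\<alpha> - 1)"
      proof -
        have "n = \<alpha> - 1" using n by simp
        then show ?thesis using a4 by (simp add: m)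
      qed
      show "(\<alpha> + 1) * (\<alpha> + 1) + 2 * 0 \<le> 2 * (\<alpha> * (\<alpha> + 1))" using a4 by (simp add: algebra_simps)
      have "0 < int \<alpha> * (int \<alpha> + 1) * (int \<alpha> - 2)" using a4 by simp
      then show "int ((\<alpha> + 1) * (\<alpha> + 1)) * int (\<alpha> * (\<alpha> + 1)) - int (\<alpha> * (\<alpha> + 1)) * int (\<alpha> * (\<alpha> + 1)) +
        int (\<alpha> * \<alpha>) * (int (\<alpha> * \<alpha>) - 1) - (2 * int 0 + 1) * (int ((\<alpha> + 1) * (\<alpha> + 1)) * int (\<alpha> * \<alpha>) - int (\<alpha> * (\<alpha> + 1))) +
        int 0 * (int 0 + 1) * (int ((\<alpha> + 1) * (\<alpha> + 1)) * int ((\<alpha> + 1) * (\<alpha> + 1)) - 1) < 0"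
        by (simp add: algebra_simps)
    qed
  next
    case three
    then obtain i where i: "\<alpha> = 4 * i + 3" by (metis mod_eqE mult.commute mod_mult_div_eq add.commute)
    have i1: "i \<ge> 1" using a4 i by (cases i) auto
    show False
    proof (rule hall_excludes_square[OF vq _ _ Kf, where u = "2 * ((\<alpha> + 1) * (\<alpha> + 1))" and q' = "2 * i + 1" and lo = "2 * (\<alpha> * (\<alpha> + 1))" and k = 0])
      show "q = int (2 * ((\<alpha> + 1) * (\<alpha> + 1))) * int (2 * i + 1)" using qf i by (simp add: algebra_simps)
      have "coprime (2 * i + 1) (2 * i + 1 + 1)" by simp
      moreover have "coprime (2 * i + 1) 2" by simp
      moreover have "\<alpha> + 1 = 2 * (2 * i + 1 + 1)" using i by simp
      ultimately show "coprime (2 * i + 1) (2 * ((\<alpha> + 1) * (\<alpha> + 1)))" by (simp only: coprime_mult_right_iff simp_thms)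
      have "n = 2 * (2 * i + 1)" using n i by simp
      then show "(2 * i + 1) * (2 * (\<alpha> * (\<alpha> + 1))) < n * m + (2 * i + 1)"
        using m by (simp add: algebra_simps)
      show "2 * ((\<alpha> + 1) * (\<alpha> + 1)) + 2 * 0 \<le> 2 * (2 * (\<alpha> * (\<alpha> + 1)))" using a4 by (simp add: algebra_simps)
      have "0 < int \<alpha> * (int \<alpha> + 1) * ((int \<alpha> - 3) * (int \<alpha> + 2))" using a4 by simp
      then show "int (2 * ((\<alpha> + 1) * (\<alpha> + 1))) * int (2 * (\<alpha> * (\<alpha> + 1))) - int (2 * (\<alpha> * (\<alpha> + 1))) * int (2 * (\<alpha> * (\<alpha> + 1))) +
        int (\<alpha> * \<alpha>) * (int (\<alpha> * \<alpha>) - 1) - (2 * int 0 + 1) * (int (2 * ((\<alpha> + 1) * (\<alpha> + 1))) * int (\<alpha> * \<alpha>) - int (2 * (\<alpha> * (\<alpha> + 1)))) +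
        int 0 * (int 0 + 1) * (int (2 * ((\<alpha> + 1) * (\<alpha> + 1))) * int (2 * ((\<alpha> + 1) * (\<alpha> + 1))) - 1) < 0"
        by (simp add: algebra_simps)
    qed
  next
    case one
    then obtain k where k: "\<alpha> = 4 * k + 1" by (metis mult.commute mod_mult_div_eq add.commute)
    have k1: "k \<ge> 1" using a4 k by (cases k) auto
    show False
    proof (rule hall_excludes_square[OF vq _ _ Kf, where u = "16 * k" and q' = "(2 * k + 1) * (2 * k + 1)" and lo = "16 * k - 3" and k = k])
      show "q = int (16 * k) * int ((2 * k + 1) * (2 * k + 1))" using qf k by (simp add: algebra_simps)
      have "coprime (2 * k + 1) (2 * k)"
        using coprime_Suc_left_nat[of "2 * k"] by (simp only: Suc_eq_plus1)
      then have "coprime (2 * k + 1) k" "coprime (2 * k + 1) 2" 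
        using coprime_mult_right_iff[of "2 * k + 1" 2 k] by blast+
      then have "coprime (2 * k + 1) (2 ^ 4 * k)"
        by (simp only: coprime_mult_right_iff coprime_power_right_iff simp_thms)
      moreover have "16 * k = 2 ^ 4 * k" by simp
      ultimately show "coprime ((2 * k + 1) * (2 * k + 1)) (16 * k)"
        by (simp only: coprime_mult_left_iff simp_thms)
      have nk: "n = 4 * k" using n k by simp
      have "int ((2 * k + 1) * (2 * k + 1)) * (16 * int k - 3) < int n * int m + int ((2 * k + 1) * (2 * k + 1))"
        unfolding nk m k using k1 by (simp add: algebra_simps)
      moreover have "int (16 * k - 3) = 16 * int k - 3" using k1 by (simp add: of_nat_diff)
      ultimately have "int ((2 * k + 1) * (2 * k + 1) * (16 * k - 3)) < int (n * m + (2 * k + 1) * (2 * k + 1))"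
        by (simp only: of_nat_mult of_nat_add)
      then show "(2 * k + 1) * (2 * k + 1) * (16 * k - 3) < n * m + (2 * k + 1) * (2 * k + 1)"
        by (simp only: of_nat_less_iff)
      show "16 * k + 2 * k \<le> 2 * (16 * k - 3)" using k1 by simp
      define z where "z = int k"
      have "z \<ge> 1" using k1 by (simp add: z_def)
      then have "1 * z \<le> z * z" by (intro mult_right_mono) auto
      moreover have "(16 * z) * (16 * z - 3) - (16 * z - 3) * (16 * z - 3) +
        (4 * z + 1) * (4 * z + 1) * ((4 * z + 1) * (4 * z + 1) - 1) -
        (2 * z + 1) * ((16 * z) * ((4 * z + 1) * (4 * z + 1)) - (16 * z - 3)) +
        z * (z + 1) * ((16 * z) * (16 * z) - 1) = 49 * z - 49 * (z * z) - 12"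
        by (simp add: algebra_simps)
      moreover have eqs: "int (16 * k) = 16 * z" "int (16 * k - 3) = 16 * z - 3"
          "int (\<alpha> * \<alpha>) = (4 * z + 1) * (4 * z + 1)" "int k = z"
        using k1 k by (simp_all add: of_nat_diff z_def algebra_simps)
      ultimately show "int (16 * k) * int (16 * k - 3) - int (16 * k - 3) * int (16 * k - 3) +
        int (\<alpha> * \<alpha>) * (int (\<alpha> * \<alpha>) - 1) - (2 * int k + 1) * (int (16 * k) * int (\<alpha> * \<alpha>) - int (16 * k - 3)) +
        int k * (int k + 1) * (int (16 * k) * int (16 * k) - 1) < 0"
        unfolding eqs by linarith
    qed
  qed
qed

lemma order_eqI:
  assumes "int \<alpha> * \<nu> = int m * (K - q)"
  shows "v = \<nu>"
proof -
  have "int \<alpha> * v = int \<alpha> * \<nu>" using assms alpha_order by simp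
  then show ?thesis using alpha_ge by simp
qed
end

lemma coprime_add_multiple: "coprime (x + k * y) y \<longleftrightarrow> coprime x (y::nat)"
  by (metis add.commute coprime_iff_gcd_eq_1 gcd.commute gcd_add_mult)

context rigid_pds begin

text \<open>Inversion fixes no element of a group of odd order besides the identity.\<close>
lemma sum_odd_subgroup_parity:
  fixes f :: "'a \<Rightarrow> int"
  assumes H: "subgroup H G" and odd: "odd (card H)" and f: "\<And>h. h \<in> H \<Longrightarrow> f (inv h) = f h"
  shows "[sum f H = f \<one>] (mod 2)"
proof -
  have HG: "h \<in> carrier G" if "h \<in> H" for h using sub_carrier[OF H that] .
  have "{h \<in> H. inv h = h} = {\<one>}"
  proof -
    have *: "h = \<one>" if h: "h \<in> H" "inv h = h" for h
    proof -
      have "h [^] card H = \<one>" by (rule subgroup_pow_card[OF H h(1)])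
      moreover have "h [^] (2::nat) = \<one>"
        using HG[OF h(1)] h(2) r_inv[of h] by (simp add: numeral_2_eq_2)
      moreover have "coprime (card H) 2" using odd by simp
      ultimately show ?thesis using pow_coprime_eq_one HG[OF h(1)] by blast
    qed
    show ?thesis
    proof (intro equalityI subsetI)
      fix x assume "x \<in> {h \<in> H. inv h = h}"
      then show "x \<in> {\<one>}" using *[of x] by blast
    next
      fix x assume "x \<in> {\<one>}"
      then show "x \<in> {h \<in> H. inv h = h}" using subgroup.one_closed[OF H] by simp
    qed
  qed
  moreover have "[sum f H = sum f {h \<in> H. inv h = h}] (mod int 2)"
  proof (rule sum_prime_action_cong)
    show "((\<lambda>h. inv h) ^^ 2) h = h" if "h \<in> H" for h using HG[OF that] by (simp add: numeral_2_eq_2)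
  qed (use finite_sub[OF H] f subgroup.m_inv_closed[OF H] in auto)
  ultimately show ?thesis by simp
qed

text \<open>Here $v = 5^4 \cdot 11^4$ and $q = 5^2 \cdot 11^2$. Let A and B be the subgroups of order $11^4$ and $5^4$. The power
  map with exponent \<open>j\<close> fixes A and inverts B, so the sum of E over a coset $aB$ with $a \in A$ has the parity
  of E(a). The inequality for B only allows the values 75 and 76 for y at the identity, and parity selects 76; then
  equality holds, so y is 9 or 10 off B, and parity gives $y = 10 - E$ on A. The total of y now determines the sum of
  E over A, namely $121 \cdot 70$, and this violates the inequality for A.\<close>
lemma not_1_1870_714: "(n, m, \<alpha>) \<noteq> (1, 1870, 714)"
proof
  assume "(n, m, \<alpha>) = (1, 1870, 714)"
  then have n: "n = 1" and m: "m = 1870" and \<alpha>: "\<alpha> = 714" by simp_all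
  have q: "q = 3025" using q_eq n m \<alpha> by simp
  have K: "K = q * 1156" using K_eq n m q by simp
  have tau: "\<tau> = 1870" using tau_eq n m by simp
  have "v = 9150625" by (rule order_eqI) (simp add: \<alpha> m K q)
  then have card: "card (carrier G) = 9150625" by simp
  have cop: "coprime (625::nat) 14641" by (simp add: coprime_iff_gcd_eq_1 gcd_non_0_nat)
  obtain A where A: "subgroup A G" "card A = 14641"
    using exists_hall_subgroup[OF fin, of 14641 625] card cop by (auto simp: coprime_commute)
  obtain B where B: "subgroup B G" "card B = 625"
    using exists_hall_subgroup[OF fin, of 625 14641] card cop by auto
  note AG = sub_carrier[OF A(1)] and BG = sub_carrier[OF B(1)]
  have AB: "A \<inter> B = {\<one>}" "sum f (carrier G) = (\<Sum>a\<in>A. \<Sum>b\<in>B. f (a \<otimes> b))" for f :: "'a \<Rightarrow> int"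
    using complementary_sum[OF fin A(1) B(1)] card A(2) B(2) cop by (auto simp: coprime_commute)
  \<comment> \<open>This number is 1 modulo $11^4$ and $-1$ modulo $5^4$.\<close>
  define j where "j = (8462499 :: nat)"
  have flip: "E (a \<otimes> inv b) = E (a \<otimes> b)" if ab: "a \<in> A" "b \<in> B" for a b
  proof -
    note c = AG[OF ab(1)] BG[OF ab(2)]
    have "a [^] j = a \<otimes> (a [^] (14641::nat)) [^] (578::nat)"
      using c by (simp add: j_def nat_pow_pow flip: nat_pow_Suc2)
    then have 1: "a [^] j = a" using subgroup_pow_card[OF A(1) ab(1)] A(2) c by simp
    have "b [^] j \<otimes> b = (b [^] (625::nat)) [^] (13540::nat)"
      using c by (simp add: j_def nat_pow_pow flip: nat_pow_Suc)
    then have "b [^] j \<otimes> b = \<one>" using subgroup_pow_card[OF B(1) ab(2)] B(2) by simp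
    then have 2: "b [^] j = inv b" using c by (simp add: inv_equality[symmetric])
    have "coprime (int j) v"
    proof -
      have "coprime j 9150625" by (simp add: j_def coprime_iff_gcd_eq_1 gcd_non_0_nat)
      then show ?thesis using card by (metis coprime_int_iff)
    qed
    moreover have "int p dvd v" if "int p dvd q" for p using that q_dvd_order by (rule dvd_trans)
    ultimately have "E ((a \<otimes> b) [^] j) = E (a \<otimes> b)"
      using c by (intro E_power_map) (auto simp: j_def)
    then show ?thesis using c 1 2 by (simp add: nat_pow_distrib)
  qed
  have par: "[coset_sum B a = E a] (mod 2)" if a: "a \<in> A" for a
    using sum_odd_subgroup_parity[OF B(1), of "\<lambda>b. E (a \<otimes> b)"] flip[OF a] AG[OF a] B(2) by (simp add: coset_sum_def)
  obtain y M where F: "\<And>g. g \<in> carrier G \<Longrightarrow> coset_sum B g = 25 * y g"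
    and yB: "\<And>h. h \<in> B \<Longrightarrow> y h = y \<one>"
    and S1: "(\<Sum>g\<in>carrier G. y g) = int (card B) * (121 * 1156)"
    and S2: "(\<Sum>g\<in>carrier G. y g * y g) = int (card B) * (121 * y \<one> + M)"
    and M: "int 14641 * M = 121 * 121 * (1156 * (1156 - 1))"
    and lo: "\<tau> \<le> 25 * y \<one>"
    by (rule hall_profile[OF B(1), of 14641 121 25 1156])
      (use card B(2) q K in \<open>auto simp: coprime_iff_gcd_eq_1 gcd_non_0_int that\<close>)
  have M: "M = 1335180" using M by simp
  have poly: "(\<Sum>g\<in>carrier G. (y g - 9) * (y g - 10)) = 625 * (121 * y \<one> - 4774)"
  proof -
    have "(\<Sum>g\<in>carrier G. (y g - 9) * (y g - 10)) = (\<Sum>g\<in>carrier G. y g * y g) - 19 * (\<Sum>g\<in>carrier G. y g) + v * 90"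
      by (simp add: algebra_simps sum.distrib sum_subtractf sum_distrib_left sum_distrib_right)
    then show ?thesis unfolding S1 S2 M B(2) card by simp
  qed
  have pos: "0 \<le> (z - 9) * (z - 10)" for z :: int
    by (cases "z \<le> 9") (simp_all add: mult_nonpos_nonpos)
  have split: "(\<Sum>g\<in>carrier G. (y g - 9) * (y g - 10))
    = (\<Sum>g\<in>carrier G - B. (y g - 9) * (y g - 10)) + 625 * ((y \<one> - 9) * (y \<one> - 10))"
    using sum.subset_diff[OF subgroup.subset[OF B(1)] fin, of "\<lambda>g. (y g - 9) * (y g - 10)"] B(2)
    by (simp add: yB)
  have rest: "0 \<le> (\<Sum>g\<in>carrier G - B. (y g - 9) * (y g - 10))" by (intro sum_nonneg pos)
  \<comment> \<open>The choice 9, 10 brackets the mean $1156/121$ of y.\<close>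
  have "(y \<one> - 64) * (y \<one> - 76) \<le> 0" using rest split poly by (simp add: algebra_simps)
  then have "y \<one> \<le> 76" using lo tau by (cases "y \<one> \<le> 76") (auto simp: mult_le_0_iff)
  moreover have "y \<one> \<ge> 75" using lo tau by simp
  moreover have "even (y \<one>)"
  proof -
    have "[25 * y \<one> = 1870] (mod 2)"
      using par[OF subgroup.one_closed[OF A(1)]] F[OF one_closed] E_one tau by simp
    then show ?thesis by (auto simp: cong_def)
  qed
  ultimately have y1: "y \<one> = 76" by presburger
  have ten: "y a = 10 - E a" if a: "a \<in> A - {\<one>}" for a
  proof -
    have aG: "a \<in> carrier G" "a \<notin> B" "a \<noteq> \<one>" using a AB(1) AG by auto
    have "(\<Sum>g\<in>carrier G - B. (y g - 9) * (y g - 10)) = 0" using split poly y1 by simp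
    then have "\<forall>g\<in>carrier G - B. (y g - 9) * (y g - 10) = 0"
      using fin by (subst (asm) sum_nonneg_eq_0_iff) (auto simp: pos)
    then have "y a = 9 \<or> y a = 10" using aG by auto
    moreover have "[25 * y a = E a] (mod 2)" using par[of a] a F[OF aG(1)] by simp
    moreover have "E a = 0 \<or> E a = 1" using E_01[OF aG(1,3)] by simp
    ultimately show ?thesis by (auto simp: cong_def)
  qed
  have "625 * (\<Sum>a\<in>A. y a) = 625 * (121 * 1156)"
  proof -
    have "y (a \<otimes> b) = y a" if "a \<in> A" "b \<in> B" for a b
      using coset_sum_shift[OF B(1) AG[OF that(1)] that(2)] F AG[OF that(1)] BG[OF that(2)] by simp
    then have "(\<Sum>g\<in>carrier G. y g) = (\<Sum>a\<in>A. \<Sum>b\<in>B. y a)"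
      unfolding AB(2) by (intro sum.cong refl) simp
    then show ?thesis using S1 B(2) by (simp add: sum_distrib_left)
  qed
  then have "(\<Sum>a\<in>A. y a) = 139876" by simp
  moreover have remA: "sum f A = f \<one> + sum f (A - {\<one>})" for f :: "'a \<Rightarrow> int"
    using sum.remove[OF finite_sub[OF A(1)] subgroup.one_closed[OF A(1)]] .
  moreover have "(\<Sum>a\<in>A - {\<one>}. y a) = 10 * 14640 - (\<Sum>a\<in>A - {\<one>}. E a)"
  proof -
    have "card (A - {\<one>}) = 14640" using A(2) subgroup.one_closed[OF A(1)] by simp
    then show ?thesis using ten by (simp add: sum_subtractf)
  qed
  ultimately have "(\<Sum>a\<in>A - {\<one>}. E a) = 6600" using y1 by (simp add: remA)
  then have "coset_sum A \<one> = 8470" using remA[of E] AG E_one tau by (simp add: coset_sum_def cong: sum.cong)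
  moreover obtain z N where z: "int 625 * N = 25 * 25 * (1156 * (1156 - 1))" "\<tau> \<le> 121 * z" "coset_sum A \<one> = 121 * z"
    "\<And>k. 0 \<le> 25 * z - z * z + N - (2 * k + 1) * (25 * 1156 - z) + k * (k + 1) * (int 625 - 1)"
    by (rule hall_inequality[OF A(1), of 625 25 121 1156])
      (use card A(2) q K in \<open>auto simp: coprime_iff_gcd_eq_1 gcd_non_0_int that\<close>)
  ultimately have "z = 70" "N = 1335180" by simp_all
  then show False using z(4)[of 46] by simp
qed

text \<open>All hypotheses are numerical: the order of the group is \<open>h * U\<close> and q is \<open>u * q'\<close>, where u collects
  the primes of U. In the applications below the splitting and the value of k are those for which the quadratic is
  negative.\<close>
lemma hall_excludes_parameters:
  fixes u q' \<epsilon> h U M lo k :: nat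
  assumes q: "(n + 1) * m = u * q' + \<alpha> + 1" and K: "n * m * m = u * q' * \<epsilon>"
    and v: "\<alpha> * (h * U) = m * (u * q' * (\<epsilon> - 1))" and cop: "coprime h U" "coprime q' U"
    and M: "U * M = u * u * (\<epsilon> * (\<epsilon> - 1))" and lo: "q' * lo < n * m + q'" and k: "u + 2 * k \<le> 2 * lo"
    and neg: "int u * int lo - int lo * int lo + int M - (2 * int k + 1) * (int u * int \<epsilon> - int lo)
        + int k * (int k + 1) * (int U - 1) < 0"
  shows False
proof -
  have "int ((n + 1) * m) = int (u * q' + \<alpha> + 1)" using q by (simp only:)
  then have q': "q = int u * int q'" using q_eq by (simp add: algebra_simps)
  have "int (n * m * m) = int (u * q' * \<epsilon>)" using K by (simp only:)
  then have K': "K = q * int \<epsilon>" by (simp add: K_eq q')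
  have "\<epsilon> \<ge> 1" using K n_pos m_ge by (cases \<epsilon>) auto
  then have K1: "K - q = int (u * q' * (\<epsilon> - 1))" unfolding K' q' by (simp add: of_nat_diff algebra_simps)
  have "int \<alpha> * int (h * U) = int m * (K - q)" unfolding K1 by (simp only: v flip: of_nat_mult)
  then have "v = int (h * U)" by (rule order_eqI)
  then have "card (carrier G) = h * U" by (simp only: of_nat_eq_iff)
  then show False by (rule hall_excludes[OF _ cop(1) q' cop(2) K' M lo k neg])
qed

lemma not_2_165_44: "(n, m, \<alpha>) \<noteq> (2, 165, 44)"
  by (rule notI, rule hall_excludes_parameters[of 225 2 121 4 50625 14520 165 0])
    (simp_all add: coprime_iff_gcd_eq_1 gcd_non_0_nat)

lemma not_3_456_95: "(n, m, \<alpha>) \<noteq> (3, 456, 95)"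
  by (rule notI, rule hall_excludes_parameters[of 64 27 361 729 4096 129960 51 5])
    (simp_all add: coprime_iff_gcd_eq_1 gcd_non_0_nat)

lemma not_34_1395_774: "(n, m, \<alpha>) \<noteq> (34, 1395, 774)"
  by (rule notI, rule hall_excludes_parameters[of 1922 25 1377 125 953312 7342164 1898 2])
    (simp_all add: coprime_iff_gcd_eq_1 gcd_non_0_nat)

lemma not_4_1015_174: "(n, m, \<alpha>) \<noteq> (4, 1015, 174)"
  by (rule notI, rule hall_excludes_parameters[of 1225 4 841 16 1500625 706440 1015 0])
    (simp_all add: coprime_iff_gcd_eq_1 gcd_non_0_nat)

lemma not_5_1968_287: "(n, m, \<alpha>) \<noteq> (5, 1968, 287)"
  by (rule notI, rule hall_excludes_parameters[of 256 45 1681 2025 65536 2824080 219 6])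
    (simp_all add: coprime_iff_gcd_eq_1 gcd_non_0_nat)

text \<open>Here the quadratic for k = 4 is negative for all y.\<close>
lemma not_2_374_153: "(n, m, \<alpha>) \<noteq> (2, 374, 153)"
proof
  assume "(n, m, \<alpha>) = (2, 374, 153)"
  then have n: "n = 2" and m: "m = 374" and \<alpha>: "\<alpha> = 153" by simp_all
  have q: "q = 968" using q_eq n m \<alpha> by simp
  have K: "K = q * int 289" using K_eq n m q by simp
  have "v = 681472" by (rule order_eqI) (simp add: \<alpha> m K q)
  then have card: "card (carrier G) = 1331 * 512" by simp
  obtain H where H: "subgroup H G" "card H = 1331"
    using exists_hall_subgroup[OF fin card] by (auto simp: coprime_iff_gcd_eq_1 gcd_non_0_nat)
  obtain y M where y: "int 512 * M = 8 * 8 * (289 * (289 - 1))"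
    "\<And>k. 0 \<le> 8 * y - y * y + M - (2 * k + 1) * (8 * 289 - y) + k * (k + 1) * (int 512 - 1)"
    by (rule hall_inequality[OF H(1), of 512 8 121 289])
      (use card H(2) q K in \<open>auto simp: coprime_iff_gcd_eq_1 gcd_non_0_int that\<close>)
  have "0 \<le> (y - 8) * (y - 9)" by (cases "y \<le> 8") (simp_all add: mult_nonpos_nonpos)
  then show False using y(1) y(2)[of 4] by (simp add: algebra_simps)
qed

lemma not_6_3465_440: "(n, m, \<alpha>) \<noteq> (6, 3465, 440)"
  by (rule notI, rule hall_excludes_parameters[of 243 98 3025 9604 59049 9147600 213 12])
    (simp_all add: coprime_iff_gcd_eq_1 gcd_non_0_nat)

lemma not_7_5680_639: "(n, m, \<alpha>) \<noteq> (7, 5680, 639)"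
  by (rule notI, rule hall_excludes_parameters[of 256 175 5041 30625 65536 25406640 228 19])
    (simp_all add: coprime_iff_gcd_eq_1 gcd_non_0_nat)

lemma not_8_8811_890: "(n, m, \<alpha>) \<noteq> (8, 8811, 890)"
  by (rule notI, rule hall_excludes_parameters[of 9801 8 7921 64 96059601 62734320 8811 0])
    (simp_all add: coprime_iff_gcd_eq_1 gcd_non_0_nat)

lemma not_3_1628_703: "(n, m, \<alpha>) \<noteq> (3, 1628, 703)"
  by (rule notI, rule hall_excludes_parameters[of 48 121 1369 1331 13824 312132 41 4])
    (simp_all add: coprime_iff_gcd_eq_1 gcd_non_0_nat)

lemma not_2_840_69: "(n, m, \<alpha>) \<noteq> (2, 840, 69)"
  by (rule notI, rule hall_excludes_parameters[of 25 98 576 5488 3125 66240 18 4])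
    (simp_all add: coprime_iff_gcd_eq_1 gcd_non_0_nat)

lemma not_3_880_319: "(n, m, \<alpha>) \<noteq> (3, 880, 319)"
  by (rule notI, rule hall_excludes_parameters[of 25 128 726 2048 3125 105270 21 5])
    (simp_all add: coprime_iff_gcd_eq_1 gcd_non_0_nat)

lemma not_3_945_104: "(n, m, \<alpha>) \<noteq> (3, 945, 104)"
  by (rule notI, rule hall_excludes_parameters[of 147 25 729 125 194481 58968 114 0])
    (simp_all add: coprime_iff_gcd_eq_1 gcd_non_0_nat)

lemma not_4_7920_395: "(n, m, \<alpha>) \<noteq> (4, 7920, 395)"
  by (rule notI, rule hall_excludes_parameters[of 81 484 6400 85184 59049 4550400 66 8])
    (simp_all add: coprime_iff_gcd_eq_1 gcd_non_0_nat)

text \<open>The case $\beta \gamma \delta = 1$, in which the filter on P is void, is the infinite family; all other cases are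
  within the range of the search.\<close>
theorem rigid_parameters:
  assumes "\<alpha> \<le> 1000"
  shows "(n, m, \<alpha>) \<in> {(1, 6, 2), (2, 12, 3), (1, 40, 15), (1, 273, 104), (2, 2296, 615)}"
proof -
  define q0 where "q0 = nat q"
  have q0: "int q0 = q" using q_pos by (simp add: q0_def)
  obtain e w :: int where K_e: "K = q * e" and v_w: "v = q * w" and alpha_w: "int \<alpha> * w = int m * (e - 1)"
    and e_gt_1: "e > 1" and w_pos: "w > 0" by (rule quotients)
  have "int ((n + 1) * m) = int (q0 + (\<alpha> + 1))" using q_eq q0 by (simp add: algebra_simps)
  then have eq1: "(n + 1) * m = q0 + (\<alpha> + 1)" by (simp only: of_nat_eq_iff)
  have "int q0 dvd int (n * m^2)" using q_dvd_total K_eq q0 by (simp add: power2_eq_square mult.assoc)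
  then have eq2: "q0 dvd n * m^2" by (simp only: int_dvd_int_iff)
  obtain \<beta> \<gamma> \<delta> a a' P Q where pos: "\<beta> > 0" "\<gamma> > 0" "\<delta> > 0" "a > 0" "a' > 0"
    and P: "P = \<beta> + a' * \<delta>" and Q: "Q = a * P + \<delta>" and n: "n = a * a'"
    and A: "\<alpha> + 1 = \<beta> * \<gamma> * Q" and m: "m = \<gamma> * P * Q"
    and q: "q0 = a' * \<gamma> * Q^2" and cop: "coprime \<beta> \<delta>" "coprime \<beta> a'"
    by (rule benson_parametrisation[OF eq1 eq2]) (use m_ge n_pos q_pos q0_def in auto)
  have P0: "P > 0" and Q0: "Q > 0" using pos by (simp_all add: P Q)
  have al: "int \<alpha> = int \<beta> * int \<gamma> * int Q - 1"
  proof -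
    have "int (\<alpha> + 1) = int (\<beta> * \<gamma> * Q)" using A by (simp only:)
    then show ?thesis by simp
  qed
  have "q * e = K" using K_e by simp
  also have "K = q * (int a * int \<gamma> * (int P * int P))"
    unfolding K_eq q0[symmetric] q n m by (simp add: power2_eq_square)
  finally have e: "e = int a * int \<gamma> * (int P * int P)" using q_pos by simp
  have w_eq: "(int \<beta> * int \<gamma> * int Q - 1) * w = int \<gamma> * int P * int Q * (int a * int \<gamma> * (int P * int P) - 1)"
    using alpha_w unfolding al e m by simp
  show ?thesis
  proof (cases "\<beta> * \<gamma> * \<delta> = 1")
    case True
    \<comment> \<open>This is the infinite family: the divisibility by \<open>\<alpha>\<close> leaves only \<open>a = 1\<close>.\<close>
    then have one: "\<beta> = 1" "\<gamma> = 1" "\<delta> = 1" by simp_all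
    have aP: "\<alpha> = a * P" using A by (simp add: one Q)
    have "int a * int P * w = int P * int Q * (int a * (int P * int P) - 1)"
      using alpha_w unfolding aP e m one by simp
    then have "int P * (int a * w) = int P * (int Q * (int a * (int P * int P) - 1))" by (simp add: algebra_simps)
    then have "int a * w = int Q * (int a * (int P * int P) - 1)" using P0 by simp
    then have "int a * w = int a * (int Q * (int P * int P) - int P * (int a * (int P * int P) - 1) + (int P * 0) + 
        int P * (int a * (int P * int P) - 1)) - int Q"
      by (simp add: algebra_simps)
    then have "int Q = int a * (int Q * (int P * int P) - w)" by (simp add: algebra_simps)
    then have "int a dvd int Q" by (metis dvd_triv_left)
    moreover have "int Q = int a * int P + 1" by (simp add: Q one)
    ultimately have "int a dvd 1" by (metis dvd_add_right_iff dvd_triv_left)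
    then have a1: "a = 1" by simp
    have nm: "n + 1 = \<alpha>" "m = \<alpha> * (\<alpha> + 1)" using aP by (simp_all add: n a1 P Q m one algebra_simps)
    then have "\<alpha> \<le> 3" by (rule family_alpha_le_3)
    then consider "\<alpha> = 2" | "\<alpha> = 3" using alpha_ge by linarith
    then show ?thesis
    proof cases
      case 1
      then have "n = 1" "m = 6" using nm by simp_all
      then show ?thesis using 1 by simp
    next
      case 2
      then have "n = 2" "m = 12" using nm by simp_all
      then show ?thesis using 2 by simp
    qed
  next
    case False
    have bound: "\<beta> * \<gamma> * Q \<le> 1001" using A assms by simp
    have PQ: "P < Q" using pos by (simp add: Q) (metis add_less_le_mono add.commute add_0 mult_le_mono1 One_nat_def Suc_leI mult_1)
    have gQ: "\<gamma> * Q \<le> 1001" using bound pos(1) by (metis mult.assoc mult_le_mono1 One_nat_def Suc_leI mult_1 le_trans)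
    have copPQ: "coprime P Q" "coprime P a'"
    proof -
      have "coprime P \<delta>" using cop(1) unfolding P by (simp only: coprime_add_multiple)
      then have "coprime (\<delta> + a * P) P" by (metis coprime_add_multiple coprime_commute)
      then show "coprime P Q" unfolding Q by (metis add.commute coprime_commute)
      show "coprime P a'" using cop(2) unfolding P mult.commute[of a'] by (simp only: coprime_add_multiple)
    qed
    define w0 where "w0 = nat w"
    have w0: "int w0 = w" "w0 > 0" using w_pos by (simp_all add: w0_def)
    have e0: "e = int (a * \<gamma> * (P * P))" using e by simp
    \<comment> \<open>A crude bound on w, which makes the fixed exponent 64 in the search sufficient.\<close>
    have "w0 < 2 ^ Suc 64"
    proof -
      have "a * P \<le> 1001" "\<gamma> * P \<le> 1001" "P \<le> 1001"
      proof -
        have "1 * Q \<le> \<gamma> * Q" using pos(2) by (intro mult_le_mono1) simp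
        then have "Q \<le> 1001" using gQ by linarith
        then show "a * P \<le> 1001" "P \<le> 1001" using PQ Q by linarith+
        have "\<gamma> * P \<le> \<gamma> * Q" using PQ by simp
        then show "\<gamma> * P \<le> 1001" using gQ by linarith
      qed
      then have "(a * P) * (\<gamma> * P) \<le> 1001 * 1001" by (intro mult_le_mono)
      then have "a * \<gamma> * (P * P) \<le> 1002001" by (simp add: mult_ac)
      then have "int (a * \<gamma> * (P * P)) \<le> int 1002001" by (simp only: of_nat_le_iff)
      then have e_le: "e \<le> 1002001" unfolding e0 by simp
      have "(\<gamma> * Q) * P \<le> 1001 * 1001" using gQ \<open>P \<le> 1001\<close> by (intro mult_le_mono)
      then have "m \<le> 1002001" unfolding m by (simp add: mult_ac)
      then have "int m \<le> 1002001" by linarith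
      then have "int m * (e - 1) \<le> 1002001 * 1002001" using e_gt_1 e_le by (intro mult_mono) auto
      moreover have "1 * w \<le> int \<alpha> * w" using w_pos alpha_ge by (intro mult_right_mono) auto
      ultimately have "w \<le> 1004006004001" using alpha_w by linarith
      then have "w0 \<le> 1004006004001" using w0(1) by linarith
      then show ?thesis by simp
    qed
    moreover have "p dvd q0" if "prime p" "p dvd w0" for p
    proof -
      have "int p dvd v" using that(2) v_w w0(1) by (metis dvd_mult int_dvd_int_iff)
      then show ?thesis using prime_dvd_q[OF that(1)] q0 by (metis int_dvd_int_iff)
    qed
    ultimately have rad: "w0 dvd q0 ^ 64"
      using w0(2) q0 q_pos by (intro dvd_power_of_radical) auto
    \<comment> \<open>P divides \<open>\<alpha> * w\<close>, and the primes of w divide q, whose factors a' and Q are coprime to P; modulo P,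
      \<open>\<alpha>\<close> is \<open>\<beta> * \<gamma> * \<delta> - 1\<close>.\<close>
    have "P dvd (\<beta> * \<gamma> * \<delta> - 1) * \<gamma> ^ 8"
    proof -
      have "\<alpha> * w0 dvd \<alpha> * q0 ^ 64" using rad by simp
      moreover have "int P dvd int (\<alpha> * w0)"
        using alpha_w w0(1) m by (metis dvd_mult2 dvd_triv_right mult.commute mult.left_commute of_nat_mult)
      then have "P dvd \<alpha> * w0" by (simp only: int_dvd_int_iff)
      ultimately have "P dvd \<alpha> * q0 ^ 64" by (rule dvd_trans[rotated])
      also have "\<alpha> * q0 ^ 64 = (\<alpha> * \<gamma> ^ 64) * (a' * Q^2) ^ 64" by (simp add: q power_mult_distrib)
      finally have 1: "P dvd \<alpha> * \<gamma> ^ 64"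
        using copPQ by (simp add: coprime_dvd_mult_left_iff)
      have b1: "\<beta> * \<gamma> * \<delta> \<ge> 1" using pos by (simp add: Suc_leI)
      have "\<alpha> + 1 = P * (a * \<beta> * \<gamma>) + \<beta> * \<gamma> * \<delta>" unfolding A Q by (simp add: algebra_simps)
      then have "\<alpha> = P * (a * \<beta> * \<gamma>) + (\<beta> * \<gamma> * \<delta> - 1)" using b1 by linarith
      then have "\<alpha> * \<gamma> ^ 64 = P * (a * \<beta> * \<gamma> * \<gamma> ^ 64) + (\<beta> * \<gamma> * \<delta> - 1) * \<gamma> ^ 64"
        by (simp add: algebra_simps)
      then have 2: "P dvd (\<beta> * \<gamma> * \<delta> - 1) * \<gamma> ^ 64" using 1 by (metis dvd_add_right_iff dvd_triv_left)
      show ?thesis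
      proof (cases "\<gamma> = 1")
        case True
        then show ?thesis using 2 by simp
      next
        case False
        then have "2 * Q \<le> \<gamma> * Q" using pos by (intro mult_le_mono1) simp
        then have "2 * Q \<le> 1001" using gQ by linarith
        then have P8: "P < 2 ^ Suc 8" using PQ by simp
        have "\<beta> * \<gamma> * \<delta> - 1 > 0" using b1 \<open>\<beta> * \<gamma> * \<delta> \<noteq> 1\<close> by linarith
        then show ?thesis by (rule dvd_mult_power_reduce[OF 2 P0 P8 _ pos(2)])
      qed
    qed
    then have dvd1: "int P dvd (int \<beta> * int \<gamma> * int \<delta> - 1) * int \<gamma> ^ 8"
    proof -
      assume "P dvd (\<beta> * \<gamma> * \<delta> - 1) * \<gamma> ^ 8"
      then have "int P dvd int ((\<beta> * \<gamma> * \<delta> - 1) * \<gamma> ^ 8)" by (simp only: int_dvd_int_iff)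
      moreover have "\<beta> * \<gamma> * \<delta> \<ge> 1" using pos by (simp add: Suc_leI)
      ultimately show ?thesis by (simp add: of_nat_diff)
    qed
    have "int w0 dvd int (q0 ^ 64)" using rad by (simp only: int_dvd_int_iff)
    then have rad': "w dvd (int a' * int \<gamma> * (int Q * int Q)) ^ 64"
      using w0(1) by (simp add: q power2_eq_square)
    have alg: "coprime (int \<alpha>) (int \<gamma> * int Q)"
    proof (rule coprimeI)
      fix c assume c: "c dvd int \<alpha>" "c dvd int \<gamma> * int Q"
      have "c dvd int \<beta> * (int \<gamma> * int Q) - int \<alpha>" by (rule dvd_diff[OF dvd_mult[OF c(2)] c(1)])
      then show "is_unit c" unfolding al by (simp add: mult.assoc)
    qed
    have "int \<alpha> dvd (int \<gamma> * int Q) * (int P * (int a * int \<gamma> * (int P * int P) - 1))"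
      using w_eq unfolding al[symmetric] by (metis (no_types, lifting) dvd_triv_left mult.assoc mult.commute mult.left_commute)
    then have dvd2: "int \<beta> * int \<gamma> * int Q - 1 dvd int P * (int a * int \<gamma> * (int P * int P) - 1)"
      using alg unfolding al[symmetric] by (simp add: coprime_dvd_mult_right_iff)
    have "int (\<beta> * \<gamma> * Q) \<le> 1001" using bound by linarith
    then have bound': "int \<beta> * int \<gamma> * int Q \<le> 1001" by simp
    have "int (\<beta> * \<gamma> * \<delta>) \<noteq> 1" using False by (metis of_nat_1_eq_iff)
    then have d': "int \<beta> * int \<gamma> * int \<delta> \<noteq> 1" by simp
    have A1: "int \<beta> * int \<gamma> * int Q > 1" using al alpha_ge by simp
    have PQ': "int P = int \<beta> + int a' * int \<delta>" "int Q = int a * int P + int \<delta>" by (simp_all add: P Q)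
    note cand = in_candidates[OF _ _ _ _ _ PQ' bound' d' dvd1 w_eq dvd2 rad' A1]
    have "(int \<beta>, int \<gamma>, int \<delta>, int a', int a) \<in> set (candidates (int \<gamma>))" "int \<gamma> \<le> 333"
      using cand pos by simp_all
    then have "(int \<beta>, int \<gamma>, int \<delta>, int a', int a) \<in>
       {(2, 1, 3, 1, 1), (3, 1, 4, 2, 1), (4, 1, 5, 3, 1), (5, 1, 2, 2, 17), (5, 1, 6, 4, 1), (5, 1, 8, 1, 1), (6, 1, 7, 5, 1), (7, 1, 5, 2, 1), (7, 1, 8, 6, 1), (8, 1, 9, 7, 1), (9, 1, 10, 8, 1), (11, 1, 15, 2, 1), (13, 1, 21, 1, 1), (16, 1, 7, 3, 1), (1, 2, 11, 1, 2), (2, 2, 19, 2, 2), (4, 2, 7, 1, 3), (1, 3, 8, 1, 3), (1, 4, 19, 1, 4)}"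
      using le_333_cases[of "int \<gamma>" "(int \<beta>, int \<gamma>, int \<delta>, int a', int a)"] pos(2)
      unfolding candidates_1_1 candidates_2_4 candidates_5_16 candidates_17_333 by auto
    then have "(\<beta>, \<gamma>, \<delta>, a', a) \<in>
       {(2, 1, 3, 1, 1), (3, 1, 4, 2, 1), (4, 1, 5, 3, 1), (5, 1, 2, 2, 17), (5, 1, 6, 4, 1), (5, 1, 8, 1, 1), (6, 1, 7, 5, 1), (7, 1, 5, 2, 1), (7, 1, 8, 6, 1), (8, 1, 9, 7, 1), (9, 1, 10, 8, 1), (11, 1, 15, 2, 1), (13, 1, 21, 1, 1), (16, 1, 7, 3, 1), (1, 2, 11, 1, 2), (2, 2, 19, 2, 2), (4, 2, 7, 1, 3), (1, 3, 8, 1, 3), (1, 4, 19, 1, 4)}"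
      by (simp only: insert_iff empty_iff prod.inject int_eq_iff_numeral of_nat_eq_1_iff simp_thms)
    moreover have "\<alpha> = \<beta> * \<gamma> * Q - 1" using A by simp
    ultimately have "(n, m, \<alpha>) \<in> {(1, 40, 15), (2, 165, 44), (3, 456, 95), (34, 1395, 774), (4, 1015, 174), (1, 273, 104), (5, 1968, 287), (2, 374, 153), (6, 3465, 440), (7, 5680, 639), (8, 8811, 890), (2, 2296, 615), (1, 1870, 714), (3, 1628, 703), (2, 840, 69), (3, 880, 319), (3, 945, 104), (4, 7920, 395)}"
      using cop(2) unfolding n m Q P insert_iff empty_iff prod.inject by (elim disjE conjE) simp_all
    then have "(n, m, \<alpha>) = (1, 40, 15) \<or> (n, m, \<alpha>) = (1, 273, 104) \<or> (n, m, \<alpha>) = (2, 2296, 615)"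
      by (simp only: insert_iff empty_iff simp_thms
        not_2_165_44 not_3_456_95 not_34_1395_774 not_4_1015_174 not_5_1968_287 not_2_374_153 not_6_3465_440 not_7_5680_639 not_8_8811_890
        not_3_1628_703 not_2_840_69 not_3_880_319 not_3_945_104 not_4_7920_395 not_1_1870_714)
    then show ?thesis by (elim disjE) simp_all
  qed
qed
end

section \<open>Collinearity in a partial geometry with a rigid Singer group\<close>

context partial_geometry begin

abbreviation join_count :: "'a \<Rightarrow> 'a \<Rightarrow> nat" where
  "join_count x y \<equiv> card {l \<in> lines S. x \<in> l \<and> y \<in> l}"

lemma finite_lines: "finite (lines S)"
proof (rule finite_subset)
  show "lines S \<subseteq> Pow (points S)" using line_subset by blast
qed (simp add: finite_points)

lemma finite_line: "l \<in> lines S \<Longrightarrow> finite l"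
  using line_subset finite_points finite_subset by blast

lemma join_count_refl: "x \<in> points S \<Longrightarrow> join_count x x = t + 1"
  using card_lines_through[of x] by simp

lemma join_count_le_1:
  assumes "x \<noteq> y"
  shows "join_count x y \<le> 1"
proof -
  have "l = m" if lm: "l \<in> lines S" "x \<in> l" "y \<in> l" "m \<in> lines S" "x \<in> m" "y \<in> m" for l m
  proof (rule ccontr)
    assume "l \<noteq> m"
    then have "card (l \<inter> m) \<le> 1" using card_inter lm by blast
    moreover have "card {x, y} \<le> card (l \<inter> m)"
      using lm finite_line by (intro card_mono) auto
    ultimately show False using assms by simp
  qed
  then show ?thesis using finite_lines by (subst card_le_Suc0_iff_eq[unfolded One_nat_def[symmetric]]) auto
qed

text \<open>Count the pairs of a point y of l and a line through x and y. Through x there pass \<open>\<alpha>\<close> lines meeting l, each in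
  one point, if x is not on l; otherwise l itself counts s + 1 times and each of the t other lines once.\<close>
lemma sum_join_count_line:
  assumes x: "x \<in> points S" and l: "l \<in> lines S"
  shows "(\<Sum>y\<in>l. join_count x y) = (if x \<in> l then s + t + 1 else \<alpha>)"
proof -
  let ?T = "{m \<in> lines S. x \<in> m}"
  have finT: "finite ?T" using finite_lines by simp
  have "(\<Sum>y\<in>l. join_count x y) = (\<Sum>y\<in>l. \<Sum>m\<in>?T. if y \<in> m then 1 else 0)"
  proof (rule sum.cong[OF refl])
    fix y
    have "{m \<in> ?T. y \<in> m} = {l \<in> lines S. x \<in> l \<and> y \<in> l}" by auto
    then show "join_count x y = (\<Sum>m\<in>?T. if y \<in> m then 1 else 0)"
      using finT by (simp add: sum.If_cases Int_def)
  qed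
  also have "\<dots> = (\<Sum>m\<in>?T. \<Sum>y\<in>l. if y \<in> m then 1 else 0)" by (rule sum.swap)
  also have "\<dots> = (\<Sum>m\<in>?T. card (m \<inter> l))"
    using finite_line[OF l] by (intro sum.cong refl) (simp add: sum.If_cases Int_def conj_commute)
  finally have eq: "(\<Sum>y\<in>l. join_count x y) = (\<Sum>m\<in>?T. card (m \<inter> l))" .
  show ?thesis
  proof (cases "x \<in> l")
    case True
    have "(\<Sum>m\<in>?T. card (m \<inter> l)) = card (l \<inter> l) + (\<Sum>m\<in>?T - {l}. card (m \<inter> l))"
      using finT True l by (intro sum.remove) auto
    also have "(\<Sum>m\<in>?T - {l}. card (m \<inter> l)) = (\<Sum>m\<in>?T - {l}. 1)"
    proof (rule sum.cong[OF refl])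
      fix m assume m: "m \<in> ?T - {l}"
      then have "card (m \<inter> l) \<le> 1" using card_inter l by blast
      moreover have "m \<inter> l \<noteq> {}" using m True by auto
      then have "card (m \<inter> l) \<noteq> 0" using finite_line[OF l] by (simp add: card_eq_0_iff)
      ultimately show "card (m \<inter> l) = 1" by linarith
    qed
    also have "\<dots> = t" using card_lines_through[OF x] True l finT by simp
    finally show ?thesis using eq True card_line[OF l] by simp
  next
    case False
    have "(\<Sum>m\<in>?T. card (m \<inter> l)) = (\<Sum>m\<in>?T. if m \<inter> l \<noteq> {} then 1 else 0)"
    proof (rule sum.cong[OF refl])
      fix m assume m: "m \<in> ?T"
      then have c1: "card (m \<inter> l) \<le> 1" using card_inter[of m l] l False by blast
      show "card (m \<inter> l) = (if m \<inter> l \<noteq> {} then 1 else 0)"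
      proof (cases "m \<inter> l = {}")
        case False
        then have "card (m \<inter> l) \<noteq> 0" using finite_line[OF l] by (simp add: card_eq_0_iff)
        then show ?thesis using c1 False by simp
      qed simp
    qed
    also have "\<dots> = card {m \<in> lines S. x \<in> m \<and> m \<inter> l \<noteq> {}}"
      using finT by (simp add: sum.If_cases Int_def)
    finally show ?thesis using eq False card_meeting[OF x l False] by simp
  qed
qed

lemma sum_over_lines_through:
  fixes f :: "'a \<Rightarrow> nat"
  shows "(\<Sum>y\<in>points S. f y * join_count y z) = (\<Sum>l\<in>{l \<in> lines S. z \<in> l}. sum f l)"
proof -
  let ?T = "{m \<in> lines S. z \<in> m}"
  have finT: "finite ?T" using finite_lines by simp
  have "(\<Sum>y\<in>points S. f y * join_count y z) = (\<Sum>y\<in>points S. \<Sum>m\<in>?T. if y \<in> m then f y else 0)"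
  proof (rule sum.cong[OF refl])
    fix y
    have "{m \<in> ?T. y \<in> m} = {l \<in> lines S. y \<in> l \<and> z \<in> l}" by auto
    then show "f y * join_count y z = (\<Sum>m\<in>?T. if y \<in> m then f y else 0)"
      using finT by (simp add: sum.If_cases Int_def)
  qed
  also have "\<dots> = (\<Sum>m\<in>?T. \<Sum>y\<in>points S. if y \<in> m then f y else 0)" by (rule sum.swap)
  also have "\<dots> = (\<Sum>l\<in>?T. sum f l)"
  proof (rule sum.cong[OF refl])
    fix m assume "m \<in> ?T"
    then have "points S \<inter> m = m" using line_subset by blast
    then show "(\<Sum>y\<in>points S. if y \<in> m then f y else 0) = sum f m"
      using finite_points by (simp add: sum.If_cases Int_def)
  qed
  finally show ?thesis .
qed

text \<open>The sum counts chains x, y, z; it is the sum, over the lines l through z, of the number of joins of x with points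
  of l, which is known.\<close>
lemma join_count_square:
  assumes x: "x \<in> points S" and z: "z \<in> points S"
  shows "(\<Sum>y\<in>points S. int (join_count x y) * int (join_count y z))
    = (int s + int t + 1 - int \<alpha>) * int (join_count x z) + int \<alpha> * (int t + 1)"
proof -
  let ?T = "{m \<in> lines S. z \<in> m}"
  have finT: "finite ?T" using finite_lines by simp
  have "(\<Sum>y\<in>points S. int (join_count x y) * int (join_count y z)) = int (\<Sum>l\<in>?T. \<Sum>y\<in>l. join_count x y)"
    by (simp flip: sum_over_lines_through)
  also have "\<dots> = (\<Sum>l\<in>?T. int \<alpha> + (if x \<in> l then int s + int t + 1 - int \<alpha> else 0))"
    unfolding of_nat_sum[of "\<lambda>l. \<Sum>y\<in>l. join_count x y"]
    by (intro sum.cong refl) (use sum_join_count_line[OF x] in simp)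
  also have "\<dots> = int (card ?T) * int \<alpha> + int (card {l \<in> ?T. x \<in> l}) * (int s + int t + 1 - int \<alpha>)"
    using finT by (simp add: sum.distrib sum.If_cases Int_def)
  also have "{l \<in> ?T. x \<in> l} = {l \<in> lines S. x \<in> l \<and> z \<in> l}" by auto
  finally show ?thesis using card_lines_through[OF z] by (simp add: algebra_simps)
qed

lemma join_count_total:
  assumes z: "z \<in> points S"
  shows "(\<Sum>y\<in>points S. join_count y z) = (s + 1) * (t + 1)"
  using sum_over_lines_through[of "\<lambda>_. 1" z] card_lines_through[OF z] card_line by simp

lemma count_flags: "card (lines S) * (s + 1) = card (points S) * (t + 1)"
proof -
  have "(\<Sum>l\<in>lines S. card l) = (\<Sum>l\<in>lines S. \<Sum>x\<in>points S. if x \<in> l then 1 else 0)"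
  proof (rule sum.cong[OF refl])
    fix l assume "l \<in> lines S"
    then have "points S \<inter> l = l" using line_subset by blast
    then show "card l = (\<Sum>x\<in>points S. if x \<in> l then 1 else 0)"
      using finite_points by (simp add: sum.If_cases Int_def)
  qed
  also have "\<dots> = (\<Sum>x\<in>points S. \<Sum>l\<in>lines S. if x \<in> l then 1 else 0)" by (rule sum.swap)
  also have "\<dots> = (\<Sum>x\<in>points S. t + 1)"
    using card_lines_through finite_lines by (intro sum.cong refl) (simp add: sum.If_cases Int_def)
  finally show ?thesis using card_line by simp
qed

end

locale rigid_singer = proper_partial_geometry S s t \<alpha> for S :: "'a geometry" and s t \<alpha> +
  fixes G :: "('a \<Rightarrow> 'a) set" and p :: 'a
  assumes singer: "abelian_singer_group S G" and rigid: "rigid_type S G"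
    and base: "p \<in> points S" and alpha_ge_2: "2 \<le> \<alpha>"
begin

definition \<Gamma> :: "('a \<Rightarrow> 'a) monoid" where "\<Gamma> = (aut_group S)\<lparr>carrier := G\<rparr>"

lemma carrier_\<Gamma> [simp]: "carrier \<Gamma> = G" by (simp add: \<Gamma>_def)

sublocale A: comm_group \<Gamma>
  using singer by (simp add: abelian_singer_group_def \<Gamma>_def)

lemma G_aut: "g \<in> G \<Longrightarrow> g \<in> Bij (points S) \<and> geometry_iso g S S"
  using singer subgroup.subset[of G "aut_group S"] by (auto simp: abelian_singer_group_def aut_group_def)

lemma G_bij: "g \<in> G \<Longrightarrow> bij_betw g (points S) (points S)"
  using G_aut by (auto simp: geometry_iso_def)

lemma G_point: "g \<in> G \<Longrightarrow> x \<in> points S \<Longrightarrow> g x \<in> points S"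
  using G_bij bij_betwE by blast

lemma G_line: "g \<in> G \<Longrightarrow> l \<in> lines S \<Longrightarrow> g ` l \<in> lines S"
  using G_aut by (auto simp: geometry_iso_def)

lemma mult_apply: "g \<in> G \<Longrightarrow> h \<in> G \<Longrightarrow> x \<in> points S \<Longrightarrow> (g \<otimes>\<^bsub>\<Gamma>\<^esub> h) x = g (h x)"
  using G_aut by (simp add: \<Gamma>_def aut_group_def BijGroup_def compose_def)

lemma one_apply: "x \<in> points S \<Longrightarrow> \<one>\<^bsub>\<Gamma>\<^esub> x = x"
  by (simp add: \<Gamma>_def aut_group_def BijGroup_def)

lemma inv_apply: "g \<in> G \<Longrightarrow> x \<in> points S \<Longrightarrow> (inv\<^bsub>\<Gamma>\<^esub> g) (g x) = x"
  using mult_apply[of "inv\<^bsub>\<Gamma>\<^esub> g" g x] one_apply[of x] A.inv_closed[of g] A.l_inv[of g] by simp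

lemma mult_image: "g \<in> G \<Longrightarrow> h \<in> G \<Longrightarrow> l \<in> lines S \<Longrightarrow> (g \<otimes>\<^bsub>\<Gamma>\<^esub> h) ` l = g ` (h ` l)"
  using line_subset[of l] by (force simp: mult_apply image_iff)

lemma one_image: "l \<in> lines S \<Longrightarrow> \<one>\<^bsub>\<Gamma>\<^esub> ` l = l"
  using line_subset[of l] one_apply by (force simp: image_iff)

lemma rigid_line:
  assumes "g \<in> G" "h \<in> G" "l \<in> lines S" "g ` l = h ` l"
  shows "g = h"
proof -
  have ih: "inv\<^bsub>\<Gamma>\<^esub> h \<in> G" using A.inv_closed assms(2) by simp
  have "(inv\<^bsub>\<Gamma>\<^esub> h \<otimes>\<^bsub>\<Gamma>\<^esub> g) ` l = (inv\<^bsub>\<Gamma>\<^esub> h) ` (g ` l)" using assms ih by (simp only: mult_image)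
  also have "\<dots> = (inv\<^bsub>\<Gamma>\<^esub> h \<otimes>\<^bsub>\<Gamma>\<^esub> h) ` l" unfolding assms(4) using assms ih by (simp only: mult_image)
  also have "\<dots> = l" using assms one_image A.l_inv[of h] by simp
  finally have "(inv\<^bsub>\<Gamma>\<^esub> h \<otimes>\<^bsub>\<Gamma>\<^esub> g) ` l = l" .
  moreover have "inv\<^bsub>\<Gamma>\<^esub> h \<otimes>\<^bsub>\<Gamma>\<^esub> g \<in> G" using A.m_closed[of "inv\<^bsub>\<Gamma>\<^esub> h" g] ih assms(1) by simp
  ultimately have "inv\<^bsub>\<Gamma>\<^esub> h \<otimes>\<^bsub>\<Gamma>\<^esub> g \<in> {g \<in> G. g ` l = l}" by simp
  then have "inv\<^bsub>\<Gamma>\<^esub> h \<otimes>\<^bsub>\<Gamma>\<^esub> g = \<one>\<^bsub>aut_group S\<^esub>"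
    using rigid assms(3) unfolding rigid_type_def by blast
  then have "inv\<^bsub>\<Gamma>\<^esub> h \<otimes>\<^bsub>\<Gamma>\<^esub> g = \<one>\<^bsub>\<Gamma>\<^esub>" by (simp add: \<Gamma>_def)
  then show ?thesis using assms(1,2) ih by (metis A.inv_equality A.inv_inv carrier_\<Gamma>)
qed

lemma orbit_bij: "bij_betw (\<lambda>g. g p) G (points S)"
proof (rule bij_betwI')
  have reg: "\<exists>!g. g \<in> G \<and> g x = y" if "x \<in> points S" "y \<in> points S" for x y
    using singer that by (simp add: abelian_singer_group_def)
  show "(g p = h p) = (g = h)" if "g \<in> G" "h \<in> G" for g h
    using reg[OF base G_point[OF that(1) base]] that by auto
  show "g p \<in> points S" if "g \<in> G" for g using G_point[OF that base] .
  show "\<exists>g\<in>G. y = g p" if "y \<in> points S" for y using reg[OF base that] by auto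
qed

lemma card_G: "card G = card (points S)"
  using orbit_bij by (rule bij_betw_same_card)

lemma finite_G: "finite G"
  using orbit_bij finite_points bij_betw_finite by blast

definition E :: "('a \<Rightarrow> 'a) \<Rightarrow> int" where "E g = int (join_count p (g p))"

lemma join_count_translate:
  assumes "g \<in> G" "x \<in> points S" "y \<in> points S"
  shows "join_count (g x) (g y) = join_count x y"
proof -
  have ig: "inv\<^bsub>\<Gamma>\<^esub> g \<in> G" using A.inv_closed assms(1) by simp
  have le: "join_count x y \<le> join_count (h x) (h y)" if h: "h \<in> G" and xy: "x \<in> points S" "y \<in> points S" for h x y
  proof (rule card_inj_on_le[where f = "\<lambda>l. h ` l"])
    show "inj_on (\<lambda>l. h ` l) {l \<in> lines S. x \<in> l \<and> y \<in> l}"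
      by (rule inj_on_subset[OF inj_on_image_Pow[OF bij_betw_imp_inj_on[OF G_bij[OF h]]]])
         (use line_subset in auto)
  qed (use G_line[OF h] finite_lines in auto)
  show ?thesis
    using le[OF assms] le[OF ig G_point[OF assms(1,2)] G_point[OF assms(1,3)]]
    by (simp add: inv_apply assms)
qed

lemma join_count_orbit:
  assumes "g \<in> G" "h \<in> G"
  shows "int (join_count (h p) (g p)) = E (inv\<^bsub>\<Gamma>\<^esub> h \<otimes>\<^bsub>\<Gamma>\<^esub> g)"
proof -
  have ih: "inv\<^bsub>\<Gamma>\<^esub> h \<in> G" using A.inv_closed assms(2) by simp
  have "join_count (h p) (g p) = join_count ((inv\<^bsub>\<Gamma>\<^esub> h) (h p)) ((inv\<^bsub>\<Gamma>\<^esub> h) (g p))"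
    using join_count_translate[OF ih] G_point assms base by simp
  then show ?thesis using assms ih base by (simp add: E_def inv_apply mult_apply)
qed

lemma E_iff_line:
  assumes g: "g \<in> G"
  shows "E g \<noteq> 0 \<longleftrightarrow> (\<exists>l\<in>lines S. p \<in> l \<and> g p \<in> l)"
  using finite_lines by (auto simp: E_def)

text \<open>Rigidity makes every orbit of G on the lines have as many members as G has elements.\<close>
lemma lines_multiple: "card (points S) dvd card (lines S)"
proof -
  define orb where "orb l = (\<lambda>g. g ` l) ` G" for l
  have one: "\<one>\<^bsub>\<Gamma>\<^esub> \<in> G" using A.one_closed by simp
  have un: "\<Union>(orb ` lines S) = lines S"
  proof
    show "\<Union>(orb ` lines S) \<subseteq> lines S" using G_line by (auto simp: orb_def)
    show "lines S \<subseteq> \<Union>(orb ` lines S)"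
    proof
      fix l assume l: "l \<in> lines S"
      then have "l \<in> orb l" unfolding orb_def using one one_image by (metis imageI)
      then show "l \<in> \<Union>(orb ` lines S)" using l by blast
    qed
  qed
  have card_orb: "card (orb l) = card (points S)" if "l \<in> lines S" for l
    unfolding orb_def card_G[symmetric] using rigid_line that by (intro card_image inj_onI) blast
  have orb_eq: "orb l \<subseteq> orb m" if lm: "l \<in> lines S" "m \<in> lines S" "g \<in> G" "h \<in> G" "g ` l = h ` m" for l m g h
  proof
    fix x assume "x \<in> orb l"
    then obtain k where k: "k \<in> G" "x = k ` l" by (auto simp: orb_def)
    have ig: "inv\<^bsub>\<Gamma>\<^esub> g \<in> G" using A.inv_closed lm(3) by simp
    have "l = (inv\<^bsub>\<Gamma>\<^esub> g \<otimes>\<^bsub>\<Gamma>\<^esub> g) ` l" using lm one_image A.l_inv[of g] by simp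
    also have "\<dots> = (inv\<^bsub>\<Gamma>\<^esub> g) ` (h ` m)" unfolding lm(5)[symmetric] using lm ig by (simp only: mult_image)
    also have "\<dots> = (inv\<^bsub>\<Gamma>\<^esub> g \<otimes>\<^bsub>\<Gamma>\<^esub> h) ` m" using lm ig by (simp only: mult_image)
    finally have l: "l = (inv\<^bsub>\<Gamma>\<^esub> g \<otimes>\<^bsub>\<Gamma>\<^esub> h) ` m" .
    have c: "inv\<^bsub>\<Gamma>\<^esub> g \<otimes>\<^bsub>\<Gamma>\<^esub> h \<in> G" using A.m_closed[of "inv\<^bsub>\<Gamma>\<^esub> g" h] ig lm(4) by simp
    have "x = (k \<otimes>\<^bsub>\<Gamma>\<^esub> (inv\<^bsub>\<Gamma>\<^esub> g \<otimes>\<^bsub>\<Gamma>\<^esub> h)) ` m"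
      using k c lm(2) l by (simp add: mult_image)
    moreover have "k \<otimes>\<^bsub>\<Gamma>\<^esub> (inv\<^bsub>\<Gamma>\<^esub> g \<otimes>\<^bsub>\<Gamma>\<^esub> h) \<in> G" using A.m_closed[of k] c k(1) by simp
    ultimately show "x \<in> orb m" unfolding orb_def by blast
  qed
  have "card (points S) dvd card (\<Union>(orb ` lines S))"
  proof (rule dvd_partition)
    show "finite (\<Union>(orb ` lines S))" using un finite_lines by simp
    show "\<forall>c\<in>orb ` lines S. card (points S) dvd card c" using card_orb by auto
    show "\<forall>c1\<in>orb ` lines S. \<forall>c2\<in>orb ` lines S. c1 \<noteq> c2 \<longrightarrow> c1 \<inter> c2 = {}"
    proof (intro ballI impI, rule ccontr)
      fix c1 c2 assume c: "c1 \<in> orb ` lines S" "c2 \<in> orb ` lines S" "c1 \<noteq> c2" "c1 \<inter> c2 \<noteq> {}"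
      then obtain l m where lm: "l \<in> lines S" "m \<in> lines S" "c1 = orb l" "c2 = orb m" by blast
      then obtain g h where gh: "g \<in> G" "h \<in> G" "g ` l = h ` m"
        using c(4) unfolding orb_def by fastforce
      show False
        using orb_eq[OF lm(1,2) gh] orb_eq[OF lm(2,1) gh(2,1) gh(3)[symmetric]] c(3) lm by blast
    qed
  qed
  then show ?thesis unfolding un .
qed

lemma obtain_orbits: obtains n where "card (lines S) = n * card (points S)" "t + 1 = n * (s + 1)"
proof -
  obtain n where n: "card (lines S) = card (points S) * n" using lines_multiple by blast
  have "card (points S) \<noteq> 0" using finite_points points_nonempty by simp
  moreover have "card (points S) * (n * (s + 1)) = card (points S) * (t + 1)"
    using count_flags n by (simp add: algebra_simps)
  ultimately have "t + 1 = n * (s + 1)" by (metis mult_cancel1)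
  then show thesis using that[of n] n by (simp add: mult.commute)
qed

text \<open>A point x off a line l through the base point is joined to only \<open>\<alpha>\<close> of the s + 1 points of l. A pair of
  noncollinear points is moved to the base point.\<close>
lemma noncollinear: "\<exists>g\<in>G. E g = 0"
proof -
  have st: "s > \<alpha>" "t > \<alpha>" using alpha_less by auto
  have "\<not> card {l \<in> lines S. p \<in> l} \<le> Suc 0" using card_lines_through[OF base] st by simp
  then obtain l m where lm: "l \<in> lines S" "p \<in> l" "m \<in> lines S" "p \<in> m" "l \<noteq> m"
    using card_le_Suc0_iff_eq[of "{l \<in> lines S. p \<in> l}"] finite_lines by auto
  have "\<not> m \<subseteq> l"
  proof
    assume "m \<subseteq> l"
    then have "l \<inter> m = m" by auto
    then show False using card_inter[OF lm(1,3,5)] card_line[OF lm(3)] st by simp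
  qed
  then obtain x where x: "x \<in> m" "x \<notin> l" by blast
  have xS: "x \<in> points S" using x(1) line_subset[OF lm(3)] by blast
  have "\<exists>y\<in>l. join_count x y = 0"
  proof (rule ccontr)
    assume nex: "\<not> ?thesis"
    have "1 \<le> join_count x y" if "y \<in> l" for y
    proof -
      have "join_count x y \<noteq> 0"
      proof
        assume "join_count x y = 0"
        then have "\<exists>y\<in>l. join_count x y = 0" using that by (rule bexI)
        then show False using nex by contradiction
      qed
      then show ?thesis by linarith
    qed
    then have "(\<Sum>y\<in>l. 1) \<le> (\<Sum>y\<in>l. join_count x y)" by (rule sum_mono)
    then show False using sum_join_count_line[OF xS lm(1)] x(2) card_line[OF lm(1)] st by simp
  qed
  then obtain y where y: "y \<in> l" "join_count x y = 0" by blast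
  have "y \<in> points S" using y(1) line_subset[OF lm(1)] by blast
  then obtain g h where gh: "g \<in> G" "h \<in> G" "x = h p" "y = g p"
    using orbit_bij xS unfolding bij_betw_def by blast
  then have "E (inv\<^bsub>\<Gamma>\<^esub> h \<otimes>\<^bsub>\<Gamma>\<^esub> g) = 0" using join_count_orbit[OF gh(1,2)] y(2) by simp
  moreover have "inv\<^bsub>\<Gamma>\<^esub> h \<otimes>\<^bsub>\<Gamma>\<^esub> g \<in> G" using A.m_closed[of "inv\<^bsub>\<Gamma>\<^esub> h" g] A.inv_closed[of h] gh by simp
  ultimately show ?thesis by blast
qed

lemma E_conv:
  assumes g: "g \<in> G"
  shows "(\<Sum>h\<in>G. E h * E (inv\<^bsub>\<Gamma>\<^esub> h \<otimes>\<^bsub>\<Gamma>\<^esub> g)) = (int s + int t + 1 - int \<alpha>) * E g + int \<alpha> * (int t + 1)"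
proof -
  have "(\<Sum>h\<in>G. E h * E (inv\<^bsub>\<Gamma>\<^esub> h \<otimes>\<^bsub>\<Gamma>\<^esub> g)) = (\<Sum>h\<in>G. int (join_count p (h p)) * int (join_count (h p) (g p)))"
    using join_count_orbit[OF g] by (intro sum.cong refl) (simp add: E_def)
  also have "\<dots> = (\<Sum>y\<in>points S. int (join_count p y) * int (join_count y (g p)))"
    by (rule sum.reindex_bij_betw[OF orbit_bij])
  finally show ?thesis using join_count_square[OF base G_point[OF g base]] by (simp add: E_def)
qed

lemma E_le_one:
  assumes "g \<in> G" "g \<noteq> \<one>\<^bsub>\<Gamma>\<^esub>"
  shows "E g \<in> {0, 1}"
proof -
  have one: "\<one>\<^bsub>\<Gamma>\<^esub> \<in> G" using A.one_closed by simp
  have "g p \<noteq> p"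
    using bij_betw_imp_inj_on[OF orbit_bij] assms one one_apply[OF base] by (metis inj_on_def)
  then have "join_count p (g p) \<le> 1" by (intro join_count_le_1) simp
  then show ?thesis by (auto simp: E_def le_Suc_eq)
qed

lemma rigid_pds_instance:
  assumes n: "t + 1 = n * (s + 1)"
  shows "rigid_pds \<Gamma> E (int s + int t + 1 - int \<alpha>) (int \<alpha> * (int t + 1)) (int ((s + 1) * (t + 1))) (int t + 1) n (s + 1) \<alpha>"
proof -
  have st: "s > \<alpha>" "t > \<alpha>" using alpha_less by auto
  have ti: "int t + 1 = int n * (int s + 1)"
  proof -
    have "int (t + 1) = int (n * (s + 1))" using n by (simp only:)
    then show ?thesis by (simp add: algebra_simps)
  qed
  show ?thesis
  proof (intro rigid_pds.intro pds_group.intro pds_group_axioms.intro rigid_pds_axioms.intro, unfold carrier_\<Gamma>)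
    show "comm_group \<Gamma>" by (rule A.comm_group_axioms)
    show "finite G" by (rule finite_G)
    show "(\<Sum>x\<in>G. E x * E (inv\<^bsub>\<Gamma>\<^esub> x \<otimes>\<^bsub>\<Gamma>\<^esub> g)) = (int s + int t + 1 - int \<alpha>) * E g + int \<alpha> * (int t + 1)"
      if "g \<in> G" for g by (rule E_conv[OF that])
    have comm: "join_count x y = join_count y x" for x y by (simp add: conj_commute)
    show "sum E G = int ((s + 1) * (t + 1))"
    proof -
      have "sum E G = (\<Sum>y\<in>points S. int (join_count p y))"
        unfolding E_def by (rule sum.reindex_bij_betw[OF orbit_bij])
      also have "\<dots> = int (\<Sum>y\<in>points S. join_count y p)" by (simp add: comm)
      finally show ?thesis using join_count_total[OF base] by simp
    qed
    show "E \<one>\<^bsub>\<Gamma>\<^esub> = int t + 1" using join_count_refl[OF base] by (simp add: E_def one_apply base)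
    show "E g \<in> {0, 1}" if "g \<in> G" "g \<noteq> \<one>\<^bsub>\<Gamma>\<^esub>" for g using E_le_one[OF that] .
    show "E (inv\<^bsub>\<Gamma>\<^esub> g) = E g" if "g \<in> G" for g
    proof -
      have one: "\<one>\<^bsub>\<Gamma>\<^esub> \<in> G" using A.one_closed by simp
      have "int (join_count (g p) (\<one>\<^bsub>\<Gamma>\<^esub> p)) = E (inv\<^bsub>\<Gamma>\<^esub> g \<otimes>\<^bsub>\<Gamma>\<^esub> \<one>\<^bsub>\<Gamma>\<^esub>)"
        by (rule join_count_orbit[OF one that])
      then show ?thesis using that A.inv_closed[of g] by (simp add: one_apply base E_def comm)
    qed
    show "0 < int s + int t + 1 - int \<alpha>" using st by simp
    show "0 < int \<alpha> * (int t + 1)" using alpha_pos by simp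
    show "0 < int t + 1" by simp
    show "\<exists>g\<in>G. E g = 0" by (rule noncollinear)
    show "int s + int t + 1 - int \<alpha> = (int n + 1) * int (s + 1) - (int \<alpha> + 1)" using ti by (simp add: algebra_simps)
    show "int \<alpha> * (int t + 1) = int \<alpha> * (int n * int (s + 1))" using ti by (simp add: algebra_simps)
    show "int ((s + 1) * (t + 1)) = int n * int (s + 1) * int (s + 1)" unfolding n by (simp add: algebra_simps)
    show "int t + 1 = int n * int (s + 1)" using ti by (simp add: algebra_simps)
    show "2 \<le> \<alpha>" by (rule alpha_ge_2)
    show "\<alpha> + 2 \<le> s + 1" using st by simp
    show "\<exists>g\<in>G. g \<noteq> \<one>\<^bsub>\<Gamma>\<^esub> \<and> E g = 1"
    proof -
      have "card {l \<in> lines S. p \<in> l} \<noteq> 0" using card_lines_through[OF base] by simp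
      then obtain l where l: "l \<in> lines S" "p \<in> l" by (auto simp: card_eq_0_iff)
      have "\<not> l \<subseteq> {p}"
      proof
        assume "l \<subseteq> {p}"
        then have "card l \<le> 1" using card_mono[of "{p}" l] by simp
        then show False using card_line[OF l(1)] st by simp
      qed
      then obtain y where y: "y \<in> l" "y \<noteq> p" by blast
      then obtain g where g: "g \<in> G" "y = g p"
        using orbit_bij line_subset[OF l(1)] unfolding bij_betw_def by blast
      have g1: "g \<noteq> \<one>\<^bsub>\<Gamma>\<^esub>" using y(2) g one_apply[OF base] by auto
      have "E g \<noteq> 0" using E_iff_line[OF g(1)] l y g by auto
      then show ?thesis using E_le_one[OF g(1) g1] g1 g(1) by auto
    qed
  qed
qed

end

section \<open>The case of 81 points: relations in the group\<close>

text \<open>In the geometry, B consists of the elements that move the base point along a fixed line through it.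
  The assumption \<open>sidon\<close> says that two translates of that line share at most one point, \<open>two_neighbours\<close> is
  \<open>\<alpha> = 2\<close>, and \<open>generated\<close> says that any two points are linked by a chain of two lines. Inverses are avoided by
  writing equations between ratios as equations between products.\<close>
locale hexad = comm_group G for G (structure) +
  fixes B :: "'a set"
  assumes B_sub: "B \<subseteq> carrier G" and card_B: "card B = 6"
    and sidon: "\<And>x y z w. x \<in> B \<Longrightarrow> y \<in> B \<Longrightarrow> z \<in> B \<Longrightarrow> w \<in> B \<Longrightarrow> x \<otimes> w = z \<otimes> y \<Longrightarrow> x \<noteq> y \<Longrightarrow> x = z"
    and two_neighbours: "\<And>z. z \<in> carrier G \<Longrightarrow> z \<notin> B \<Longrightarrow>
      card {p \<in> B. \<exists>u\<in>B. \<exists>w\<in>B. u \<noteq> w \<and> z \<otimes> w = p \<otimes> u} = 2"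
    and generated: "\<And>g. g \<in> carrier G \<Longrightarrow> \<exists>x\<in>B. \<exists>y\<in>B. \<exists>u\<in>B. \<exists>w\<in>B. g \<otimes> (y \<otimes> w) = x \<otimes> u"
    and one_in: "\<one> \<in> B"
begin

lemma B_carrier [simp]: "x \<in> B \<Longrightarrow> x \<in> carrier G"
  using B_sub by blast

text \<open>The points a and b are collinear: their ratio is a ratio of two elements of B.\<close>
definition coll :: "'a \<Rightarrow> 'a \<Rightarrow> bool" where
  "coll a b \<longleftrightarrow> (\<exists>u\<in>B. \<exists>w\<in>B. u \<noteq> w \<and> a \<otimes> w = b \<otimes> u)"

lemma collI: "u \<in> B \<Longrightarrow> w \<in> B \<Longrightarrow> u \<noteq> w \<Longrightarrow> a \<otimes> w = b \<otimes> u \<Longrightarrow> coll a b"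
  unfolding coll_def by blast

lemma coll_sym:
  assumes "coll a b" shows "coll b a"
proof -
  obtain u w where "u \<in> B" "w \<in> B" "u \<noteq> w" "a \<otimes> w = b \<otimes> u" using assms unfolding coll_def by blast
  then show ?thesis by (intro collI[of w u]) auto
qed

lemma coll_ratio:
  assumes c: "a \<in> carrier G" "b \<in> carrier G" "a' \<in> carrier G" "b' \<in> carrier G"
    and eq: "a \<otimes> b' = a' \<otimes> b" and coll: "coll a b"
  shows "coll a' b'"
proof -
  obtain u w where uw: "u \<in> B" "w \<in> B" "u \<noteq> w" "a \<otimes> w = b \<otimes> u" using coll unfolding coll_def by blast
  have uwc: "u \<in> carrier G" "w \<in> carrier G" using uw by auto
  have "(a' \<otimes> w) \<otimes> b = (a' \<otimes> b) \<otimes> w" using c uwc by (simp add: m_ac)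
  also have "\<dots> = (a \<otimes> w) \<otimes> b'" unfolding eq[symmetric] using c uwc by (simp add: m_ac)
  also have "\<dots> = (b' \<otimes> u) \<otimes> b" unfolding uw(4) using c uwc by (simp add: m_ac)
  finally have "a' \<otimes> w = b' \<otimes> u" using c uwc by simp
  then show ?thesis using uw by (intro collI)
qed

lemma two_coll: "z \<in> carrier G \<Longrightarrow> z \<notin> B \<Longrightarrow> card {p \<in> B. coll z p} = 2"
  using two_neighbours unfolding coll_def .

lemma finite_B: "finite B" using card_B by (simp add: card_ge_0_finite)

text \<open>The point \<open>z = x y / k\<close> is off the line B and collinear with x and y. If $x y$ were collinear with $k p$, then z
  would be collinear with a third point p of B.\<close>
lemma not_coll:
  assumes B: "x \<in> B" "y \<in> B" "k \<in> B" "p \<in> B" and ne: "x \<noteq> y" "x \<noteq> k" "y \<noteq> k" "p \<noteq> x" "p \<noteq> y"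
  shows "\<not> coll (x \<otimes> y) (k \<otimes> p)"
proof
  assume c: "coll (x \<otimes> y) (k \<otimes> p)"
  note cl = B_carrier[OF B(1)] B_carrier[OF B(2)] B_carrier[OF B(3)] B_carrier[OF B(4)]
  define z where "z = x \<otimes> y \<otimes> inv k"
  have z: "z \<in> carrier G" using cl by (simp add: z_def)
  have zk: "z \<otimes> k = x \<otimes> y" using cl by (simp add: z_def m_assoc)
  have zB: "z \<notin> B"
  proof
    assume "z \<in> B"
    have "x = z" by (rule sidon[OF B(1,3) \<open>z \<in> B\<close> B(2) _ ne(2)]) (simp add: zk)
    then have "x \<otimes> k = x \<otimes> y" using zk by simp
    then have "k = y" using cl by simp
    then show False using ne(3) by simp
  qed
  have cx: "coll z x" by (rule collI[OF B(2,3) ne(3) zk])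
  have "z \<otimes> k = y \<otimes> x" using zk cl by (simp add: m_comm)
  then have cy: "coll z y" by (rule collI[OF B(1,3) ne(2)])
  have "(x \<otimes> y) \<otimes> p = z \<otimes> (k \<otimes> p)" unfolding zk[symmetric] using cl z by (simp add: m_assoc)
  then have cp: "coll z p" using coll_ratio[OF _ _ _ _ _ c, of z p] cl z by simp
  have "card {x, y, p} \<le> card {p \<in> B. coll z p}"
    using cx cy cp B finite_B by (intro card_mono) auto
  then show False using two_coll[OF z zB] ne by simp
qed

text \<open>The point \<open>z = x x / k\<close> is collinear with x and with one more point p of B. By \<open>not_coll\<close> this can only be
  \<open>p = k\<close>, so $x x w = k k u$ for some u and w in B, and again by \<open>not_coll\<close> only u = k and w = x is possible.\<close>
lemma cube_eq:
  assumes B: "x \<in> B" "k \<in> B" and ne: "x \<noteq> k"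
  shows "x \<otimes> x \<otimes> x = k \<otimes> k \<otimes> k"
proof -
  note cl = B_carrier[OF B(1)] B_carrier[OF B(2)]
  define z where "z = x \<otimes> x \<otimes> inv k"
  have z: "z \<in> carrier G" using cl by (simp add: z_def)
  have zk: "z \<otimes> k = x \<otimes> x" using cl by (simp add: z_def m_assoc)
  have zB: "z \<notin> B"
  proof
    assume "z \<in> B"
    have "x = z" by (rule sidon[OF B \<open>z \<in> B\<close> B(1) _ ne]) (simp add: zk)
    then have "x \<otimes> k = x \<otimes> x" using zk by simp
    then show False using cl ne by simp
  qed
  have "\<not> {p \<in> B. coll z p} \<subseteq> {x}"
    using two_coll[OF z zB] card_mono[of "{x}" "{p \<in> B. coll z p}"] by auto
  then obtain p where p: "p \<in> B" "coll z p" "p \<noteq> x" by blast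
  note cp = B_carrier[OF p(1)]
  have "z \<otimes> (k \<otimes> p) = (x \<otimes> x) \<otimes> p" unfolding zk[symmetric] using cl z cp by (simp add: m_assoc)
  then have c: "coll (x \<otimes> x) (k \<otimes> p)" using coll_ratio[OF _ _ _ _ _ p(2), of "x \<otimes> x" "k \<otimes> p"] cl z cp by simp
  have "p = k"
  proof (rule ccontr)
    assume "p \<noteq> k"
    then show False using not_coll[OF B(2) p(1) B(1) B(1)] coll_sym[OF c] ne p(3) by auto
  qed
  with c obtain u w where uw: "u \<in> B" "w \<in> B" "u \<noteq> w" "(x \<otimes> x) \<otimes> w = (k \<otimes> k) \<otimes> u"
    unfolding coll_def by blast
  note cu = B_carrier[OF uw(1)] B_carrier[OF uw(2)]
  have uk: "u = k"
  proof (rule ccontr)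
    assume uk: "u \<noteq> k"
    show False
    proof (cases "w = k")
      case True
      have "(x \<otimes> x) \<otimes> k = (u \<otimes> k) \<otimes> k" using uw(4) True cl cu by (simp add: m_ac)
      then have xx: "x \<otimes> x = u \<otimes> k" using cl cu by simp
      have "x = u" by (rule sidon[OF B uw(1) B(1) xx ne])
      then show False using xx cl ne by simp
    next
      case wk: False
      show False
      proof (cases "u = x")
        case True
        have "(k \<otimes> k) \<otimes> x = (w \<otimes> x) \<otimes> x" using uw(4) True cl cu by (simp add: m_ac)
        then have "k \<otimes> k = w \<otimes> x" using cl cu by simp
        then have "k = w" using sidon[OF B(2) B(1) uw(2) B(2)] ne by auto
        then show False using wk by simp
      next
        case False
        have "(k \<otimes> u) \<otimes> k = (x \<otimes> x) \<otimes> w" using uw(4) cl cu by (simp add: m_ac)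
        then have "coll (k \<otimes> u) (x \<otimes> x)" using wk by (intro collI[OF uw(2) B(2)])
        then show False using not_coll[OF B(2) uw(1) B(1) B(1)] uk False ne by auto
      qed
    qed
  qed
  have "w = x"
  proof (rule ccontr)
    assume wx: "w \<noteq> x"
    have "(x \<otimes> w) \<otimes> x = (k \<otimes> k) \<otimes> k" using uw(4) uk cl cu by (simp add: m_ac)
    then have "coll (x \<otimes> w) (k \<otimes> k)" using ne by (intro collI[OF B(2) B(1)]) auto
    then show False using not_coll[OF B(1) uw(2) B(2) B(2)] wx uw(3) uk ne by auto
  qed
  then show ?thesis using uw(4) uk by simp
qed

lemma cube_B: "x \<in> B \<Longrightarrow> x \<otimes> x \<otimes> x = \<one>"
  using cube_eq[of x \<one>] one_in by (cases "x = \<one>") auto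

lemma cube_move:
  assumes "b \<in> B" "r \<in> carrier G" "t \<in> carrier G" "r \<otimes> (b \<otimes> b) = t"
  shows "r = t \<otimes> b"
proof -
  have b: "b \<in> carrier G" using assms by simp
  have "t \<otimes> b = r \<otimes> (b \<otimes> b \<otimes> b)" unfolding assms(4)[symmetric] using b assms(2) by (simp add: m_ac)
  then show ?thesis using cube_B[OF assms(1)] assms(2) by simp
qed

lemma no_four_one:
  assumes B: "a \<in> B" "b \<in> B" "c \<in> B" "d \<in> B" "e \<in> B"
    and ne: "a \<noteq> b" "a \<noteq> c" "b \<noteq> c" "d \<noteq> e"
  shows "a \<otimes> b \<otimes> c \<otimes> d \<noteq> e"
proof
  assume h: "a \<otimes> b \<otimes> c \<otimes> d = e"
  note cl = B[THEN B_carrier]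
  have "(a \<otimes> b) \<otimes> d = (c \<otimes> c) \<otimes> e"
  proof -
    have "(c \<otimes> c) \<otimes> e = (a \<otimes> b \<otimes> d) \<otimes> (c \<otimes> c \<otimes> c)"
      unfolding h[symmetric] using cl by (simp add: m_ac)
    then show ?thesis using cube_B[OF B(3)] cl by simp
  qed
  then have "coll (a \<otimes> b) (c \<otimes> c)" using ne(4) by (intro collI[OF B(5,4)]) auto
  then show False using not_coll[OF B(1,2,3,3)] ne by auto
qed

lemma no_three_three:
  assumes B: "a \<in> B" "b \<in> B" "c \<in> B" "d \<in> B" "e \<in> B" "f \<in> B"
    and ne: "a \<noteq> b" "a \<noteq> d" "b \<noteq> d" "e \<noteq> a" "e \<noteq> b" "c \<noteq> f"
  shows "a \<otimes> b \<otimes> c \<noteq> d \<otimes> e \<otimes> f"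
proof
  assume "a \<otimes> b \<otimes> c = d \<otimes> e \<otimes> f"
  then have "coll (a \<otimes> b) (d \<otimes> e)" using ne(6) by (intro collI[OF B(6,3)]) auto
  then show False using not_coll[OF B(1,2,4,5)] ne by auto
qed

lemma no_square_term:
  assumes B: "b \<in> B" "c \<in> B" "d \<in> B" "f \<in> B" and ne: "b \<noteq> c" "c \<noteq> f"
  shows "b \<otimes> c \<otimes> d \<otimes> b \<noteq> f"
proof
  assume h: "b \<otimes> c \<otimes> d \<otimes> b = f"
  note cl = B[THEN B_carrier]
  have "c \<otimes> d = f \<otimes> b" by (rule cube_move[OF B(1)]) (use cl h in \<open>simp_all add: m_ac\<close>)
  then have "c = f" using sidon[OF B(2,1,4,3)] ne(1) by auto
  then show False using ne(2) by simp
qed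

lemma no_line_zero_sum:
  assumes B: "b \<in> B" "c \<in> B" "d \<in> B" and ne: "b \<noteq> c"
  shows "b \<otimes> c \<otimes> d \<noteq> \<one>"
proof
  assume h: "b \<otimes> c \<otimes> d = \<one>"
  note cl = B[THEN B_carrier]
  have "c \<otimes> d = b \<otimes> b"
  proof -
    have "b \<otimes> b = (b \<otimes> b) \<otimes> (b \<otimes> c \<otimes> d)" using h cl by simp
    also have "\<dots> = (b \<otimes> b \<otimes> b) \<otimes> (c \<otimes> d)" using cl by (simp add: m_ac)
    finally show ?thesis using cube_B[OF B(1)] cl by simp
  qed
  then have "c = b" using sidon[OF B(2,1,1,3)] ne by auto
  then show False using ne by simp
qed

text \<open>Cancelling a leaves \<open>b c d w = f\<close>, which contradicts one of the preceding lemmas for each w.\<close>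
lemma first_four_excluded:
  assumes B: "B = {a, b, c, d, f, g}" and dist: "distinct [a, b, c, d, f, g]"
    and w: "w \<in> B" "w \<noteq> a"
  shows "a \<otimes> b \<otimes> c \<otimes> d \<otimes> w \<noteq> f \<otimes> a"
proof
  assume h: "a \<otimes> b \<otimes> c \<otimes> d \<otimes> w = f \<otimes> a"
  have m: "a \<in> B" "b \<in> B" "c \<in> B" "d \<in> B" "f \<in> B" "g \<in> B" using B by auto
  note cl = m[THEN B_carrier] B_carrier[OF w(1)]
  have "(b \<otimes> c \<otimes> d \<otimes> w) \<otimes> a = f \<otimes> a" using h cl by (simp add: m_ac)
  then have h: "b \<otimes> c \<otimes> d \<otimes> w = f" using cl by simp
  consider "w = b" | "w = c" | "w = d" | "w = f" | "w = g" using w B by auto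
  then show False
  proof cases
    case 1 then show False using no_square_term[OF m(2,3,4,5)] h dist by auto
  next
    case 2
    have "c \<otimes> b \<otimes> d \<otimes> c = f" using h 2 cl by (simp add: m_ac)
    then show False using no_square_term[OF m(3,2,4,5)] dist by auto
  next
    case 3
    have "d \<otimes> b \<otimes> c \<otimes> d = f" using h 3 cl by (simp add: m_ac)
    then show False using no_square_term[OF m(4,2,3,5)] dist by auto
  next
    case 4
    have "(b \<otimes> c \<otimes> d) \<otimes> f = \<one> \<otimes> f" using h 4 cl by simp
    then have "b \<otimes> c \<otimes> d = \<one>" using cl by (simp del: l_one)
    then show False using no_line_zero_sum[OF m(2,3,4)] dist by auto
  next
    case 5
    then show False using no_four_one[OF m(2,3,4,6,5)] h dist by auto
  qed
qed

text \<open>Here u and w range over B. The only solution that survives is u = f and w = g, for which the hypothesis is the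
  claim because f has cube 1.\<close>
lemma zero_sum_step:
  assumes B: "B = {a, b, c, d, f, g}" and dist: "distinct [a, b, c, d, f, g]"
    and uw: "u \<in> B" "w \<in> B" "u \<noteq> w" and h: "a \<otimes> b \<otimes> c \<otimes> d \<otimes> w = f \<otimes> u"
  shows "a \<otimes> b \<otimes> c \<otimes> d \<otimes> f \<otimes> g = \<one>"
proof -
  have m: "a \<in> B" "b \<in> B" "c \<in> B" "d \<in> B" "f \<in> B" "g \<in> B" using B by auto
  note cl = m[THEN B_carrier] B_carrier[OF uw(1)] B_carrier[OF uw(2)]
  consider "u = a" | "u = b" | "u = c" | "u = d" | "u = f" | "u = g" using uw B by auto
  then show ?thesis
  proof cases
    case 1 then show ?thesis using first_four_excluded[OF B dist uw(2)] h uw(3) by auto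
  next
    case 2
    have "b \<otimes> a \<otimes> c \<otimes> d \<otimes> w = f \<otimes> b" using h 2 cl by (simp add: m_ac)
    then show ?thesis using first_four_excluded[of b a c d f g w] B dist uw 2 by auto
  next
    case 3
    have "c \<otimes> a \<otimes> b \<otimes> d \<otimes> w = f \<otimes> c" using h 3 cl by (simp add: m_ac)
    then show ?thesis using first_four_excluded[of c a b d f g w] B dist uw 3 by auto
  next
    case 4
    have "d \<otimes> a \<otimes> b \<otimes> c \<otimes> w = f \<otimes> d" using h 4 cl by (simp add: m_ac)
    then show ?thesis using first_four_excluded[of d a b c f g w] B dist uw 4 by auto
  next
    case 5
    have all: "a \<otimes> b \<otimes> c \<otimes> d \<otimes> f \<otimes> w = \<one>"
    proof -
      have "a \<otimes> b \<otimes> c \<otimes> d \<otimes> f \<otimes> w = (a \<otimes> b \<otimes> c \<otimes> d \<otimes> w) \<otimes> f" using cl by (simp add: m_ac)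
      then show ?thesis unfolding h 5 using cube_B[OF m(5)] by simp
    qed
    have sq: "\<not> (p \<otimes> q \<otimes> r \<otimes> f \<otimes> (w \<otimes> w) = \<one>)"
      if "p \<in> B" "q \<in> B" "r \<in> B" "p \<noteq> q" "p \<noteq> r" "q \<noteq> r" "f \<noteq> w" for p q r
    proof
      assume "p \<otimes> q \<otimes> r \<otimes> f \<otimes> (w \<otimes> w) = \<one>"
      then have "p \<otimes> q \<otimes> r \<otimes> f = \<one> \<otimes> w"
        using that cl by (intro cube_move[OF uw(2)]) auto
      then show False using no_four_one[OF that(1,2,3) m(5) uw(2)] that cl by auto
    qed
    consider "w = a" | "w = b" | "w = c" | "w = d" | "w = g" using uw 5 B by auto
    then show ?thesis
    proof cases
      case 1
      have "b \<otimes> c \<otimes> d \<otimes> f \<otimes> (w \<otimes> w) = \<one>" using all 1 cl by (simp add: m_ac)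
      then show ?thesis using sq[OF m(2,3,4)] dist 1 by auto
    next
      case 2
      have "a \<otimes> c \<otimes> d \<otimes> f \<otimes> (w \<otimes> w) = \<one>" using all 2 cl by (simp add: m_ac)
      then show ?thesis using sq[OF m(1,3,4)] dist 2 by auto
    next
      case 3
      have "a \<otimes> b \<otimes> d \<otimes> f \<otimes> (w \<otimes> w) = \<one>" using all 3 cl by (simp add: m_ac)
      then show ?thesis using sq[OF m(1,2,4)] dist 3 by auto
    next
      case 4
      have "a \<otimes> b \<otimes> c \<otimes> f \<otimes> (w \<otimes> w) = \<one>" using all 4 cl by (simp add: m_ac)
      then show ?thesis using sq[OF m(1,2,3)] dist 4 by auto
    next
      case 5
      then show ?thesis using all by simp
    qed
  next
    case 6
    have sq: False if pqr: "p \<in> B" "q \<in> B" "r \<in> B" "p \<noteq> q" "{p, q, r} \<inter> {f, g, w} = {}"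
      and e: "p \<otimes> q \<otimes> r \<otimes> (w \<otimes> w) = f \<otimes> g" for p q r
    proof -
      have "p \<otimes> q \<otimes> r = f \<otimes> g \<otimes> w"
        using that cl by (intro cube_move[OF uw(2)]) auto
      then show False using no_three_three[OF pqr(1,2,3) m(5,6) uw(2)] pqr(4,5) by auto
    qed
    consider "w = a" | "w = b" | "w = c" | "w = d" | "w = f" using uw 6 B by auto
    then show ?thesis
    proof cases
      case 1
      have "b \<otimes> c \<otimes> d \<otimes> (w \<otimes> w) = f \<otimes> g" using h 1 6 cl by (simp add: m_ac)
      then show ?thesis using sq[OF m(2,3,4)] dist 1 by auto
    next
      case 2
      have "a \<otimes> c \<otimes> d \<otimes> (w \<otimes> w) = f \<otimes> g" using h 2 6 cl by (simp add: m_ac)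
      then show ?thesis using sq[OF m(1,3,4)] dist 2 by auto
    next
      case 3
      have "a \<otimes> b \<otimes> d \<otimes> (w \<otimes> w) = f \<otimes> g" using h 3 6 cl by (simp add: m_ac)
      then show ?thesis using sq[OF m(1,2,4)] dist 3 by auto
    next
      case 4
      have "a \<otimes> b \<otimes> c \<otimes> (w \<otimes> w) = f \<otimes> g" using h 4 6 cl by (simp add: m_ac)
      then show ?thesis using sq[OF m(1,2,3)] dist 4 by auto
    next
      case 5
      have "(a \<otimes> b \<otimes> c \<otimes> d) \<otimes> f = g \<otimes> f" using h 5 6 cl by (simp add: m_ac)
      then have "a \<otimes> b \<otimes> c \<otimes> d = g" using cl by simp
      then show ?thesis using no_four_one[OF m(1,2,3,4,6)] dist by auto
    qed
  qed
qed

text \<open>The point \<open>z = a b c / (d f)\<close> is off the line B. By \<open>not_coll\<close> it is not collinear with a, b or c, so it is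
  collinear with two of d, f, g, hence with d or f.\<close>
lemma zero_sum:
  assumes B: "B = {a, b, c, d, f, g}" and dist: "distinct [a, b, c, d, f, g]"
  shows "a \<otimes> b \<otimes> c \<otimes> d \<otimes> f \<otimes> g = \<one>"
proof -
  have m: "a \<in> B" "b \<in> B" "c \<in> B" "d \<in> B" "f \<in> B" "g \<in> B" using B by auto
  note cl = m[THEN B_carrier]
  define z where "z = a \<otimes> b \<otimes> c \<otimes> inv (d \<otimes> f)"
  have z: "z \<in> carrier G" using cl by (simp add: z_def)
  have zdf: "z \<otimes> (d \<otimes> f) = a \<otimes> b \<otimes> c" using cl by (simp add: z_def m_assoc)
  have zB: "z \<notin> B"
  proof
    assume zB: "z \<in> B"
    show False
    proof (cases "z = c")
      case True
      have "(a \<otimes> b) \<otimes> c = (d \<otimes> f) \<otimes> c" using zdf True cl by (simp add: m_ac)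
      then have "a \<otimes> b = d \<otimes> f" using cl by simp
      then have "a = d" using sidon[OF m(1,5,4,2)] dist by auto
      then show False using dist by simp
    next
      case False
      have "(a \<otimes> b) \<otimes> c = (d \<otimes> f) \<otimes> z" using zdf z cl by (simp add: m_ac)
      then have "coll (a \<otimes> b) (d \<otimes> f)" using False by (intro collI[OF zB m(3)])
      then show False using not_coll[OF m(1,2,4,5)] dist by auto
    qed
  qed
  have nc: "\<not> coll z r" if pqr: "p \<in> B" "q \<in> B" "r \<in> B" "z \<otimes> (d \<otimes> f) = p \<otimes> q \<otimes> r"
      "p \<noteq> q" "{p, q} \<inter> {d, f} = {}" for p q r
  proof
    assume "coll z r"
    moreover have "z \<otimes> (d \<otimes> f) = (p \<otimes> q) \<otimes> r" using pqr(4) .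
    ultimately have "coll (p \<otimes> q) (d \<otimes> f)"
      using coll_ratio[of z r "p \<otimes> q" "d \<otimes> f"] z cl pqr by simp
    then show False using not_coll[OF pqr(1,2) m(4,5)] pqr(5,6) by auto
  qed
  have "\<not> coll z c" using nc[OF m(1,2,3) zdf] dist by auto
  moreover have "\<not> coll z b" using nc[OF m(1,3,2)] zdf dist cl by (auto simp: m_ac)
  moreover have "\<not> coll z a" using nc[OF m(2,3,1)] zdf dist cl by (auto simp: m_ac)
  ultimately have sub: "{p \<in> B. coll z p} \<subseteq> {d, f, g}" using B by auto
  have "coll z d \<or> coll z f"
  proof (rule ccontr)
    assume "\<not> ?thesis"
    then have "{p \<in> B. coll z p} \<subseteq> {g}" using sub by auto
    then have "card {p \<in> B. coll z p} \<le> 1" using card_mono[of "{g}"] by fastforce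
    then show False using two_coll[OF z zB] by simp
  qed
  then show ?thesis
  proof
    assume "coll z d"
    then obtain u w where uw: "u \<in> B" "w \<in> B" "u \<noteq> w" "z \<otimes> w = d \<otimes> u" unfolding coll_def by blast
    note cu = B_carrier[OF uw(1)] B_carrier[OF uw(2)]
    have "a \<otimes> b \<otimes> c \<otimes> d \<otimes> w = (z \<otimes> w) \<otimes> (d \<otimes> f \<otimes> d)"
      unfolding zdf[symmetric] using cl cu z by (simp add: m_ac)
    also have "\<dots> = (d \<otimes> d \<otimes> d) \<otimes> (f \<otimes> u)" unfolding uw(4) using cl cu by (simp add: m_ac)
    finally have "a \<otimes> b \<otimes> c \<otimes> d \<otimes> w = f \<otimes> u" using cube_B[OF m(4)] cl cu by simp
    then show ?thesis by (rule zero_sum_step[OF B dist uw(1-3)])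
  next
    assume "coll z f"
    then obtain u w where uw: "u \<in> B" "w \<in> B" "u \<noteq> w" "z \<otimes> w = f \<otimes> u" unfolding coll_def by blast
    note cu = B_carrier[OF uw(1)] B_carrier[OF uw(2)]
    have "a \<otimes> b \<otimes> c \<otimes> f \<otimes> w = (z \<otimes> w) \<otimes> (d \<otimes> f \<otimes> f)"
      unfolding zdf[symmetric] using cl cu z by (simp add: m_ac)
    also have "\<dots> = (f \<otimes> f \<otimes> f) \<otimes> (d \<otimes> u)" unfolding uw(4) using cl cu by (simp add: m_ac)
    finally have "a \<otimes> b \<otimes> c \<otimes> f \<otimes> w = d \<otimes> u" using cube_B[OF m(5)] cl cu by simp
    then have "a \<otimes> b \<otimes> c \<otimes> f \<otimes> d \<otimes> g = \<one>"
      using zero_sum_step[of a b c f d g u w] B dist uw(1-3) by auto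
    then show ?thesis using cl by (simp add: m_ac)
  qed
qed

end

section \<open>The field of order 81\<close>

datatype F3 = Z3 | O3 | T3

instantiation F3 :: comm_ring_1 begin
definition "zero_F3 = Z3"
definition "one_F3 = O3"
fun plus_F3 where
  "plus_F3 Z3 y = y" | "plus_F3 x Z3 = x" | "plus_F3 O3 O3 = T3" | "plus_F3 O3 T3 = Z3"
| "plus_F3 T3 O3 = Z3" | "plus_F3 T3 T3 = O3"
fun uminus_F3 where "uminus_F3 Z3 = Z3" | "uminus_F3 O3 = T3" | "uminus_F3 T3 = O3"
definition "minus_F3 x y = x + - (y :: F3)"
fun times_F3 where
  "times_F3 Z3 y = Z3" | "times_F3 O3 y = y" | "times_F3 T3 y = - y"
instance
proof
  fix a b c :: F3
  show "a * b * c = a * (b * c)" by (cases a; cases b; cases c) simp_all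
  show "a * b = b * a" by (cases a; cases b) simp_all
  show "1 * a = a" by (simp add: one_F3_def)
  show "(a + b) * c = a * c + b * c" by (cases a; cases b; cases c) simp_all
  show "a + b + c = a + (b + c)" by (cases a; cases b; cases c) simp_all
  show "a + b = b + a" by (cases a; cases b) simp_all
  show "0 + a = a" by (simp add: zero_F3_def)
  show "- a + a = 0" by (cases a) (simp_all add: zero_F3_def)
  show "a - b = a + - b" by (simp add: minus_F3_def)
  show "(0::F3) \<noteq> 1" by (simp add: zero_F3_def one_F3_def)
qed
end

text \<open>Coordinates over the field of three elements with respect to $1, \gamma, \gamma^2, \gamma^3$, where
  $1 + \gamma + \gamma^2 + \gamma^3 + \gamma^4 = 0$.\<close>
type_synonym quad = "F3 \<times> F3 \<times> F3 \<times> F3"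

fun quad_add :: "quad \<Rightarrow> quad \<Rightarrow> quad" where
  "quad_add (a0, a1, a2, a3) (b0, b1, b2, b3) = (a0 + b0, a1 + b1, a2 + b2, a3 + b3)"

text \<open>Here \<open>r\<close> is the coefficient of $\gamma^4$ in the product; moreover $\gamma^5 = 1$ and $\gamma^6 = \gamma$.\<close>
fun quad_mult :: "quad \<Rightarrow> quad \<Rightarrow> quad" where
  "quad_mult (a0, a1, a2, a3) (b0, b1, b2, b3) =
    (let r = a1 * b3 + a2 * b2 + a3 * b1 in
      (a0 * b0 + a2 * b3 + a3 * b2 - r, a0 * b1 + a1 * b0 + a3 * b3 - r,
       a0 * b2 + a1 * b1 + a2 * b0 - r, a0 * b3 + a1 * b2 + a2 * b1 + a3 * b0 - r))"

text \<open>The cube map: $\gamma \mapsto \gamma^3$, $\gamma^2 \mapsto \gamma$, $\gamma^3 \mapsto \gamma^4$.\<close>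
fun frob :: "quad \<Rightarrow> quad" where
  "frob (a0, a1, a2, a3) = (a0 - a3, a2 - a3, - a3, a1 - a3)"

text \<open>The product of the three other conjugates of x, so that x times it is the norm of x to the prime field.\<close>
definition quad_cofactor :: "quad \<Rightarrow> quad" where
  "quad_cofactor x = quad_mult (frob x) (quad_mult (frob (frob x)) (frob (frob (frob x))))"

definition F81 :: "quad ring" where
  "F81 = \<lparr>carrier = UNIV, monoid.mult = quad_mult, one = (1, 0, 0, 0), zero = (0, 0, 0, 0), add = quad_add\<rparr>"

lemma quad_add_assoc: "quad_add (quad_add x y) z = quad_add x (quad_add y z)"
  by (cases x; cases y; cases z) (simp add: add.assoc)

lemma quad_add_comm: "quad_add x y = quad_add y x"
  by (cases x; cases y) (simp add: add.commute)

lemma quad_zero: "quad_add (0, 0, 0, 0) x = x"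
  by (cases x) simp

lemma quad_mult_assoc: "quad_mult (quad_mult x y) z = quad_mult x (quad_mult y z)"
  by (cases x; cases y; cases z) (simp add: Let_def algebra_simps)

lemma quad_mult_comm: "quad_mult x y = quad_mult y x"
  by (cases x; cases y) (simp add: Let_def algebra_simps)

lemma quad_distrib: "quad_mult (quad_add x y) z = quad_add (quad_mult x z) (quad_mult y z)"
  by (cases x; cases y; cases z) (simp add: Let_def algebra_simps)

lemma quad_one: "quad_mult (1, 0, 0, 0) x = x"
  by (cases x) (simp add: Let_def)

text \<open>A nonzero element has nonzero norm, hence an inverse; this is verified for the 81 elements one by one.\<close>
definition unit_norm :: "quad \<Rightarrow> bool" where
  "unit_norm x \<longleftrightarrow> x = (0, 0, 0, 0) \<or>
     (case quad_mult x (quad_cofactor x) of (a, b, c, d) \<Rightarrow> a \<noteq> 0 \<and> b = 0 \<and> c = 0 \<and> d = 0)"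

lemma unit_norm_all:
  "list_all (\<lambda>a. list_all (\<lambda>b. list_all (\<lambda>c. list_all (\<lambda>d. unit_norm (a, b, c, d))
     [Z3, O3, T3]) [Z3, O3, T3]) [Z3, O3, T3]) [Z3, O3, T3]"
  by code_simp

lemma UNIV_F3: "UNIV = {Z3, O3, T3}"
  using F3.exhaust by auto

lemma quad_norm: "unit_norm x"
proof (cases x)
  case (fields a b c d)
  have mem: "y \<in> set [Z3, O3, T3]" for y using UNIV_F3 by simp
  show ?thesis
    unfolding fields using unit_norm_all[unfolded list_all_iff] mem by blast
qed

lemma quad_inverse: "x \<noteq> (0, 0, 0, 0) \<Longrightarrow> \<exists>y. quad_mult x y = (1, 0, 0, 0)"
proof -
  assume "x \<noteq> (0, 0, 0, 0)"
  then consider "quad_mult x (quad_cofactor x) = (1, 0, 0, 0)"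
    | "quad_mult x (quad_cofactor x) = (- 1, 0, 0, 0)"
  proof -
    obtain a b c d where abcd: "quad_mult x (quad_cofactor x) = (a, b, c, d)" by (metis prod_cases4)
    then have "a \<noteq> 0" "b = 0" "c = 0" "d = 0"
      using quad_norm[of x] \<open>x \<noteq> (0, 0, 0, 0)\<close> unfolding unit_norm_def by auto
    moreover have "a = 1 \<or> a = - 1" using \<open>a \<noteq> 0\<close> by (cases a) (simp_all add: zero_F3_def one_F3_def)
    ultimately show thesis using that abcd by blast
  qed
  then show ?thesis
  proof cases
    case 2
    then have "quad_mult x (quad_mult (quad_cofactor x) (- 1, 0, 0, 0)) = (1, 0, 0, 0)"
      unfolding quad_mult_assoc[symmetric] by (simp add: Let_def)
    then show ?thesis by blast
  qed blast
qed

lemma card_quad: "card (UNIV :: quad set) = 81"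
proof -
  have "card (UNIV :: F3 set) = 3" unfolding UNIV_F3 by simp
  then show ?thesis by (simp add: card_cartesian_product flip: UNIV_Times_UNIV)
qed

lemma field_F81: "field F81"
proof -
  have abel: "abelian_group F81"
  proof (rule abelian_groupI)
    fix x assume "x \<in> carrier F81"
    show "\<exists>y\<in>carrier F81. y \<oplus>\<^bsub>F81\<^esub> x = \<zero>\<^bsub>F81\<^esub>"
      by (cases x) (auto simp: F81_def intro!: exI[of _ "- _"])
  qed (auto simp: F81_def quad_add_assoc quad_zero intro: quad_add_comm simp del: quad_add.simps)
  have mon: "comm_monoid F81"
    by (rule comm_monoidI) (auto simp: F81_def quad_mult_assoc quad_one intro: quad_mult_comm simp del: quad_mult.simps)
  interpret cring F81
    by (rule cringI[OF abel mon]) (auto simp: F81_def quad_distrib simp del: quad_mult.simps quad_add.simps)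
  show ?thesis
  proof (rule cring_fieldI2)
    show "\<zero>\<^bsub>F81\<^esub> \<noteq> \<one>\<^bsub>F81\<^esub>" by (simp add: F81_def)
    fix x assume "x \<in> carrier F81" "x \<noteq> \<zero>\<^bsub>F81\<^esub>"
    then show "\<exists>y\<in>carrier F81. x \<otimes>\<^bsub>F81\<^esub> y = \<one>\<^bsub>F81\<^esub>"
      using quad_inverse by (simp add: F81_def)
  qed
qed

section \<open>Recognition of the Van Lint--Schrijver geometry\<close>

instance F3 :: countable by countable_datatype

text \<open>Exponents for elements of cube 1.\<close>
fun F3_nat :: "F3 \<Rightarrow> nat" where "F3_nat Z3 = 0" | "F3_nat O3 = 1" | "F3_nat T3 = 2"

text \<open>Zero and the five powers of $\gamma$.\<close>
definition hexagon :: "quad set" where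
  "hexagon = {(0, 0, 0, 0), (1, 0, 0, 0), (0, 1, 0, 0), (0, 0, 1, 0), (0, 0, 0, 1), (- 1, - 1, - 1, - 1)}"

lemma (in hexad) pow_F3_add:
  assumes "b \<in> B"
  shows "b [^] F3_nat (x + y) = b [^] F3_nat x \<otimes> b [^] F3_nat y"
  using cube_B[OF assms] assms
  by (cases x; cases y) (simp_all add: numeral_2_eq_2 m_assoc)

text \<open>Four of the nonidentity elements of B serve as the images of $1, \gamma, \gamma^2, \gamma^3$. The fifth is the
  inverse of their product, as $\gamma^4$ is the negative of the sum of the lower powers. The homomorphism is onto
  because every element is a ratio of products of elements of B, and it is injective by counting.\<close>
lemma (in hexad) hexad_coordinates:
  assumes card: "card (carrier G) = 81"
  obtains \<psi> :: "quad \<Rightarrow> 'a" where "bij_betw \<psi> UNIV (carrier G)"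
    "\<And>x y. \<psi> (quad_add x y) = \<psi> x \<otimes> \<psi> y" "\<psi> ` hexagon = B"
proof -
  have "card (B - {\<one>}) = 5" using card_B one_in finite_B by simp
  then obtain xs where xs: "B - {\<one>} = set xs" "distinct xs" "length xs = 5"
    using finite_distinct_list[of "B - {\<one>}"] finite_B distinct_card by (metis finite_Diff)
  then obtain a b c d f where abcd: "xs = [a, b, c, d, f]" by (auto simp: length_Suc_conv numeral_eq_Suc)
  have B: "B = {a, b, c, d, f, \<one>}" and dist: "distinct [a, b, c, d, f, \<one>]"
    using xs one_in unfolding abcd by auto
  have m: "a \<in> B" "b \<in> B" "c \<in> B" "d \<in> B" "f \<in> B" using B by auto
  note cl = m[THEN B_carrier]
  define \<psi> :: "quad \<Rightarrow> 'a" where "\<psi> = (\<lambda>(x0, x1, x2, x3).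
    a [^] F3_nat x0 \<otimes> b [^] F3_nat x1 \<otimes> c [^] F3_nat x2 \<otimes> d [^] F3_nat x3)"
  have psi: "\<psi> (x0, x1, x2, x3) =
    a [^] F3_nat x0 \<otimes> b [^] F3_nat x1 \<otimes> c [^] F3_nat x2 \<otimes> d [^] F3_nat x3" for x0 x1 x2 x3
    by (simp add: \<psi>_def)
  have hom: "\<psi> (quad_add x y) = \<psi> x \<otimes> \<psi> y" for x y
    using cl by (cases x; cases y) (simp add: psi pow_F3_add m m_ac)
  have psi_cl: "\<psi> x \<in> carrier G" for x using cl by (cases x) (simp add: psi)
  have f: "f = a \<otimes> a \<otimes> (b \<otimes> b) \<otimes> (c \<otimes> c) \<otimes> (d \<otimes> d)"
  proof -
    have "f = f \<otimes> (a \<otimes> a \<otimes> a) \<otimes> (b \<otimes> b \<otimes> b) \<otimes> (c \<otimes> c \<otimes> c) \<otimes> (d \<otimes> d \<otimes> d)"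
      using cube_B m cl by simp
    also have "\<dots> = (a \<otimes> b \<otimes> c \<otimes> d \<otimes> f \<otimes> \<one>) \<otimes> (a \<otimes> a \<otimes> (b \<otimes> b) \<otimes> (c \<otimes> c) \<otimes> (d \<otimes> d))"
      using cl by (simp add: m_ac)
    finally show ?thesis unfolding zero_sum[OF B dist] using cl by simp
  qed
  have vals: "\<psi> (0, 0, 0, 0) = \<one>" "\<psi> (1, 0, 0, 0) = a" "\<psi> (0, 1, 0, 0) = b"
    "\<psi> (0, 0, 1, 0) = c" "\<psi> (0, 0, 0, 1) = d" "\<psi> (- 1, - 1, - 1, - 1) = f"
    using cl by (simp_all add: psi zero_F3_def one_F3_def f numeral_2_eq_2 m_assoc)
  have img: "\<psi> ` hexagon = B" by (simp only: hexagon_def image_insert image_empty vals B) auto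
  have closed: "x \<otimes> y \<in> range \<psi>" if "x \<in> range \<psi>" "y \<in> range \<psi>" for x y
  proof -
    obtain i j where "x = \<psi> i" "y = \<psi> j" using \<open>x \<in> range \<psi>\<close> \<open>y \<in> range \<psi>\<close> by blast
    then show ?thesis by (intro range_eqI[of _ _ "quad_add i j"]) (simp only: hom)
  qed
  have inB: "x \<in> range \<psi>" if "x \<in> B" for x using that img by blast
  have onto: "range \<psi> = carrier G"
  proof
    show "range \<psi> \<subseteq> carrier G" using psi_cl by auto
    show "carrier G \<subseteq> range \<psi>"
    proof
      fix g assume g: "g \<in> carrier G"
      then obtain x y u w where xyuw: "x \<in> B" "y \<in> B" "u \<in> B" "w \<in> B" "g \<otimes> (y \<otimes> w) = x \<otimes> u"
        using generated by blast
      note cx = xyuw(1-4)[THEN B_carrier]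
      have "g = g \<otimes> (y \<otimes> y \<otimes> y) \<otimes> (w \<otimes> w \<otimes> w)" using cube_B xyuw g by simp
      also have "\<dots> = (g \<otimes> (y \<otimes> w)) \<otimes> (y \<otimes> y) \<otimes> (w \<otimes> w)" using g cx by (simp add: m_ac)
      finally have "g = x \<otimes> u \<otimes> (y \<otimes> y) \<otimes> (w \<otimes> w)" unfolding xyuw(5) .
      then show "g \<in> range \<psi>" using closed inB xyuw by simp
    qed
  qed
  have "inj \<psi>"
    using onto card card_quad by (intro eq_card_imp_inj_on) (simp_all add: card_ge_0_finite)
  then show thesis using that onto hom img by (simp add: bij_betw_def)
qed

lemma geometry_iso_sym:
  assumes "geometry_iso f S T" and sub: "\<And>l. l \<in> lines S \<Longrightarrow> l \<subseteq> points S"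
  shows "geometry_iso (inv_into (points S) f) T S"
proof -
  have bij: "bij_betw f (points S) (points T)" and im: "(\<lambda>l. f ` l) ` lines S = lines T"
    using assms by (simp_all add: geometry_iso_def)
  have "inv_into (points S) f ` f ` l = l" if "l \<in> lines S" for l
    using sub[OF that] bij by (simp add: inv_into_image_cancel bij_betw_def)
  then have "(\<lambda>l. inv_into (points S) f ` l) ` lines T = lines S"
    unfolding im[symmetric] image_image by simp
  then show ?thesis using bij_betw_inv_into[OF bij] by (simp add: geometry_iso_def)
qed

lemma geometry_iso_trans:
  assumes "geometry_iso f S T" "geometry_iso g T U"
  shows "geometry_iso (g \<circ> f) S U"
proof -
  have "(\<lambda>l. (g \<circ> f) ` l) ` lines S = (\<lambda>l. g ` l) ` (\<lambda>l. f ` l) ` lines S" by (simp add: image_comp comp_def image_image)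
  then show ?thesis using assms bij_betw_trans by (auto simp: geometry_iso_def)
qed

lemma van_lint_schrijver_iso:
  assumes "field K" "field K'" and h: "h \<in> ring_iso K K'" and \<gamma>: "\<gamma> \<in> carrier K"
  shows "geometry_iso h (van_lint_schrijver K \<gamma>) (van_lint_schrijver K' (h \<gamma>))"
proof -
  interpret K: field K by fact
  interpret K': field K' by fact
  have hom: "h \<in> Ring.ring_hom K K'" and bij: "bij_betw h (carrier K) (carrier K')"
    using h by (simp_all add: ring_iso_def)
  have pow: "h (\<gamma> [^]\<^bsub>K\<^esub> k) = h \<gamma> [^]\<^bsub>K'\<^esub> k" for k :: nat
    by (induction k) (simp_all add: ring_hom_one[OF hom] ring_hom_mult[OF hom] \<gamma>)
  have line: "h ` {b, b \<oplus>\<^bsub>K\<^esub> \<one>\<^bsub>K\<^esub>, b \<oplus>\<^bsub>K\<^esub> \<gamma>, b \<oplus>\<^bsub>K\<^esub> \<gamma> [^]\<^bsub>K\<^esub> (2::nat),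
      b \<oplus>\<^bsub>K\<^esub> \<gamma> [^]\<^bsub>K\<^esub> (3::nat), b \<oplus>\<^bsub>K\<^esub> \<gamma> [^]\<^bsub>K\<^esub> (4::nat)}
    = {h b, h b \<oplus>\<^bsub>K'\<^esub> \<one>\<^bsub>K'\<^esub>, h b \<oplus>\<^bsub>K'\<^esub> h \<gamma>, h b \<oplus>\<^bsub>K'\<^esub> h \<gamma> [^]\<^bsub>K'\<^esub> (2::nat),
      h b \<oplus>\<^bsub>K'\<^esub> h \<gamma> [^]\<^bsub>K'\<^esub> (3::nat), h b \<oplus>\<^bsub>K'\<^esub> h \<gamma> [^]\<^bsub>K'\<^esub> (4::nat)}" if "b \<in> carrier K" for b
    using that \<gamma> by (simp add: ring_hom_add[OF hom] ring_hom_one[OF hom] pow)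
  have "carrier K' = h ` carrier K" using bij by (simp add: bij_betw_def)
  then show ?thesis using bij line
    by (simp add: geometry_iso_def van_lint_schrijver_def setcompr_eq_image image_image cong: image_cong)
qed

definition X81 :: quad where "X81 = (0, 1, 0, 0)"

lemma F81_power: "X81 [^]\<^bsub>F81\<^esub> (2::nat) = (0, 0, 1, 0)" "X81 [^]\<^bsub>F81\<^esub> (3::nat) = (0, 0, 0, 1)"
  "X81 [^]\<^bsub>F81\<^esub> (4::nat) = (- 1, - 1, - 1, - 1)" "X81 [^]\<^bsub>F81\<^esub> (5::nat) = \<one>\<^bsub>F81\<^esub>"
proof -
  interpret field F81 by (rule field_F81)
  have m: "quad_mult = (\<otimes>\<^bsub>F81\<^esub>)" "(1, 0, 0, 0) = \<one>\<^bsub>F81\<^esub>" by (simp_all add: F81_def)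
  note n = numeral_eq_Suc nat_pow_Suc nat_pow_0 m[symmetric] X81_def
  show "X81 [^]\<^bsub>F81\<^esub> (2::nat) = (0, 0, 1, 0)" "X81 [^]\<^bsub>F81\<^esub> (3::nat) = (0, 0, 0, 1)"
    "X81 [^]\<^bsub>F81\<^esub> (4::nat) = (- 1, - 1, - 1, - 1)" "X81 [^]\<^bsub>F81\<^esub> (5::nat) = \<one>\<^bsub>F81\<^esub>"
    by (simp_all add: n Let_def)
qed

lemma primitive_root_image:
  assumes "field K'" and h: "h \<in> ring_iso F81 K'"
  shows "primitive_root_of_unity K' 5 (h X81)"
proof -
  interpret F: field F81 by (rule field_F81)
  interpret K': field K' by fact
  interpret M: group "mult_of K'" by (rule K'.field_mult_group)
  have hom: "h \<in> Ring.ring_hom F81 K'" and bij: "bij_betw h (carrier F81) (carrier K')"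
    using h by (simp_all add: ring_iso_def)
  have X: "X81 \<in> carrier F81" by (simp add: F81_def)
  have inj: "h x = h y \<longleftrightarrow> x = y" for x y
    using bij_betw_imp_inj_on[OF bij] by (auto simp: F81_def inj_eq)
  have pow: "h (X81 [^]\<^bsub>F81\<^esub> k) = h X81 [^]\<^bsub>K'\<^esub> k" for k :: nat
    by (induction k) (simp_all add: ring_hom_one[OF hom] ring_hom_mult[OF hom] X)
  have h0: "h \<zero>\<^bsub>F81\<^esub> = \<zero>\<^bsub>K'\<^esub>" by (rule ring_hom_zero[OF hom F.ring_axioms K'.ring_axioms])
  have ne: "X81 \<noteq> \<zero>\<^bsub>F81\<^esub>" "X81 \<noteq> \<one>\<^bsub>F81\<^esub>" by (simp_all add: X81_def F81_def)
  have mem: "h X81 \<in> carrier (mult_of K')"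
    using ring_hom_closed[OF hom X] inj[of X81 "\<zero>\<^bsub>F81\<^esub>"] ne h0 by simp
  have "h X81 [^]\<^bsub>mult_of K'\<^esub> (5::nat) = \<one>\<^bsub>mult_of K'\<^esub>"
    using pow[of 5] F81_power(4) ring_hom_one[OF hom] by (simp add: nat_pow_mult_of)
  then have "M.ord (h X81) dvd 5" using M.pow_eq_id[OF mem] by simp
  moreover have "M.ord (h X81) \<noteq> 1"
    using M.ord_eq_1[OF mem] inj[of X81 "\<one>\<^bsub>F81\<^esub>"] ne ring_hom_one[OF hom] by simp
  moreover have "prime (5::nat)" by simp
  ultimately have "M.ord (h X81) = 5" using prime_nat_iff by metis
  then show ?thesis using mem by (simp add: primitive_root_of_unity_def)
qed

text \<open>The field is carried over to the natural numbers by an arbitrary injection.\<close>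
lemma is_van_lint_schrijverI:
  assumes "geometry_iso f S (van_lint_schrijver F81 X81)"
  shows "is_van_lint_schrijver S"
proof -
  interpret F: field F81 by (rule field_F81)
  define e :: "quad \<Rightarrow> nat" where "e = to_nat"
  have inj: "inj_on e (carrier F81)" unfolding e_def by (rule inj_on_subset[OF inj_to_nat]) simp
  define K where "K = image_ring e F81"
  have iso: "e \<in> ring_iso F81 K" unfolding K_def by (rule inj_imp_image_ring_iso[OF inj])
  have fld: "field K" unfolding K_def by (rule F.inj_imp_image_ring_is_field[OF inj])
  have "Coset.order K = 81"
    using card_image[OF inj] card_quad
    by (simp add: Coset.order_def K_def image_ring_carrier) (simp add: F81_def)
  moreover have "isomorphic S (van_lint_schrijver K (e X81))"
    using geometry_iso_trans[OF assms van_lint_schrijver_iso[OF field_F81 fld iso]]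
    by (auto simp: isomorphic_def F81_def)
  ultimately show ?thesis
    unfolding is_van_lint_schrijver_def using fld primitive_root_image[OF fld iso] by blast
qed

lemma van_lint_schrijver_F81:
  "points (van_lint_schrijver F81 X81) = UNIV"
  "lines (van_lint_schrijver F81 X81) = (\<lambda>b. quad_add b ` hexagon) ` UNIV"
proof -
  have F81 [simp]: "(\<oplus>\<^bsub>F81\<^esub>) = quad_add" "\<one>\<^bsub>F81\<^esub> = (1, 0, 0, 0)" "carrier F81 = UNIV" by (simp_all add: F81_def)
  have "quad_add b (0, 0, 0, 0) = b" for b using quad_zero quad_add_comm by metis
  then have eq: "{b, b \<oplus>\<^bsub>F81\<^esub> \<one>\<^bsub>F81\<^esub>, b \<oplus>\<^bsub>F81\<^esub> X81, b \<oplus>\<^bsub>F81\<^esub> X81 [^]\<^bsub>F81\<^esub> (2::nat), b \<oplus>\<^bsub>F81\<^esub> X81 [^]\<^bsub>F81\<^esub> (3::nat),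
      b \<oplus>\<^bsub>F81\<^esub> X81 [^]\<^bsub>F81\<^esub> (4::nat)} = quad_add b ` hexagon" for b
    by (simp only: hexagon_def image_insert image_empty F81_power) (simp add: X81_def del: quad_add.simps)
  show "lines (van_lint_schrijver F81 X81) = (\<lambda>b. quad_add b ` hexagon) ` UNIV"
    unfolding van_lint_schrijver_def geometry.simps setcompr_eq_image Collect_mem_eq eq F81(3) ..
qed (simp add: van_lint_schrijver_def F81_def)

context rigid_singer begin

text \<open>The lines are the 81 translates of a single line L through the base point, so it is enough that the coordinates
  carry \<open>hexagon\<close> to the elements moving the base point along L.\<close>
lemma hexad_van_lint_schrijver:
  assumes par: "s = 5" "t = 5" "\<alpha> = 2" and v: "card (points S) = 81"
  shows "is_van_lint_schrijver S"
proof -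
  have mG: "g \<otimes>\<^bsub>\<Gamma>\<^esub> h \<in> G" if "g \<in> G" "h \<in> G" for g h using A.m_closed that by simp
  have iG: "inv\<^bsub>\<Gamma>\<^esub> g \<in> G" if "g \<in> G" for g using A.inv_closed that by simp
  have eqG: "g = h" if "g \<in> G" "h \<in> G" "g p = h p" for g h
    using bij_betw_imp_inj_on[OF orbit_bij] that by (auto dest: inj_onD)
  have "card {l \<in> lines S. p \<in> l} \<noteq> 0" using card_lines_through[OF base] by simp
  then obtain L where L: "L \<in> lines S" "p \<in> L" by (auto simp: card_eq_0_iff)
  define B where "B = {g \<in> G. g p \<in> L}"
  have BG: "x \<in> G" if "x \<in> B" for x using that by (simp add: B_def)
  have LB: "L = (\<lambda>h. h p) ` B"
    using orbit_bij line_subset[OF L(1)] by (auto simp: B_def bij_betw_def)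
  have injB: "inj_on (\<lambda>h. h p) B" using eqG BG by (intro inj_onI) blast
  have card_B: "card B = 6" using card_image[OF injB] card_line[OF L(1)] par by (simp flip: LB)
  have finB: "finite B" using finite_G by (simp add: B_def)
  have "card (lines S) = card ((\<lambda>g. g ` L) ` G)"
  proof -
    have "inj_on (\<lambda>g. g ` L) G" using rigid_line L(1) by (intro inj_onI) blast
    then show ?thesis using count_flags card_G par by (simp add: card_image)
  qed
  \<comment> \<open>The translates of L are pairwise distinct, and there are as many of them as there are lines.\<close>
  then have linesL: "lines S = (\<lambda>g. g ` L) ` G"
    using G_line[OF _ L(1)] finite_lines by (intro card_seteq[symmetric]) auto
  have E_B: "E g \<noteq> 0 \<longleftrightarrow> (\<exists>u\<in>B. \<exists>w\<in>B. g \<otimes>\<^bsub>\<Gamma>\<^esub> w = u)" if g: "g \<in> G" for g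
  proof
    assume "E g \<noteq> 0"
    then obtain l where "l \<in> lines S" "p \<in> l" "g p \<in> l" using E_iff_line[OF g] by blast
    then obtain h where h: "h \<in> G" "p \<in> h ` L" "g p \<in> h ` L" unfolding linesL by blast
    then obtain x y where xy: "x \<in> L" "y \<in> L" "p = h x" "g p = h y" by blast
    obtain w u where "w \<in> B" "u \<in> B" "x = w p" "y = u p" using xy(1,2) unfolding LB by blast
    then have wu: "w \<in> B" "u \<in> B" "p = h (w p)" "g p = h (u p)" using xy(3,4) by simp_all
    have "h \<otimes>\<^bsub>\<Gamma>\<^esub> w = \<one>\<^bsub>\<Gamma>\<^esub>"
      using wu h BG mG base A.one_closed by (intro eqG) (simp_all add: mult_apply one_apply)
    moreover have hu: "g = h \<otimes>\<^bsub>\<Gamma>\<^esub> u"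
      using wu h BG mG base g by (intro eqG) (simp_all add: mult_apply)
    ultimately have "g \<otimes>\<^bsub>\<Gamma>\<^esub> w = u"
      using A.m_comm[of u w] A.m_assoc[of h w u] A.m_assoc[of h u w] h wu BG by simp
    then show "\<exists>u\<in>B. \<exists>w\<in>B. g \<otimes>\<^bsub>\<Gamma>\<^esub> w = u" using wu by blast
  next
    assume "\<exists>u\<in>B. \<exists>w\<in>B. g \<otimes>\<^bsub>\<Gamma>\<^esub> w = u"
    then obtain w where w: "w \<in> B" "g \<otimes>\<^bsub>\<Gamma>\<^esub> w \<in> B" by blast
    have "inv\<^bsub>\<Gamma>\<^esub> w \<otimes>\<^bsub>\<Gamma>\<^esub> (g \<otimes>\<^bsub>\<Gamma>\<^esub> w) = g"
      using A.m_comm[of g w] A.inv_solve_left[of g w "g \<otimes>\<^bsub>\<Gamma>\<^esub> w"] w BG g mG by simp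
    then have "(inv\<^bsub>\<Gamma>\<^esub> w) ((g \<otimes>\<^bsub>\<Gamma>\<^esub> w) p) = g p"
      using mult_apply[of "inv\<^bsub>\<Gamma>\<^esub> w" "g \<otimes>\<^bsub>\<Gamma>\<^esub> w" p] w BG iG base by simp
    moreover have "(inv\<^bsub>\<Gamma>\<^esub> w) (w p) = p" using inv_apply[of w p] w BG base by simp
    moreover have "w p \<in> L" "(g \<otimes>\<^bsub>\<Gamma>\<^esub> w) p \<in> L" using w by (simp_all add: B_def)
    ultimately have "p \<in> (inv\<^bsub>\<Gamma>\<^esub> w) ` L" "g p \<in> (inv\<^bsub>\<Gamma>\<^esub> w) ` L" by (metis imageI)+
    then show "E g \<noteq> 0" using E_iff_line[OF g] G_line[OF iG[OF BG[OF w(1)]] L(1)] by blast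
  qed
  have E_ratio: "E (inv\<^bsub>\<Gamma>\<^esub> h \<otimes>\<^bsub>\<Gamma>\<^esub> z) \<noteq> 0 \<longleftrightarrow> (\<exists>u\<in>B. \<exists>w\<in>B. z \<otimes>\<^bsub>\<Gamma>\<^esub> w = h \<otimes>\<^bsub>\<Gamma>\<^esub> u)"
    if hz: "h \<in> G" "z \<in> G" for h z
  proof -
    have "inv\<^bsub>\<Gamma>\<^esub> h \<otimes>\<^bsub>\<Gamma>\<^esub> z \<otimes>\<^bsub>\<Gamma>\<^esub> w = u \<longleftrightarrow> z \<otimes>\<^bsub>\<Gamma>\<^esub> w = h \<otimes>\<^bsub>\<Gamma>\<^esub> u" if "u \<in> B" "w \<in> B" for u w
      using A.m_assoc[of "inv\<^bsub>\<Gamma>\<^esub> h" z w] A.inv_solve_left'[of u h "z \<otimes>\<^bsub>\<Gamma>\<^esub> w"] hz that BG iG mG by simp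
    then show ?thesis using E_B[OF mG[OF iG[OF hz(1)] hz(2)]] by simp
  qed
  interpret H: hexad \<Gamma> B
  proof (intro hexad.intro hexad_axioms.intro, unfold carrier_\<Gamma>)
    show "comm_group \<Gamma>" by (rule A.comm_group_axioms)
    show "B \<subseteq> G" using BG by blast
    show "card B = 6" by (rule card_B)
    show "\<one>\<^bsub>\<Gamma>\<^esub> \<in> B" using A.one_closed one_apply[OF base] L(2) by (simp add: B_def)
    show "x = z" if m: "x \<in> B" "y \<in> B" "z \<in> B" "w \<in> B" and eq: "x \<otimes>\<^bsub>\<Gamma>\<^esub> w = z \<otimes>\<^bsub>\<Gamma>\<^esub> y" and ne: "x \<noteq> y" for x y z w
    proof -
      define g where "g = x \<otimes>\<^bsub>\<Gamma>\<^esub> inv\<^bsub>\<Gamma>\<^esub> y"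
      have g: "g \<in> G" using mG iG BG m by (simp add: g_def)
      have gy: "g \<otimes>\<^bsub>\<Gamma>\<^esub> y = x" using A.inv_solve_right[of g x y] g m BG by (simp add: g_def)
      have gw: "g \<otimes>\<^bsub>\<Gamma>\<^esub> w = z"
      proof -
        have "g \<otimes>\<^bsub>\<Gamma>\<^esub> w \<otimes>\<^bsub>\<Gamma>\<^esub> y = z \<otimes>\<^bsub>\<Gamma>\<^esub> y"
          unfolding eq[symmetric] gy[symmetric]
          using A.m_assoc[of g w y] A.m_assoc[of g y w] A.m_comm[of w y] g m BG by simp
        then show ?thesis using A.right_cancel[of y "g \<otimes>\<^bsub>\<Gamma>\<^esub> w" z] mG g m BG by simp
      qed
      have "g ` L \<noteq> L"
      proof
        assume "g ` L = L"
        then have "g = \<one>\<^bsub>\<Gamma>\<^esub>" using rigid_line[OF g _ L(1)] one_image[OF L(1)] A.one_closed by simp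
        then show False using gy ne A.l_one[of y] m BG by simp
      qed
      then have c: "card (g ` L \<inter> L) \<le> 1" by (intro card_inter G_line[OF g] L(1))
      have "x p \<in> g ` L" "z p \<in> g ` L"
        using mult_apply[OF g BG[OF m(2)] base] mult_apply[OF g BG[OF m(4)] base] gy gw m by (auto simp: B_def)
      moreover have "x p \<in> L" "z p \<in> L" using m by (simp_all add: B_def)
      ultimately have "x p = z p"
        using c finite_line[OF L(1)] card_le_Suc0_iff_eq[of "g ` L \<inter> L"] by auto
      then show ?thesis using eqG m BG by blast
    qed
    show "\<exists>x\<in>B. \<exists>y\<in>B. \<exists>u\<in>B. \<exists>w\<in>B. g \<otimes>\<^bsub>\<Gamma>\<^esub> (y \<otimes>\<^bsub>\<Gamma>\<^esub> w) = x \<otimes>\<^bsub>\<Gamma>\<^esub> u" if g: "g \<in> G" for g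
    proof -
      have "0 \<le> E g" by (simp add: E_def)
      then have "(\<Sum>h\<in>G. E h * E (inv\<^bsub>\<Gamma>\<^esub> h \<otimes>\<^bsub>\<Gamma>\<^esub> g)) \<noteq> 0" using E_conv[OF g] par by simp
      then obtain h where h: "h \<in> G" "E h * E (inv\<^bsub>\<Gamma>\<^esub> h \<otimes>\<^bsub>\<Gamma>\<^esub> g) \<noteq> 0" by (meson sum.neutral)
      then obtain x y u w where xy: "x \<in> B" "y \<in> B" "h \<otimes>\<^bsub>\<Gamma>\<^esub> y = x"
        and uw: "u \<in> B" "w \<in> B" "g \<otimes>\<^bsub>\<Gamma>\<^esub> w = h \<otimes>\<^bsub>\<Gamma>\<^esub> u"
        using E_B[OF h(1)] E_ratio[OF h(1) g] by auto
      have "g \<otimes>\<^bsub>\<Gamma>\<^esub> (y \<otimes>\<^bsub>\<Gamma>\<^esub> w) = (g \<otimes>\<^bsub>\<Gamma>\<^esub> w) \<otimes>\<^bsub>\<Gamma>\<^esub> y"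
        using A.m_comm[of y w] A.m_assoc[of g w y] xy uw g BG by simp
      also have "\<dots> = x \<otimes>\<^bsub>\<Gamma>\<^esub> u"
        unfolding uw(3) xy(3)[symmetric]
        using A.m_assoc[of h u y] A.m_assoc[of h y u] A.m_comm[of u y] xy uw h BG by simp
      finally show ?thesis using xy uw by blast
    qed
    show "card {q \<in> B. \<exists>u\<in>B. \<exists>w\<in>B. u \<noteq> w \<and> z \<otimes>\<^bsub>\<Gamma>\<^esub> w = q \<otimes>\<^bsub>\<Gamma>\<^esub> u} = 2" if z: "z \<in> G" "z \<notin> B" for z
    proof -
      have zL: "z p \<notin> L" using z by (simp add: B_def)
      have eq: "(\<exists>u\<in>B. \<exists>w\<in>B. u \<noteq> w \<and> z \<otimes>\<^bsub>\<Gamma>\<^esub> w = q \<otimes>\<^bsub>\<Gamma>\<^esub> u) \<longleftrightarrow> E (inv\<^bsub>\<Gamma>\<^esub> q \<otimes>\<^bsub>\<Gamma>\<^esub> z) \<noteq> 0"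
        and jc: "int (join_count (z p) (q p)) = (if E (inv\<^bsub>\<Gamma>\<^esub> q \<otimes>\<^bsub>\<Gamma>\<^esub> z) \<noteq> 0 then 1 else 0)" if q: "q \<in> B" for q
      proof -
        have "u \<noteq> w" if "u \<in> B" "w \<in> B" "z \<otimes>\<^bsub>\<Gamma>\<^esub> w = q \<otimes>\<^bsub>\<Gamma>\<^esub> u" for u w
          using that z q A.right_cancel[of w z q] BG by auto
        then show "(\<exists>u\<in>B. \<exists>w\<in>B. u \<noteq> w \<and> z \<otimes>\<^bsub>\<Gamma>\<^esub> w = q \<otimes>\<^bsub>\<Gamma>\<^esub> u) \<longleftrightarrow> E (inv\<^bsub>\<Gamma>\<^esub> q \<otimes>\<^bsub>\<Gamma>\<^esub> z) \<noteq> 0"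
          unfolding E_ratio[OF BG[OF q] z(1)] by blast
        have "z p \<noteq> q p" using zL q by (auto simp: B_def)
        then have "join_count (z p) (q p) \<le> 1" by (rule join_count_le_1)
        moreover have "join_count (z p) (q p) = join_count (q p) (z p)" by (simp add: conj_commute)
        ultimately show "int (join_count (z p) (q p)) = (if E (inv\<^bsub>\<Gamma>\<^esub> q \<otimes>\<^bsub>\<Gamma>\<^esub> z) \<noteq> 0 then 1 else 0)"
          using join_count_orbit[OF z(1) BG[OF q]] by (auto simp: le_Suc_eq)
      qed
      have "int 2 = int (\<Sum>y\<in>L. join_count (z p) y)"
        using sum_join_count_line[OF G_point[OF z(1) base] L(1)] zL par by simp
      also have "\<dots> = (\<Sum>q\<in>B. int (join_count (z p) (q p)))"
        by (subst LB) (simp add: sum.reindex[OF injB])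
      also have "\<dots> = (\<Sum>q\<in>B. if E (inv\<^bsub>\<Gamma>\<^esub> q \<otimes>\<^bsub>\<Gamma>\<^esub> z) \<noteq> 0 then 1 else 0)" by (intro sum.cong refl jc)
      also have "\<dots> = int (card {q \<in> B. E (inv\<^bsub>\<Gamma>\<^esub> q \<otimes>\<^bsub>\<Gamma>\<^esub> z) \<noteq> 0})"
        using finB by (simp add: sum.If_cases Int_def)
      also have "{q \<in> B. E (inv\<^bsub>\<Gamma>\<^esub> q \<otimes>\<^bsub>\<Gamma>\<^esub> z) \<noteq> 0}
        = {q \<in> B. \<exists>u\<in>B. \<exists>w\<in>B. u \<noteq> w \<and> z \<otimes>\<^bsub>\<Gamma>\<^esub> w = q \<otimes>\<^bsub>\<Gamma>\<^esub> u}" using eq by blast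
      finally show ?thesis by simp
    qed
  qed
  have "card (carrier \<Gamma>) = 81" using card_G v by simp
  then obtain \<psi> :: "quad \<Rightarrow> 'a \<Rightarrow> 'a" where psi: "bij_betw \<psi> UNIV (carrier \<Gamma>)"
    "\<And>x y. \<psi> (quad_add x y) = \<psi> x \<otimes>\<^bsub>\<Gamma>\<^esub> \<psi> y" "\<psi> ` hexagon = B"
    by (rule H.hexad_coordinates) blast
  have psiG: "\<psi> x \<in> G" for x using psi(1) by (auto simp: bij_betw_def)
  define \<phi> where "\<phi> x = \<psi> x p" for x
  have bij: "bij_betw \<phi> UNIV (points S)"
    using bij_betw_trans[OF psi(1)[unfolded carrier_\<Gamma>] orbit_bij] by (simp add: \<phi>_def[abs_def] comp_def)
  have "\<phi> ` quad_add b ` hexagon = \<psi> b ` L" for b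
  proof -
    have "\<phi> ` quad_add b ` hexagon = (\<lambda>h. \<psi> b (h p)) ` \<psi> ` hexagon"
      by (simp add: image_image \<phi>_def psi(2) mult_apply psiG base)
    then show ?thesis unfolding psi(3) LB by (simp add: image_image)
  qed
  then have "(\<lambda>l. \<phi> ` l) ` lines (van_lint_schrijver F81 X81) = (\<lambda>g. g ` L) ` range \<psi>"
    by (simp add: van_lint_schrijver_F81 image_image)
  also have "range \<psi> = G" using psi(1) by (simp add: bij_betw_def)
  finally have "geometry_iso \<phi> (van_lint_schrijver F81 X81) S"
    using bij by (simp add: geometry_iso_def van_lint_schrijver_F81 linesL)
  then have "geometry_iso (inv_into UNIV \<phi>) S (van_lint_schrijver F81 X81)"
    using geometry_iso_sym[of \<phi> "van_lint_schrijver F81 X81" S] by (simp add: van_lint_schrijver_F81)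
  then show ?thesis by (rule is_van_lint_schrijverI)
qed

end

theorem theorem7p1:
  fixes S :: "'a geometry" and G :: "('a \<Rightarrow> 'a) set" and s t \<alpha> :: nat
  assumes "proper_partial_geometry S s t \<alpha>"
    and "2 \<le> \<alpha>" and "\<alpha> \<le> 1000"
    and "abelian_singer_group S G"
    and "rigid_type S G"
  shows "is_van_lint_schrijver S \<or>
    (s, t, \<alpha>) \<in> {(11, 23, 3), (39, 39, 15), (272, 272, 104), (2295, 4591, 615)}"
proof -
  interpret P: proper_partial_geometry S s t \<alpha> by fact
  obtain p where "p \<in> points S" using P.points_nonempty by blast
  then interpret R: rigid_singer S s t \<alpha> G p
    using assms by unfold_locales
  obtain n where n: "card (lines S) = n * card (points S)" "t + 1 = n * (s + 1)" by (rule R.obtain_orbits)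
  interpret D: rigid_pds R.\<Gamma> R.E "int s + int t + 1 - int \<alpha>" "int \<alpha> * (int t + 1)"
    "int ((s + 1) * (t + 1))" "int t + 1" n "s + 1" \<alpha>
    by (rule R.rigid_pds_instance[OF n(2)])
  have "(n, s + 1, \<alpha>) \<in> {(1, 6, 2), (2, 12, 3), (1, 40, 15), (1, 273, 104), (2, 2296, 615)}"
    using D.rigid_parameters assms(3) by blast
  then consider "n = 1" "s = 5" "\<alpha> = 2" | "(s, t, \<alpha>) \<in> {(11, 23, 3), (39, 39, 15), (272, 272, 104), (2295, 4591, 615)}"
    using n(2) by auto
  then show ?thesis
  proof cases
    case 1
    then have t: "t = 5" using n(2) by simp
    have "card (points S) = 81"
      using D.order_eqI[of 81] 1 t R.card_G by (simp add: Coset.order_def)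
    then show ?thesis using R.hexad_van_lint_schrijver 1 t by blast
  qed blast
qed

end
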